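(* Let $m \ge 2$ and let $F_m$ be the free group of rank $m$. There exists an element $u \in F_m$ such that the following holds: if $\phi$ is an endomorphism of $F_m$, $\psi$ is an endomorphism of $F_m$ with non-cyclic image, and $\phi(u) = \psi(u)$, then $\phi$ also has non-cyclic image; more precisely, $\phi = \tau_S \circ \psi$ for some $S \in F_m$ such that the subgroup $\langle S, \psi(u) \rangle$ of $F_m$ is cyclic.
   Context: For $S \in F_m$, $\tau_S$ denotes the inner automorphism of $F_m$ defined by means of $S$, i.e. $\tau_S(X) = S X S^{-1}$ for $X\in F_m$. $\langle A, B\rangle$ denotes the subgroup generated by $A$ and $B$. The trivial group is cyclic. *)

theory Defs
  imports "HOL-Algebra.Elementary_Groups"
begin

section \<open>Free groups as groups of reduced words\<close>

text \<open>The letter \<open>(x, True)\<close> stands for the generator \<open>x\<close>, and \<open>(x, False)\<close> for its inverse.\<close>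

type_synonym 'a letter = "'a \<times> bool"

definition inv_letter :: "'a letter \<Rightarrow> 'a letter" where
  "inv_letter a = (fst a, \<not> snd a)"

fun reduced :: "'a letter list \<Rightarrow> bool" where
  "reduced [] \<longleftrightarrow> True"
| "reduced [a] \<longleftrightarrow> True"
| "reduced (a # b # w) \<longleftrightarrow> b \<noteq> inv_letter a \<and> reduced (b # w)"

text \<open>On a reduced word \<open>w\<close>, \<open>cons_reduce a w\<close> is the reduced form of \<open>a # w\<close>; hence
  \<open>foldr cons_reduce v w\<close> is the reduced form of the concatenation \<open>v @ w\<close>.\<close>

fun cons_reduce :: "'a letter \<Rightarrow> 'a letter list \<Rightarrow> 'a letter list" where
  "cons_reduce a [] = [a]"
| "cons_reduce a (b # w) = (if b = inv_letter a then w else a # b # w)"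

definition free_group :: "'a set \<Rightarrow> 'a letter list monoid" where
  "free_group X =
    \<lparr>carrier = {w. fst ` set w \<subseteq> X \<and> reduced w},
     mult = foldr cons_reduce,
     one = []\<rparr>"

definition inner_automorphism :: "('a, 'b) monoid_scheme \<Rightarrow> 'a \<Rightarrow> 'a \<Rightarrow> 'a" where
  "inner_automorphism G s x = s \<otimes>\<^bsub>G\<^esub> x \<otimes>\<^bsub>G\<^esub> inv\<^bsub>G\<^esub> s"


subsection \<open>Group laws\<close>

lemma inv_letter_inv_letter [simp]: "inv_letter (inv_letter a) = a"
  by (simp add: inv_letter_def)

lemma fst_inv_letter [simp]: "fst (inv_letter a) = fst a"
  by (simp add: inv_letter_def)

lemma inv_letter_neq [simp]: "inv_letter a \<noteq> a" "a \<noteq> inv_letter a"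
  by (cases a; simp add: inv_letter_def)+

lemma reduced_tl: "reduced (a # w) \<Longrightarrow> reduced w"
  by (cases w) auto

lemma reduced_cons_reduce: "reduced w \<Longrightarrow> reduced (cons_reduce a w)"
  by (cases w) (auto dest: reduced_tl)

lemma reduced_foldr_cons_reduce: "reduced w \<Longrightarrow> reduced (foldr cons_reduce v w)"
  by (induction v) (auto intro: reduced_cons_reduce)

lemma set_cons_reduce: "set (cons_reduce a w) \<subseteq> insert a (set w)"
  by (cases w) auto

lemma set_foldr_cons_reduce: "set (foldr cons_reduce v w) \<subseteq> set v \<union> set w"
proof (induction v)
  case (Cons a v)
  then show ?case using set_cons_reduce[of a "foldr cons_reduce v w"] by auto
qed auto

lemma cons_reduce_cancel:
  "reduced w \<Longrightarrow> cons_reduce a (cons_reduce (inv_letter a) w) = w"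
  by (cases w rule: reduced.cases) auto

lemma foldr_cons_reduce_cons_reduce:
  assumes "reduced w"
  shows "foldr cons_reduce (cons_reduce a v) w = cons_reduce a (foldr cons_reduce v w)"
proof (cases v)
  case (Cons b v')
  then show ?thesis
    using cons_reduce_cancel[OF reduced_foldr_cons_reduce[OF assms]] by simp
qed simp

lemma foldr_cons_reduce_assoc:
  assumes "reduced w"
  shows "foldr cons_reduce (foldr cons_reduce u v) w = foldr cons_reduce u (foldr cons_reduce v w)"
  by (induction u) (simp_all add: foldr_cons_reduce_cons_reduce assms)

lemma foldr_cons_reduce_Nil: "reduced w \<Longrightarrow> foldr cons_reduce w [] = w"
  by (induction w rule: reduced.induct) auto

lemma foldr_cons_reduce_inverse:
  "reduced w \<Longrightarrow> foldr cons_reduce (rev (map inv_letter w)) w = []"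
proof (induction w)
  case (Cons a w)
  then show ?case by (auto dest: reduced_tl)
qed simp

lemma reduced_inverse_word:
  assumes "reduced w"
  shows "foldr cons_reduce (foldr cons_reduce (rev (map inv_letter w)) []) w = []"
  by (simp add: foldr_cons_reduce_assoc foldr_cons_reduce_inverse assms)

theorem group_free_group: "group (free_group X)"
proof (rule groupI)
  fix u v assume "u \<in> carrier (free_group X)" "v \<in> carrier (free_group X)"
  then show "u \<otimes>\<^bsub>free_group X\<^esub> v \<in> carrier (free_group X)"
    using set_foldr_cons_reduce[of u v] by (fastforce simp: free_group_def reduced_foldr_cons_reduce)
next
  fix w assume w: "w \<in> carrier (free_group X)"
  let ?v = "foldr cons_reduce (rev (map inv_letter w)) []"
  have "fst ` set ?v \<subseteq> fst ` set w"
    using image_mono[OF set_foldr_cons_reduce[of "rev (map inv_letter w)" "[]"], of fst]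
    by (simp add: image_image)
  then have "?v \<in> carrier (free_group X)"
    using w by (auto simp: free_group_def intro: reduced_foldr_cons_reduce)
  moreover have "?v \<otimes>\<^bsub>free_group X\<^esub> w = \<one>\<^bsub>free_group X\<^esub>"
    using w by (simp add: free_group_def reduced_inverse_word)
  ultimately show "\<exists>v\<in>carrier (free_group X). v \<otimes>\<^bsub>free_group X\<^esub> w = \<one>\<^bsub>free_group X\<^esub>" by blast
qed (auto simp: free_group_def foldr_cons_reduce_assoc)


subsection \<open>Universal property\<close>

definition generator :: "'a \<Rightarrow> 'a letter list" where
  "generator x = [(x, True)]"

lemma generator_in_carrier: "x \<in> X \<Longrightarrow> generator x \<in> carrier (free_group X)"
  by (simp add: generator_def free_group_def)

definition letter_value :: "('b, 'c) monoid_scheme \<Rightarrow> ('a \<Rightarrow> 'b) \<Rightarrow> 'a letter \<Rightarrow> 'b" where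
  "letter_value G f a = (if snd a then f (fst a) else inv\<^bsub>G\<^esub> f (fst a))"

definition word_value :: "('b, 'c) monoid_scheme \<Rightarrow> ('a \<Rightarrow> 'b) \<Rightarrow> 'a letter list \<Rightarrow> 'b" where
  "word_value G f w = foldr (\<lambda>a y. letter_value G f a \<otimes>\<^bsub>G\<^esub> y) w \<one>\<^bsub>G\<^esub>"

context group
begin

lemma letter_value_closed:
  "f \<in> X \<rightarrow> carrier G \<Longrightarrow> fst a \<in> X \<Longrightarrow> letter_value G f a \<in> carrier G"
  by (auto simp: letter_value_def)

lemma word_value_closed:
  "f \<in> X \<rightarrow> carrier G \<Longrightarrow> fst ` set w \<subseteq> X \<Longrightarrow> word_value G f w \<in> carrier G"
  by (induction w) (auto simp: word_value_def letter_value_closed)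

lemma letter_value_inv_letter:
  assumes "f \<in> X \<rightarrow> carrier G" "fst a \<in> X"
  shows "letter_value G f a \<otimes> letter_value G f (inv_letter a) = \<one>"
  using assms by (auto simp: letter_value_def inv_letter_def Pi_iff)

lemma word_value_cons_reduce:
  assumes "f \<in> X \<rightarrow> carrier G" "fst a \<in> X" "fst ` set w \<subseteq> X"
  shows "word_value G f (cons_reduce a w) = letter_value G f a \<otimes> word_value G f w"
proof (cases "\<exists>v. w = inv_letter a # v")
  case True
  then obtain v where v: "w = inv_letter a # v" by blast
  with assms have c: "word_value G f v \<in> carrier G" "letter_value G f a \<in> carrier G"
    "letter_value G f (inv_letter a) \<in> carrier G"
    by (auto intro: word_value_closed letter_value_closed)
  have "letter_value G f a \<otimes> word_value G f w
      = (letter_value G f a \<otimes> letter_value G f (inv_letter a)) \<otimes> word_value G f v"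
    using c by (simp add: v word_value_def m_assoc)
  then show ?thesis
    using c letter_value_inv_letter[OF assms(1,2)] by (simp add: v)
next
  case False
  then have "cons_reduce a w = a # w" by (cases w) auto
  then show ?thesis by (simp add: word_value_def)
qed

lemma word_value_hom:
  assumes f: "f \<in> X \<rightarrow> carrier G"
  shows "word_value G f \<in> hom (free_group X) G"
proof (rule homI)
  fix u v assume "u \<in> carrier (free_group X)" "v \<in> carrier (free_group X)"
  then have u: "fst ` set u \<subseteq> X" and v: "fst ` set v \<subseteq> X" by (auto simp: free_group_def)
  have "word_value G f (foldr cons_reduce u v) = word_value G f u \<otimes> word_value G f v"
    using u
  proof (induction u)
    case Nil
    then show ?case using word_value_closed[OF f v] by (simp add: word_value_def)
  next
    case (Cons a u)
    have "fst ` set (foldr cons_reduce u v) \<subseteq> X"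
      using set_foldr_cons_reduce[of u v] Cons.prems v by fastforce
    then have "word_value G f (foldr cons_reduce (a # u) v)
        = letter_value G f a \<otimes> word_value G f (foldr cons_reduce u v)"
      using word_value_cons_reduce[OF f] Cons.prems by simp
    also have "\<dots> = letter_value G f a \<otimes> (word_value G f u \<otimes> word_value G f v)"
      using Cons by simp
    also have "\<dots> = (letter_value G f a \<otimes> word_value G f u) \<otimes> word_value G f v"
      using Cons.prems f v by (intro m_assoc[symmetric]) (auto intro: letter_value_closed word_value_closed)
    finally show ?case by (simp add: word_value_def)
  qed
  then show "word_value G f (u \<otimes>\<^bsub>free_group X\<^esub> v) = word_value G f u \<otimes> word_value G f v"
    by (simp add: free_group_def)
qed (use f in \<open>auto simp: free_group_def intro: word_value_closed\<close>)

lemma word_value_generator: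
  "f \<in> X \<rightarrow> carrier G \<Longrightarrow> x \<in> X \<Longrightarrow> word_value G f (generator x) = f x"
  by (auto simp: word_value_def letter_value_def generator_def Pi_iff)

lemma hom_free_group_eq_word_value:
  assumes h: "h \<in> hom (free_group X) G" and w: "w \<in> carrier (free_group X)"
  shows "h w = word_value G (\<lambda>x. h (generator x)) w"
proof -
  interpret F: group "free_group X" by (rule group_free_group)
  interpret h: group_hom "free_group X" G h
    using h by unfold_locales
  have inv_gen: "inv\<^bsub>free_group X\<^esub> generator x = [(x, False)]" if "x \<in> X" for x
    using that by (intro F.inv_equality) (auto simp: free_group_def generator_def inv_letter_def)
  show ?thesis
    using w
  proof (induction w)
    case Nil
    then show ?case using h.hom_one by (simp add: word_value_def free_group_def)
  next
    case (Cons a w)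
    then have x: "fst a \<in> X" and red: "reduced (a # w)" and w: "w \<in> carrier (free_group X)"
      by (auto simp: free_group_def dest: reduced_tl)
    have a: "[a] \<in> carrier (free_group X)" using x by (simp add: free_group_def)
    have "a # w = [a] \<otimes>\<^bsub>free_group X\<^esub> w"
      using red by (cases w) (auto simp: free_group_def)
    then have "h (a # w) = h [a] \<otimes> h w" using a w by simp
    moreover have "h [a] = letter_value G (\<lambda>x. h (generator x)) a"
    proof (cases "snd a")
      case True
      then show ?thesis by (cases a) (simp add: letter_value_def generator_def)
    next
      case False
      then have "[a] = inv\<^bsub>free_group X\<^esub> generator (fst a)" using inv_gen[OF x] by (cases a) simp
      then have "h [a] = inv (h (generator (fst a)))"
        using h.hom_inv[OF generator_in_carrier[OF x]] by simp
      then show ?thesis using False by (simp add: letter_value_def)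
    qed
    ultimately show ?case using Cons.IH[OF w] by (simp add: word_value_def)
  qed
qed

theorem free_group_hom_exists:
  assumes "f \<in> X \<rightarrow> carrier G"
  shows "\<exists>h\<in>hom (free_group X) G. \<forall>x\<in>X. h (generator x) = f x"
  using word_value_hom[OF assms] word_value_generator[OF assms] by blast

theorem free_group_hom_unique:
  assumes h: "h \<in> hom (free_group X) G" "h' \<in> hom (free_group X) G"
    and eq: "\<And>x. x \<in> X \<Longrightarrow> h (generator x) = h' (generator x)"
    and w: "w \<in> carrier (free_group X)"
  shows "h w = h' w"
proof -
  have "word_value G (\<lambda>x. h (generator x)) w = word_value G (\<lambda>x. h' (generator x)) w"
    unfolding word_value_def
    using w eq by (intro foldr_cong) (auto simp: letter_value_def free_group_def)
  then show ?thesis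
    using h w by (simp add: hom_free_group_eq_word_value)
qed

end

end

theory Submission
  imports Defs
begin

text \<open>The element \<open>u\<close> is a word in the generators, and an endomorphism is the tuple of its values on the
generators, so the claim concerns two tuples \<open>f\<close> and \<open>g\<close> in a free group with \<open>u(f) = u(g)\<close>, where \<open>g\<close>
does not commute: they must be conjugate. The conjugator then commutes with the common value
of \<open>u\<close>, and commuting elements of a free group lie in one cyclic subgroup.

The word has the shape
\<open>c^P d c^(2E) d c^E d c^E x_0 c^E d \<dots> c^E x_(m-1) c^E d c^E s c^E\<close>
for exponents \<open>P\<close> much larger than \<open>E\<close>. Three properties of the words \<open>c\<close> and \<open>d\<close>, for all tuples \<open>f\<close>,
make it work: if \<open>f\<close> commutes, then \<open>c(f) = 1\<close>; if \<open>f\<close> does not commute, then \<open>d(f)\<close> does not commute with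
\<open>c(f)\<close>; and, in that case, after a conjugation \<open>c(f)\<close> becomes a cyclically reduced word \<open>v\<close> while all
the \<open>x_i(f)\<close>, \<open>d(f)\<close> and \<open>s(f)\<close> are no longer than \<open>K\<close> times \<open>v\<close>, with a constant \<open>K\<close> independent of \<open>f\<close>.
Hence up to conjugation \<open>u(f)\<close> is a cyclically reduced word that consists of long \<open>v\<close>-periodic runs
with short separators between them. The word \<open>s\<close> is the inverse of the product of the other separators,
so that \<open>u\<close> vanishes on commuting tuples; it does not vanish on the others.

Suppose \<open>u(f) = u(g)\<close>, with periods \<open>v\<close> and \<open>w\<close>. The two cyclic words agree up to a rotation
(\<open>conj_rotate\<close>), and the runs of exponent \<open>P\<close> are so long that they overlap; so \<open>v\<close> and \<open>w\<close> are powers of a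
common root (\<open>two_periods_commute\<close>, used in \<open>rotated_match\<close>). A run ends at the separator \<open>d\<close>, because \<open>d\<close> does not commute
with the root. Comparing where the first three runs end yields \<open>v = w\<close> and aligns the words exactly
(\<open>three_exits\<close>). Then the separators \<open>x_i\<close> are read off one after the other (\<open>separators_equal\<close>).
All these comparisons rest on one observation: if \<open>X\<close> and \<open>f X\<close> both begin with a long
\<open>r\<close>-periodic piece, then \<open>f\<close> commutes with \<open>r\<close> (\<open>comm_of_periodic\<close>).

It remains to find \<open>c\<close> and \<open>d\<close> (\<open>controlling_pair\<close>). At a point of the Cayley tree where the largest
displacement of a nontrivial tuple is minimal, that displacement is at most three times the translation length
of some \<open>x_i\<close> or \<open>x_i x_j\<close> (\<open>joint_displacement\<close>). So it suffices that the translation length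
of \<open>c\<close> is at least that of each word in this finite list. The commutator of the cubes of \<open>a\<close> and \<open>b\<close> is trivial
if \<open>a\<close> and \<open>b\<close> commute, and otherwise its translation length is at least that of \<open>a\<close> and of \<open>b\<close>. Iterated
commutators of this kind form a list of words whose first nontrivial value is as long as required
(\<open>candidate_list\<close>). A product \<open>q_1^(n_1) q_2^(n_2) \<dots>\<close> with sufficiently large exponents inherits this from
its first nontrivial factor (\<open>dominant_word\<close>). This gives \<open>d\<close>. A second application, to the
commutators of the cubes of \<open>d\<close> and the \<open>x_i\<close>, gives \<open>c\<close>.\<close>

section \<open>The type of reduced words\<close>

text \<open>As a type, the free group on all generators has group laws without membership conditions.\<close>

typedef 'a fg = "{w :: 'a letter list. reduced w}" morphisms wd fg_of
  by (rule exI[of _ "[]"]) simp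

lemma reduced_wd [simp]: "reduced (wd x)"
  using wd[of x] by simp

instantiation fg :: (type) "{monoid_mult, inverse}"
begin

definition one_fg :: "'a fg" where "1 = fg_of []"
definition times_fg :: "'a fg \<Rightarrow> 'a fg \<Rightarrow> 'a fg" where
  "x * y = fg_of (foldr cons_reduce (wd x) (wd y))"
definition inverse_fg :: "'a fg \<Rightarrow> 'a fg" where
  "inverse x = fg_of (foldr cons_reduce (rev (map inv_letter (wd x))) [])"
definition divide_fg :: "'a fg \<Rightarrow> 'a fg \<Rightarrow> 'a fg" where
  "divide x y = x * inverse (y :: 'a fg)"

lemma wd_one [simp]: "wd (1 :: 'a fg) = []"
  by (simp add: one_fg_def fg_of_inverse)

lemma wd_times: "wd (x * y :: 'a fg) = foldr cons_reduce (wd x) (wd y)"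
  by (simp add: times_fg_def fg_of_inverse reduced_foldr_cons_reduce)

instance
proof
  fix x y z :: "'a fg"
  show "x * y * z = x * (y * z)"
    by (simp add: wd_inject[symmetric] wd_times foldr_cons_reduce_assoc)
  show "1 * x = x" "x * 1 = x"
    by (simp_all add: wd_inject[symmetric] wd_times foldr_cons_reduce_Nil)
qed

end

lemma fg_left_inverse [simp]: "inverse x * x = (1 :: 'a fg)"
  by (simp add: wd_inject[symmetric] wd_times inverse_fg_def fg_of_inverse
      reduced_foldr_cons_reduce reduced_inverse_word)

lemma fg_left_inverse_mult [simp]: "inverse x * (x * y) = (y :: 'a fg)"
  by (simp add: mult.assoc[symmetric])

lemma fg_right_inverse [simp]: "x * inverse x = (1 :: 'a fg)"
proof -
  have "x * inverse x = (inverse (inverse x) * inverse x) * (x * inverse x)" by simp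
  also have "\<dots> = inverse (inverse x) * ((inverse x * x) * inverse x)"
    by (simp only: mult.assoc)
  also have "\<dots> = 1" by simp
  finally show ?thesis .
qed

lemma fg_right_inverse_mult [simp]: "x * (inverse x * y) = (y :: 'a fg)"
  by (simp add: mult.assoc[symmetric])

lemma fg_left_cancel [simp]: "x * y = x * z \<longleftrightarrow> y = (z :: 'a fg)"
  by (metis fg_left_inverse_mult)

lemma fg_right_cancel [simp]: "y * x = z * x \<longleftrightarrow> y = (z :: 'a fg)"
  by (metis fg_right_inverse mult.assoc mult.right_neutral)

lemma fg_inverse_unique: "x * y = 1 \<Longrightarrow> inverse x = (y :: 'a fg)"
  by (metis fg_left_inverse_mult mult.right_neutral)

lemma fg_inverse_inverse [simp]: "inverse (inverse x) = (x :: 'a fg)"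
  by (rule fg_inverse_unique) simp

lemma fg_inverse_mult [simp]: "inverse (x * y) = inverse y * inverse (x :: 'a fg)"
  by (rule fg_inverse_unique) (simp add: mult.assoc)

lemma fg_inverse_one [simp]: "inverse 1 = (1 :: 'a fg)"
  by (rule fg_inverse_unique) simp

lemma fg_inverse_eq_1_iff [simp]: "inverse x = 1 \<longleftrightarrow> x = (1 :: 'a fg)"
  by (metis fg_inverse_one fg_inverse_inverse)

lemma fg_inverse_power: "inverse (x ^ n) = inverse (x :: 'a fg) ^ n"
  by (induction n) (simp_all add: power_commutes[symmetric])

section \<open>Commutation and conjugation\<close>

definition comm :: "'a fg \<Rightarrow> 'a fg \<Rightarrow> bool" where
  "comm x y \<longleftrightarrow> x * y = y * x"

lemma comm_sym: "comm x y \<Longrightarrow> comm y x"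
  by (simp add: comm_def)

lemma comm_refl [simp]: "comm x x" and comm_one [simp]: "comm 1 x" "comm x 1"
  by (simp_all add: comm_def)

lemma comm_mult: "comm x z \<Longrightarrow> comm y z \<Longrightarrow> comm (x * y) z"
  unfolding comm_def by (metis mult.assoc)

lemma comm_inverse: "comm x z \<Longrightarrow> comm (inverse x) z"
  unfolding comm_def by (metis fg_right_inverse_mult fg_right_cancel fg_left_inverse mult.assoc mult.right_neutral)

lemma comm_power: "comm x z \<Longrightarrow> comm (x ^ n) z"
  by (induction n) (auto intro: comm_mult)

lemma comm_inverse_iff [simp]: "comm (inverse x) z \<longleftrightarrow> comm x z" "comm z (inverse x) \<longleftrightarrow> comm z x"
  by (metis comm_inverse comm_sym fg_inverse_inverse)+

text \<open>The inverse stands on the left: \<open>len (conj_by T x)\<close> is the distance by which \<open>x\<close> displaces the vertex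
  \<open>T\<close> of the Cayley tree.\<close>

definition conj_by :: "'a fg \<Rightarrow> 'a fg \<Rightarrow> 'a fg" where
  "conj_by T x = inverse T * x * T"

lemma conj_by_mult: "conj_by T (x * y) = conj_by T x * conj_by T y"
  by (simp add: conj_by_def mult.assoc)

lemma conj_by_one [simp]: "conj_by T 1 = 1"
  by (simp add: conj_by_def)

lemma conj_by_inverse: "conj_by T (inverse x) = inverse (conj_by T x)"
  by (simp add: conj_by_def mult.assoc)

lemma conj_by_power: "conj_by T (x ^ n) = conj_by T x ^ n"
  by (induction n) (simp_all add: conj_by_mult)

lemma conj_by_conj_by: "conj_by S (conj_by T x) = conj_by (T * S) x"
  by (simp add: conj_by_def mult.assoc)

lemma conj_by_trivial [simp]: "conj_by 1 x = x"
  by (simp add: conj_by_def)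

lemma conj_by_eq_1_iff [simp]: "conj_by T x = 1 \<longleftrightarrow> x = 1"
proof
  assume "conj_by T x = 1"
  then have "conj_by (inverse T) (conj_by T x) = 1" by simp
  then show "x = 1" by (simp add: conj_by_conj_by)
qed simp

lemma conj_by_eq_iff [simp]: "conj_by T x = conj_by T y \<longleftrightarrow> x = y"
  by (simp add: conj_by_def)

lemma comm_conj_by_iff [simp]: "comm (conj_by T x) (conj_by T y) \<longleftrightarrow> comm x y"
  by (simp add: comm_def conj_by_mult[symmetric])

lemma conj_by_comm: "comm T x \<Longrightarrow> conj_by T x = x"
  by (simp add: conj_by_def comm_def mult.assoc) (metis fg_left_inverse_mult)

section \<open>Words and lengths\<close>

definition inv_word :: "'a letter list \<Rightarrow> 'a letter list" where
  "inv_word w = rev (map inv_letter w)"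

lemma inv_word_simps [simp]: "inv_word [] = []" "inv_word (a # w) = inv_word w @ [inv_letter a]"
  "inv_word (v @ w) = inv_word w @ inv_word v" "length (inv_word w) = length w"
  "inv_word w = [] \<longleftrightarrow> w = []"
  by (simp_all add: inv_word_def)

lemma inv_word_inv_word [simp]: "inv_word (inv_word w) = w"
  by (induction w) auto

lemma inv_letter_eq_iff [simp]: "inv_letter a = inv_letter b \<longleftrightarrow> a = b"
  by (metis inv_letter_inv_letter)

lemma reduced_Cons: "reduced (a # w) \<longleftrightarrow> reduced w \<and> (w = [] \<or> hd w \<noteq> inv_letter a)"
  by (cases w) auto

lemma reduced_append:
  "reduced (v @ w) \<longleftrightarrow> reduced v \<and> reduced w \<and> (v = [] \<or> w = [] \<or> hd w \<noteq> inv_letter (last v))"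
  by (induction v) (auto simp: reduced_Cons)

lemma hd_inv_word: "w \<noteq> [] \<Longrightarrow> hd (inv_word w) = inv_letter (last w)"
  and last_inv_word: "w \<noteq> [] \<Longrightarrow> last (inv_word w) = inv_letter (hd w)"
  by (simp_all add: inv_word_def hd_rev last_rev last_map hd_map)

lemma reduced_inv_word [simp]: "reduced (inv_word w) \<longleftrightarrow> reduced w"
proof -
  have "reduced w \<Longrightarrow> reduced (inv_word w)" for w :: "'a letter list"
    by (induction w) (auto simp: reduced_Cons reduced_append last_inv_word)
  from this[of w] this[of "inv_word w"] show ?thesis by auto
qed

definition mk :: "'a letter list \<Rightarrow> 'a fg" where
  "mk w = fg_of (foldr cons_reduce w [])"

lemma wd_mk: "wd (mk w) = foldr cons_reduce w []"
  by (simp add: mk_def fg_of_inverse reduced_foldr_cons_reduce)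

lemma wd_mk_reduced [simp]: "reduced w \<Longrightarrow> wd (mk w) = w"
  by (simp add: wd_mk foldr_cons_reduce_Nil)

lemma mk_wd [simp]: "mk (wd x) = x"
  by (simp add: wd_inject[symmetric])

lemma mk_Nil [simp]: "mk [] = 1"
  by (simp add: wd_inject[symmetric])

lemma mk_append: "mk (v @ w) = mk v * mk w"
proof -
  have "foldr cons_reduce v (foldr cons_reduce w []) =
      foldr cons_reduce (foldr cons_reduce v []) (foldr cons_reduce w [])"
    by (simp add: foldr_cons_reduce_assoc reduced_foldr_cons_reduce)
  then show ?thesis by (simp add: wd_inject[symmetric] wd_times wd_mk)
qed

lemma mk_inv_word: "mk (inv_word w) = inverse (mk w)"
proof -
  have "mk w * mk (inv_word w) = 1"
  proof (induction w)
    case (Cons a w)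
    have a: "mk [a] * mk [inv_letter a] = 1"
      by (simp add: mk_append[symmetric] wd_inject[symmetric] wd_mk)
    have "mk (a # w) * mk (inv_word (a # w)) = mk [a] * (mk w * mk (inv_word w)) * mk [inv_letter a]"
      using mk_append[of "[a]" w] by (simp add: mk_append mult.assoc)
    with Cons a show ?case by simp
  qed simp
  then show ?thesis by (metis fg_inverse_unique)
qed

lemma wd_inverse: "wd (inverse x) = inv_word (wd x)"
  by (metis mk_inv_word mk_wd reduced_inv_word reduced_wd wd_mk_reduced)

lemma wd_eq_Nil_iff [simp]: "wd x = [] \<longleftrightarrow> x = 1"
  by (metis wd_inject wd_one)

definition len :: "'a fg \<Rightarrow> nat" where
  "len x = length (wd x)"

lemma len_one [simp]: "len 1 = 0" and len_inverse [simp]: "len (inverse x) = len x"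
  and len_eq_0_iff [simp]: "len x = 0 \<longleftrightarrow> x = 1"
  by (simp_all add: len_def wd_inverse)

lemma len_pos_iff [simp]: "0 < len x \<longleftrightarrow> x \<noteq> 1"
  by (metis len_eq_0_iff neq0_conv)

text \<open>Since both factors are reduced, cancellation happens only at the junction: a suffix of \<open>x\<close> meets its
  inverse at the front of \<open>y\<close>.\<close>

lemma cancellation:
  obtains a b c where "wd x = a @ b" "wd y = inv_word b @ c" "wd (x * y) = a @ c"
proof -
  have "reduced v \<Longrightarrow> reduced w \<Longrightarrow>
      \<exists>a b c. v = a @ b \<and> w = inv_word b @ c \<and> foldr cons_reduce v w = a @ c" for v w :: "'a letter list"
  proof (induction v)
    case Nil
    then show ?case by simp
  next
    case (Cons l v)
    then obtain a b c where *: "v = a @ b" "w = inv_word b @ c" "foldr cons_reduce v w = a @ c"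
      by (auto simp: reduced_Cons)
    show ?case
    proof (cases a)
      case (Cons l' a')
      with * Cons.prems have "l # v = (l # a) @ b \<and> w = inv_word b @ c \<and> foldr cons_reduce (l # v) w = (l # a) @ c"
        by auto
      then show ?thesis by blast
    next
      case Nil
      show ?thesis
      proof (cases "c \<noteq> [] \<and> hd c = inv_letter l")
        case True
        then obtain c' where c: "c = inv_letter l # c'" by (cases c) auto
        with * Nil have "l # v = [] @ (l # b) \<and> w = inv_word (l # b) @ c' \<and> foldr cons_reduce (l # v) w = [] @ c'"
          by auto
        then show ?thesis by blast
      next
        case False
        with * Nil have "l # v = [l] @ b \<and> w = inv_word b @ c \<and> foldr cons_reduce (l # v) w = [l] @ c"
          by (cases c) auto
        then show ?thesis by blast
      qed
    qed
  qed
  from this[of "wd x" "wd y"] that show ?thesis by (auto simp: wd_times)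
qed

lemma len_mult_le: "len (x * y) \<le> len x + len y"
proof -
  obtain a b c where "wd x = a @ b" "wd y = inv_word b @ c" "wd (x * y) = a @ c"
    by (rule cancellation)
  then show ?thesis by (simp add: len_def)
qed

lemma len_power_le: "len (x ^ n) \<le> n * len x"
proof (induction n)
  case (Suc n)
  then show ?case using len_mult_le[of x "x ^ n"] by simp
qed simp

lemma len_conj_by_le: "len (conj_by T x) \<le> len x + 2 * len T"
  using len_mult_le[of "inverse T * x" T] len_mult_le[of "inverse T" x] by (simp add: conj_by_def)

lemma wd_mult_reduced: "reduced (wd x @ wd y) \<Longrightarrow> wd (x * y) = wd x @ wd y"
  by (metis mk_append mk_wd wd_mk_reduced)

section \<open>Cyclically reduced elements\<close>

definition cyc_reduced :: "'a fg \<Rightarrow> bool" where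
  "cyc_reduced x \<longleftrightarrow> x = 1 \<or> hd (wd x) \<noteq> inv_letter (last (wd x))"

lemma cyc_one [simp]: "cyc_reduced 1"
  by (simp add: cyc_reduced_def)

lemma cyc_inverse: "cyc_reduced x \<Longrightarrow> cyc_reduced (inverse x)"
  by (auto simp: cyc_reduced_def wd_inverse hd_inv_word last_inv_word)

lemma not_cyc_decomp:
  assumes "\<not> cyc_reduced x"
  obtains s w where "wd x = s # w @ [inv_letter s]" "w \<noteq> []" "reduced w" "x \<noteq> 1"
proof -
  from assms have x: "wd x \<noteq> []" and h: "hd (wd x) = inv_letter (last (wd x))"
    by (auto simp: cyc_reduced_def)
  then obtain s v where v: "wd x = s # v" by (cases "wd x") auto
  with h have "v \<noteq> []" by (auto split: if_splits)
  with v h obtain w where w: "wd x = s # w @ [inv_letter s]"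
    by (metis append_butlast_last_id inv_letter_inv_letter last_ConsR list.sel(1))
  have "reduced (wd x)" by simp
  then have "w \<noteq> [] \<and> reduced w"
    unfolding w by (auto simp: reduced_Cons reduced_append)
  moreover have "x \<noteq> 1" using x by auto
  ultimately show ?thesis using w that by blast
qed

lemma conj_by_letter: "wd x = s # w @ [inv_letter s] \<Longrightarrow> conj_by (mk [s]) x = mk w"
proof -
  assume w: "wd x = s # w @ [inv_letter s]"
  then have "wd x = [s] @ w @ inv_word [s]" by simp
  then have "x = mk ([s] @ w @ inv_word [s])" by (metis mk_wd)
  then have "x = mk [s] * (mk w * inverse (mk [s]))" by (simp only: mk_append mk_inv_word)
  then show ?thesis by (simp add: conj_by_def mult.assoc)
qed

lemma len_mk_reduced: "reduced w \<Longrightarrow> len (mk w) = length w"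
  by (simp add: len_def)

lemma len_mk_le: "len (mk w) \<le> length w"
proof (induction w)
  case (Cons a w)
  have "len (mk [a]) = 1" by (simp add: len_mk_reduced)
  with Cons show ?case using len_mult_le[of "mk [a]" "mk w"] mk_append[of "[a]" w] by simp
qed (simp add: len_def)

text \<open>Stripping a first letter that is inverse to the last one shortens the word by two. The bound on \<open>S\<close>
  keeps the displacement of other elements under control when the base point moves to the axis of \<open>x\<close>.\<close>

lemma exists_cyc: "\<exists>S. cyc_reduced (conj_by S x) \<and> len S \<le> len x"
proof (induction "len x" arbitrary: x rule: less_induct)
  case less
  show ?case
  proof (cases "cyc_reduced x")
    case True
    then show ?thesis by (intro exI[of _ 1]) simp
  next
    case False
    then obtain s w where w: "wd x = s # w @ [inv_letter s]" "reduced w" by (rule not_cyc_decomp)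
    have l: "len (mk w) + 2 = len x" using w by (simp add: len_def)
    then obtain S where S: "cyc_reduced (conj_by S (mk w))" "len S \<le> len (mk w)" using less[of "mk w"] by auto
    have "len (mk [s] * S) \<le> len x" using len_mult_le[of "mk [s]" S] S l by (simp add: len_mk_reduced)
    moreover have "cyc_reduced (conj_by (mk [s] * S) x)" using S conj_by_letter[OF w(1)] by (simp add: conj_by_conj_by[symmetric])
    ultimately show ?thesis by blast
  qed
qed

lemma cyc_rotate:
  assumes "cyc_reduced x" "wd x = a @ b"
  shows "cyc_reduced (conj_by (mk a) x)" "wd (conj_by (mk a) x) = b @ a"
proof -
  have x: "x = mk a * mk b" using assms(2) by (metis mk_append mk_wd)
  have "reduced (a @ b)" using assms(2) by (metis reduced_wd)
  then have r: "reduced (b @ a)"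
    using assms by (auto simp: reduced_append cyc_reduced_def)
  have "conj_by (mk a) x = mk (b @ a)" by (simp add: x conj_by_def mk_append mult.assoc)
  then show w: "wd (conj_by (mk a) x) = b @ a" using r by simp
  show "cyc_reduced (conj_by (mk a) x)"
  proof (cases "a = [] \<or> b = []")
    case True
    then show ?thesis using assms x by (auto simp: conj_by_def)
  next
    case False
    then show ?thesis using w \<open>reduced (a @ b)\<close> by (auto simp: cyc_reduced_def reduced_append)
  qed
qed

text \<open>The vertex \<open>mk [s]\<close> is the neighbour of the base point on the axis of \<open>x\<close>, on one side or the other.\<close>

lemma cyc_rotate_letter:
  assumes "cyc_reduced x" "x \<noteq> 1" "hd (wd x) = s \<or> last (wd x) = inv_letter s"
  shows "cyc_reduced (conj_by (mk [s]) x) \<and> len (conj_by (mk [s]) x) = len x"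
  using assms(3)
proof
  assume "hd (wd x) = s"
  then obtain b where "wd x = [s] @ b" using assms(2) by (cases "wd x") auto
  from cyc_rotate[OF assms(1) this] this show ?thesis by (simp add: len_def)
next
  assume "last (wd x) = inv_letter s"
  then obtain b where b: "wd x = b @ inv_word [s]" using assms(2)
    by (metis append_butlast_last_id append_Nil inv_word_simps(1,2) wd_eq_Nil_iff)
  then have "x = mk b * inverse (mk [s])" by (metis mk_append mk_inv_word mk_wd)
  then have "conj_by (mk b) x = conj_by (mk [s]) x" by (simp add: conj_by_def mult.assoc)
  with cyc_rotate[OF assms(1) b] b show ?thesis by (simp add: len_def)
qed

lemma wd_power_cyc:
  assumes "cyc_reduced x"
  shows "wd (x ^ n) = concat (replicate n (wd x))"
proof (induction n)
  case (Suc n)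
  have "reduced (wd x @ wd (x ^ n))"
  proof (cases "x = 1 \<or> n = 0")
    case False
    then have "hd (wd (x ^ n)) = hd (wd x)" using Suc by (cases n) auto
    then show ?thesis using assms False by (auto simp: reduced_append cyc_reduced_def)
  qed auto
  then have "wd (x * x ^ n) = wd x @ wd (x ^ n)" by (rule wd_mult_reduced)
  with Suc show ?case by simp
qed simp

lemma length_concat_replicate: "length (concat (replicate n w)) = n * length w"
  by (induction n) simp_all

lemma len_power_cyc: "cyc_reduced x \<Longrightarrow> len (x ^ n) = n * len x"
  by (simp add: len_def wd_power_cyc length_concat_replicate)

lemma fg_power_eq_1: "x ^ n = 1 \<longleftrightarrow> n = 0 \<or> x = (1 :: 'a fg)"
proof -
  obtain S where S: "cyc_reduced (conj_by S x)" using exists_cyc by blast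
  have "x ^ n = 1 \<longleftrightarrow> len (conj_by S x ^ n) = 0" by (simp add: conj_by_power[symmetric])
  then show ?thesis using S by (auto simp: len_power_cyc)
qed

section \<open>Periodic prefixes\<close>

definition periodic :: "'a fg \<Rightarrow> nat \<Rightarrow> 'a fg \<Rightarrow> bool" where
  "periodic r L X \<longleftrightarrow> L \<le> len X \<and> (\<forall>i<L. wd X ! i = wd r ! (i mod len r))"

lemma periodic_mono: "periodic r L X \<Longrightarrow> L' \<le> L \<Longrightarrow> periodic r L' X"
  by (auto simp: periodic_def)

lemma nth_concat_replicate:
  "i < n * length w \<Longrightarrow> concat (replicate n w) ! i = w ! (i mod length w)"
proof (induction n arbitrary: i)
  case (Suc n)
  show ?case
  proof (cases "i < length w")
    case True
    then show ?thesis by (simp add: nth_append)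
  next
    case False
    with Suc show ?thesis by (simp add: nth_append le_mod_geq)
  qed
qed simp

lemma periodic_power: "cyc_reduced r \<Longrightarrow> periodic r (n * len r) (r ^ n)"
  by (simp add: periodic_def len_power_cyc wd_power_cyc nth_concat_replicate length_concat_replicate len_def)

lemma periodic_mult:
  assumes "periodic r L X"
  shows "periodic r (L - len Y) (X * Y)"
proof -
  obtain a b c where *: "wd X = a @ b" "wd Y = inv_word b @ c" "wd (X * Y) = a @ c"
    by (rule cancellation)
  have l: "length b \<le> len Y" "length a + length b = len X" using * by (simp_all add: len_def)
  have "L \<le> len X" using assms by (simp add: periodic_def)
  with l have La: "L - len Y \<le> length a" by linarith
  show ?thesis
    unfolding periodic_def
  proof (intro conjI allI impI)
    show "L - len Y \<le> len (X * Y)" using La * by (simp add: len_def)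
  next
    fix i assume i: "i < L - len Y"
    then have "wd (X * Y) ! i = wd X ! i" using La * by (simp add: nth_append)
    also have "\<dots> = wd r ! (i mod len r)" using assms i by (simp add: periodic_def)
    finally show "wd (X * Y) ! i = wd r ! (i mod len r)" .
  qed
qed

text \<open>A second occurrence of the period, \<open>length a\<close> letters later, is the rotation of \<open>r\<close> by \<open>a\<close>.\<close>

lemma periodic_shift:
  assumes "wd X = a @ z" "periodic r L X" "length a + len r \<le> L"
  shows "r * mk a = mk a * mk (take (len r) z)"
proof -
  have l: "length a + len r \<le> length a + length z" "L \<le> length a + length z"
    using assms by (auto simp: periodic_def len_def)
  have p: "wd X ! i = wd r ! (i mod len r)" if "i < length a + len r" for i
    using assms(2,3) that by (auto simp: periodic_def)
  have "wd r @ a = a @ take (len r) z"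
  proof (rule nth_equalityI)
    show "length (wd r @ a) = length (a @ take (len r) z)" using l by (simp add: len_def)
  next
    fix i assume "i < length (wd r @ a)"
    then have i: "i < length a + len r" by (simp add: len_def)
    have "(a @ take (len r) z) ! i = wd X ! i" using i assms(1) by (auto simp: nth_append)
    also have "\<dots> = wd r ! (i mod len r)" using p i by simp
    also have "\<dots> = (wd r @ a) ! i"
    proof (cases "i < len r")
      case True
      then show ?thesis by (simp add: nth_append len_def)
    next
      case False
      then have j: "i - len r < length a" using i by linarith
      have "(wd r @ a) ! i = wd X ! (i - len r)" using False j assms(1) by (simp add: nth_append len_def)
      also have "\<dots> = wd r ! ((i - len r) mod len r)" using p j by simp
      finally show ?thesis using False by (simp add: le_mod_geq)
    qed
    finally show "(wd r @ a) ! i = (a @ take (len r) z) ! i" by simp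
  qed
  then have "mk (wd r @ a) = mk (a @ take (len r) z)" by simp
  then show ?thesis by (simp add: mk_append)
qed

text \<open>The easy half of the Fine--Wilf theorem: both concatenations of the two periods are prefixes of the
  same length.\<close>

lemma two_periods_commute:
  assumes "periodic v L X" "periodic w L X" "len v + len w \<le> L"
  shows "wd v @ wd w = wd w @ wd v"
proof -
  have "wd v @ wd w = take (len v + len w) (wd X)"
    if "periodic v L X" "periodic w L X" "len v + len w \<le> L" for v w
  proof (rule nth_equalityI)
    show "length (wd v @ wd w) = length (take (len v + len w) (wd X))"
      using that by (auto simp: len_def periodic_def)
  next
    fix i assume "i < length (wd v @ wd w)"
    then have i: "i < len v + len w" by (simp add: len_def)
    then have *: "take (len v + len w) (wd X) ! i = wd v ! (i mod len v)"
      using that by (auto simp: periodic_def len_def)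
    show "(wd v @ wd w) ! i = take (len v + len w) (wd X) ! i"
    proof (cases "i < len v")
      case True
      then show ?thesis unfolding * by (simp add: nth_append len_def)
    next
      case False
      let ?j = "i - len v"
      have j: "?j < len w" using i False by linarith
      then have "(wd v @ wd w) ! i = wd w ! (?j mod len w)" using False by (simp add: nth_append len_def)
      also have "\<dots> = wd X ! ?j" using that(2,3) j by (auto simp: periodic_def)
      also have "\<dots> = wd v ! (?j mod len v)" using that(1,3) j by (auto simp: periodic_def)
      finally show ?thesis unfolding * using False by (simp add: le_mod_geq)
    qed
  qed
  from this[OF assms] this[OF assms(2,1)] assms(3) show ?thesis by (simp add: add.commute)
qed

text \<open>Cancellation leaves a common tail \<open>c\<close> of \<open>X\<close> and \<open>f * X\<close>, and the next \<open>len r\<close> letters of \<open>c\<close> are a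
  rotation of \<open>r\<close> in two ways, by the two parts of \<open>f\<close>. So both parts conjugate \<open>r\<close> to the
  same element, and \<open>f\<close> centralises \<open>r\<close>.\<close>

lemma comm_of_periodic:
  assumes "periodic r L X" "periodic r L (f * X)" "len f + len r \<le> L"
  shows "comm f r"
proof -
  obtain a b c where *: "wd f = a @ b" "wd X = inv_word b @ c" "wd (f * X) = a @ c"
    by (rule cancellation)
  have l: "length a \<le> len f" "length b \<le> len f" using * by (simp_all add: len_def)
  let ?z = "mk (take (len r) c)"
  have 1: "r * mk a = mk a * ?z" using periodic_shift[OF *(3) assms(2)] l assms(3) by simp
  have 2: "r * inverse (mk b) = inverse (mk b) * ?z"
    using periodic_shift[OF *(2) assms(1)] l assms(3) by (simp add: mk_inv_word)
  have f: "f = mk a * mk b" using *(1) by (metis mk_append mk_wd)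
  have "mk b * r = ?z * mk b"
    using 2 by (metis fg_left_inverse fg_right_inverse_mult mult.assoc mult.right_neutral)
  then have "f * r = mk a * ?z * mk b" by (simp add: f mult.assoc)
  also have "\<dots> = r * f" using 1 by (simp add: f mult.assoc[symmetric])
  finally show ?thesis by (simp add: comm_def)
qed

text \<open>A large power \<open>X\<close> of \<open>r ^ n\<close> satisfies \<open>y * X = X * y\<close>, which is \<open>r\<close>-periodic apart from a bounded piece at the end.\<close>

lemma comm_power_root_cyc:
  assumes "cyc_reduced r" "comm (r ^ n) y" "n \<ge> 1"
  shows "comm r y"
proof (cases "r = 1")
  case False
  let ?N = "2 * len y + len r"
  have "1 \<le> n * len r" using False assms(3) by (simp add: Suc_le_eq)
  then have "?N * 1 \<le> ?N * (n * len r)" by (rule mult_le_mono2)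
  then have "?N \<le> ?N * n * len r" by (simp only: mult.assoc mult_1_right)
  then have p: "periodic r ?N (r ^ (?N * n))"
    using periodic_mono[OF periodic_power[OF assms(1)], of ?N "?N * n"] by simp
  have "comm (r ^ (n * ?N)) y" unfolding power_mult by (rule comm_power[OF assms(2)])
  then have c: "y * r ^ (?N * n) = r ^ (?N * n) * y" by (simp add: comm_def mult.commute)
  have "periodic r (len y + len r) (y * r ^ (?N * n))"
    unfolding c by (rule periodic_mono[OF periodic_mult[OF p]]) simp
  moreover have "periodic r (len y + len r) (r ^ (?N * n))" by (rule periodic_mono[OF p]) simp
  ultimately have "comm y r" by (intro comm_of_periodic[where L = "len y + len r"]) auto
  then show ?thesis by (rule comm_sym)
qed simp

lemma comm_power_iff: "n \<ge> 1 \<Longrightarrow> comm (x ^ n) y \<longleftrightarrow> comm x y"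
proof
  assume n: "n \<ge> 1" and c: "comm (x ^ n) y"
  obtain S where S: "cyc_reduced (conj_by S x)" using exists_cyc by blast
  have "comm (conj_by S x ^ n) (conj_by S y)" using c by (simp add: conj_by_power[symmetric])
  then have "comm (conj_by S x) (conj_by S y)" using comm_power_root_cyc[OF S _ n] by blast
  then show "comm x y" by simp
qed (rule comm_power)

lemma comm_power_iff': "n \<ge> 1 \<Longrightarrow> comm y (x ^ n) \<longleftrightarrow> comm y x"
  using comm_power_iff comm_sym by metis

text \<open>Two conjugations by \<open>y\<close> fix \<open>x\<close>, so the square of \<open>y\<close>, and hence \<open>y\<close>, commutes with \<open>x\<close>; then \<open>x\<close> has order two.\<close>

lemma not_conj_inverse: "conj_by y x = inverse x \<Longrightarrow> x = 1"
proof -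
  assume h: "conj_by y x = inverse x"
  then have "conj_by (y * y) x = x" by (simp add: conj_by_conj_by[symmetric] conj_by_inverse)
  then have "x * (y * y) = y * y * x"
    unfolding conj_by_def by (metis fg_right_inverse_mult mult.assoc)
  then have "comm (y ^ 2) x" by (simp add: comm_def power2_eq_square)
  then have "comm y x" using comm_power_iff[of 2 y x] by simp
  then have "x = inverse x" using h by (simp add: conj_by_comm)
  then have "x ^ 2 = 1" by (metis fg_right_inverse power2_eq_square)
  then show "x = 1" by (simp add: fg_power_eq_1)
qed

text \<open>There is no backtracking from one run of \<open>r\<close> into another: if more than \<open>len g + len r\<close> letters of
  \<open>r ^ p\<close> cancelled, a full period of the run in \<open>X\<close> would lie against a full period of the inverse run,
  and \<open>r\<close> would be conjugate to its inverse.\<close>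

lemma power_mult_periodic:
  assumes "cyc_reduced r" "r \<noteq> 1" "periodic r L X" "len g + len r \<le> L"
  shows "periodic r (p * len r - len g - len r) (r ^ p * g * X)" (is ?A)
    and "last (wd (r ^ p * g * X)) = last (wd X)" (is ?B)
proof -
  obtain a b c where *: "wd g = a @ b" "wd X = inv_word b @ c" "wd (g * X) = a @ c"
    by (rule cancellation)
  have l: "length a + length b = len g" using * by (simp add: len_def)
  obtain h k y where **: "wd (r ^ p) = h @ k" "wd (g * X) = inv_word k @ y" "wd (r ^ p * (g * X)) = h @ y"
    by (rule cancellation)
  have lX: "len g + len r \<le> length b + length c" using assms(3,4) * by (simp add: periodic_def len_def)
  \<comment> \<open>The cancelled part stops before it covers a whole period of the run in \<open>X\<close>.\<close>
  have k: "length k < length a + len r"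
  proof (rule ccontr)
    assume "\<not> ?thesis"
    then have kl: "length a + len r \<le> length k" by simp
    let ?z = "mk (take (len r) c)"
    have 1: "r * inverse (mk b) = inverse (mk b) * ?z"
      using periodic_shift[OF *(2) assms(3)] l assms(4) by (simp add: mk_inv_word)
    have hk: "wd (inverse r ^ p) = inv_word k @ inv_word h"
      using **(1) by (metis fg_inverse_power inv_word_simps(3) wd_inverse)
    have "take (length a + len r) (inv_word k) = a @ take (len r) c"
    proof -
      have "take (length a + len r) (inv_word k) = take (length a + len r) (wd (g * X))"
        using kl ** by simp
      also have "\<dots> = a @ take (len r) c" using * by simp
      finally show ?thesis .
    qed
    then obtain z where z: "wd (inverse r ^ p) = a @ (take (len r) c @ z)"
      using hk by (metis append.assoc append_take_drop_id)
    have "len r \<le> length c" using lX l by linarith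
    have "len (inverse r ^ p) = p * len r" using assms(1) cyc_inverse len_power_cyc by fastforce
    moreover have "len (inverse r ^ p) \<ge> length k" using hk by (simp add: len_def)
    ultimately have "periodic (inverse r) (length k) (inverse r ^ p)"
      using periodic_mono[OF periodic_power[OF cyc_inverse[OF assms(1)]]] by simp
    from periodic_shift[OF z this] kl have "inverse r * mk a = mk a * mk (take (len r) (take (len r) c @ z))" by simp
    then have 2: "inverse r * mk a = mk a * ?z" using \<open>len r \<le> length c\<close> by simp
    have "conj_by (mk a) (inverse r) = ?z" using 2 by (simp add: conj_by_def mult.assoc)
    moreover have "conj_by (inverse (mk b)) r = ?z" using 1 by (simp add: conj_by_def mult.assoc)
    ultimately have "conj_by (mk b) (conj_by (mk a) (inverse r)) = conj_by (mk b) (conj_by (inverse (mk b)) r)" by simp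
    then have "conj_by (mk a * mk b) (inverse r) = r" by (simp add: conj_by_conj_by)
    then have "conj_by (mk a * mk b) r = inverse r" by (metis conj_by_inverse fg_inverse_inverse)
    then show False using not_conj_inverse assms(2) by blast
  qed
  have lh: "length h + length k = p * len r" using **(1) assms(1) by (metis len_def len_power_cyc length_append)
  have hl: "p * len r - len g - len r \<le> length h" using lh k l by linarith
  have p: "periodic r (p * len r) (r ^ p)" by (rule periodic_power[OF assms(1)])
  show ?A
    unfolding periodic_def mult.assoc
  proof (intro conjI allI impI)
    show "p * len r - len g - len r \<le> len (r ^ p * (g * X))" using hl ** by (simp add: len_def)
  next
    fix i assume i: "i < p * len r - len g - len r"
    then have "wd (r ^ p * (g * X)) ! i = wd (r ^ p) ! i" using hl ** by (simp add: nth_append)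
    then show "wd (r ^ p * (g * X)) ! i = wd r ! (i mod len r)" using p i by (simp add: periodic_def)
  qed
  have cy: "length a + length c = length k + length y" using * ** by (metis length_append inv_word_simps(4))
  have "len r \<le> length c" using lX l by linarith
  then have "y \<noteq> []" "c \<noteq> []" using cy k assms(2) by auto
  have "last (wd (g * X)) = last y" using ** \<open>y \<noteq> []\<close> by simp
  moreover have "last (wd (g * X)) = last c" using * \<open>c \<noteq> []\<close> by simp
  moreover have "last (wd X) = last c" using * \<open>c \<noteq> []\<close> by simp
  moreover have "last (wd (r ^ p * (g * X))) = last y" using ** \<open>y \<noteq> []\<close> by simp
  ultimately show ?B by (simp add: mult.assoc)
qed

section \<open>Commuting elements have a common root\<close>

definition powers :: "'a fg \<Rightarrow> 'a fg set" where
  "powers e = {x. \<exists>n. x = e ^ n \<or> x = inverse e ^ n}"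

lemma powers_inverse: "x \<in> powers e \<Longrightarrow> inverse x \<in> powers e"
  unfolding powers_def by (auto simp: fg_inverse_power)

lemma powers_conj_by: "x \<in> powers e \<Longrightarrow> conj_by T x \<in> powers (conj_by T e)"
  unfolding powers_def by (auto simp: conj_by_power conj_by_inverse)

lemma powers_comm: "comm e z \<Longrightarrow> x \<in> powers e \<Longrightarrow> comm x z"
  unfolding powers_def by (auto intro: comm_power)

lemma common_root_of_words:
  assumes "wd x @ wd y = wd y @ wd x"
  shows "\<exists>e i j. x = e ^ i \<and> y = e ^ j"
proof -
  obtain i j z where *: "concat (replicate i z) = wd x" "concat (replicate j z) = wd y"
    using comm_append_are_replicate assms by blast
  have "mk (concat (replicate n z)) = mk z ^ n" for n
    by (induction n) (simp_all add: mk_append)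
  then have "x = mk z ^ i \<and> y = mk z ^ j" using * by (metis mk_wd)
  then show ?thesis by blast
qed

text \<open>Without cancellation in \<open>x * y\<close>, commuting elements are commuting words.\<close>

lemma common_root_words:
  assumes "reduced (wd x @ wd y)" "comm x y"
  shows "\<exists>e i j. x = e ^ i \<and> y = e ^ j"
proof -
  have a: "wd (x * y) = wd x @ wd y" using assms(1) by (rule wd_mult_reduced)
  have "wd (y * x) = wd y @ wd x"
  proof -
    obtain a b c where *: "wd y = a @ b" "wd x = inv_word b @ c" "wd (y * x) = a @ c"
      by (rule cancellation)
    have "length (wd (y * x)) = length (wd y) + length (wd x)"
      using a assms(2) by (simp add: comm_def)
    with * have "b = []" by simp
    with * show ?thesis by simp
  qed
  with a assms(2) have "wd x @ wd y = wd y @ wd x" by (simp add: comm_def)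
  then show ?thesis by (rule common_root_of_words)
qed

text \<open>An element \<open>y\<close> that is not cyclically reduced has the form \<open>s * y' * inverse s\<close>. Either the axis of \<open>x\<close> passes
  through \<open>s\<close>, and the base point moves there, or \<open>x * y\<close> and \<open>y * x\<close> are reduced as written and begin with
  different letters. If \<open>y\<close> is cyclically reduced, there is no cancellation in the product of \<open>x\<close> or of its inverse with \<open>y\<close>.\<close>

lemma common_root_cyc:
  assumes "cyc_reduced x" "x \<noteq> 1" "comm x y"
  shows "\<exists>e. x \<in> powers e \<and> y \<in> powers e"
  using assms
proof (induction "len y" arbitrary: x y rule: less_induct)
  case less
  have pos: "\<exists>e. x \<in> powers e \<and> y \<in> powers e" if "reduced (wd x @ wd y)" "comm x y" for x y :: "'a fg"
    using common_root_words[OF that] unfolding powers_def by blast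
  consider "y = 1" | "y \<noteq> 1" "cyc_reduced y" | "\<not> cyc_reduced y" by blast
  then show ?case
  proof cases
    case 1
    then have "x = x ^ 1 \<and> y = x ^ 0" by simp
    then show ?thesis unfolding powers_def by blast
  next
    case 2
    show ?thesis
    proof (cases "reduced (wd x @ wd y)")
      case True
      then show ?thesis using pos less.prems by blast
    next
      case False
      then have 3: "hd (wd y) = inv_letter (last (wd x))" by (auto simp: reduced_append)
      have "\<not> reduced (wd y @ wd x)"
      proof
        assume r: "reduced (wd y @ wd x)"
        obtain a b c where *: "wd x = a @ b" "wd y = inv_word b @ c" "wd (x * y) = a @ c"
          by (rule cancellation)
        have "length (wd (x * y)) = length (wd x) + length (wd y)"
          using wd_mult_reduced[OF r] less.prems(3) by (simp add: comm_def)
        with * have "b = []" by simp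
        with * False show False by (metis append_Nil append_Nil2 inv_word_simps(1) reduced_wd)
      qed
      then have 4: "hd (wd x) = inv_letter (last (wd y))" by (auto simp: reduced_append)
      have "reduced (wd (inverse x) @ wd y)"
        using 2 4 less.prems(2) by (auto simp: reduced_append wd_inverse last_inv_word cyc_reduced_def)
      moreover have "comm (inverse x) y" using less.prems by simp
      ultimately obtain e where "inverse x \<in> powers e" "y \<in> powers e" using pos by blast
      then show ?thesis using powers_inverse by fastforce
    qed
  next
    case 3
    then obtain s w where w: "wd y = s # w @ [inv_letter s]" "reduced w" by (rule not_cyc_decomp)
    show ?thesis
    proof (cases "hd (wd x) = s \<or> last (wd x) = inv_letter s")
      case True
      let ?T = "mk [s]"
      have y: "conj_by ?T y = mk w" using w by (intro conj_by_letter)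
      have "len (conj_by ?T y) < len y" using w unfolding y by (simp add: len_def)
      moreover have "comm (conj_by ?T x) (conj_by ?T y)" using less.prems by simp
      ultimately obtain e where "conj_by ?T x \<in> powers e" "conj_by ?T y \<in> powers e"
        using less.hyps[of "conj_by ?T y" "conj_by ?T x"] cyc_rotate_letter[OF less.prems(1,2) True] less.prems by auto
      then have "conj_by (inverse ?T) (conj_by ?T x) \<in> powers (conj_by (inverse ?T) e)"
        "conj_by (inverse ?T) (conj_by ?T y) \<in> powers (conj_by (inverse ?T) e)" by (auto intro: powers_conj_by)
      then show ?thesis by (auto simp: conj_by_conj_by)
    next
      case False
      have e: "hd (wd y) = s" "last (wd y) = inv_letter s" using w by simp_all
      have "s \<noteq> inv_letter (last (wd x))" using False inv_letter_inv_letter by metis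
      then have r: "reduced (wd x @ wd y)" "reduced (wd y @ wd x)"
        using False e by (simp_all add: reduced_append)
      then have "wd x @ wd y = wd y @ wd x"
        using less.prems(3) by (metis comm_def wd_mult_reduced)
      then have "hd (wd x) = s" using w less.prems(2) by (metis append_Cons hd_append2 list.sel(1) wd_eq_Nil_iff)
      with False show ?thesis by simp
    qed
  qed
qed

theorem common_root: "comm x y \<Longrightarrow> \<exists>e. x \<in> powers e \<and> y \<in> powers e"
proof (cases "x = 1")
  case True
  have "1 = y ^ 0 \<and> y = y ^ 1" by simp
  then show ?thesis unfolding True powers_def by blast
next
  case False
  assume c: "comm x y"
  obtain S where S: "cyc_reduced (conj_by S x)" using exists_cyc by blast
  have "comm (conj_by S x) (conj_by S y)" "conj_by S x \<noteq> 1" using c False by simp_all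
  then obtain e where "conj_by S x \<in> powers e" "conj_by S y \<in> powers e" using common_root_cyc[OF S] by blast
  then have "conj_by (inverse S) (conj_by S x) \<in> powers (conj_by (inverse S) e)"
    "conj_by (inverse S) (conj_by S y) \<in> powers (conj_by (inverse S) e)" by (auto intro: powers_conj_by)
  then show ?thesis by (auto simp: conj_by_conj_by)
qed

lemma powers_root_comm:
  assumes "y \<in> powers e" "y \<noteq> 1" "comm y z"
  shows "comm e z"
proof -
  obtain n where n: "y = e ^ n \<or> y = inverse e ^ n" using assms(1) by (auto simp: powers_def)
  with assms(2) have "n \<ge> 1" by (cases n) auto
  with n assms(3) show ?thesis by (auto simp: comm_power_iff)
qed

theorem comm_trans:
  assumes "comm y x" "comm y z" "y \<noteq> 1"
  shows "comm x z"
proof -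
  obtain e where e: "x \<in> powers e" "y \<in> powers e" using common_root assms(1) comm_sym by blast
  have "comm e z" using powers_root_comm[OF e(2) assms(3,2)] .
  then show ?thesis using e(1) by (rule powers_comm)
qed

section \<open>Translation length\<close>

text \<open>For cyclically reduced \<open>x\<close> this is the length of the word (\<open>translation_length_cyc\<close>). The minimum over all
  conjugates makes the invariance under conjugation immediate.\<close>

definition translation_length :: "'a fg \<Rightarrow> nat" where
  "translation_length x = (LEAST n. \<exists>S. len (conj_by S x) = n)"

lemma translation_length_le: "translation_length x \<le> len (conj_by S x)"
  unfolding translation_length_def by (rule Least_le) blast

lemma translation_length_attained: "\<exists>S. len (conj_by S x) = translation_length x"
  unfolding translation_length_def by (rule LeastI_ex) blast

lemma translation_length_conj_by [simp]: "translation_length (conj_by T x) = translation_length x"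
proof (rule antisym)
  obtain S where "len (conj_by S x) = translation_length x" using translation_length_attained by blast
  then show "translation_length (conj_by T x) \<le> translation_length x" using translation_length_le[of "conj_by T x" "inverse T * S"] by (simp add: conj_by_conj_by)
  obtain S where "len (conj_by S (conj_by T x)) = translation_length (conj_by T x)" using translation_length_attained by blast
  then show "translation_length x \<le> translation_length (conj_by T x)" using translation_length_le[of x "T * S"] by (simp add: conj_by_conj_by)
qed

lemma translation_length_inverse [simp]: "translation_length (inverse x) = translation_length x"
  by (simp add: translation_length_def conj_by_inverse)

text \<open>A conjugate shorter than \<open>x\<close> would have powers that grow more slowly than those of \<open>x\<close>, but
  conjugation by \<open>S\<close> changes lengths by no more than \<open>2 * len S\<close>.\<close>

lemma translation_length_cyc:
  assumes "cyc_reduced x"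
  shows "translation_length x = len x"
proof (rule antisym)
  show "translation_length x \<le> len x" using translation_length_le[of x 1] by simp
  obtain S where S: "len (conj_by S x) = translation_length x" using translation_length_attained by blast
  let ?n = "2 * len S + 1"
  have "conj_by (inverse S) (conj_by S x ^ ?n) = x ^ ?n" by (simp only: conj_by_power[symmetric] conj_by_conj_by) simp
  then have "len (x ^ ?n) \<le> len (conj_by S x ^ ?n) + 2 * len S"
    using len_conj_by_le[of "inverse S" "conj_by S x ^ ?n"] by (simp only: len_inverse)
  also have "\<dots> \<le> ?n * translation_length x + 2 * len S" using len_power_le[of "conj_by S x" ?n] S by simp
  finally have "?n * len x < ?n * (translation_length x + 1)" by (simp only: len_power_cyc[OF assms]) simp
  then have "len x < translation_length x + 1" using mult_less_cancel1 by blast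
  then show "len x \<le> translation_length x" by simp
qed

lemma translation_length_pos: "x \<noteq> 1 \<Longrightarrow> 0 < translation_length x"
proof -
  assume x: "x \<noteq> 1"
  obtain S where "len (conj_by S x) = translation_length x" using translation_length_attained by blast
  then show ?thesis using x by (metis conj_by_eq_1_iff len_pos_iff)
qed

lemma hd_last_power_cyc:
  assumes "cyc_reduced x" "x \<noteq> 1" "n \<ge> 1"
  shows "hd (wd (x ^ n)) = hd (wd x) \<and> last (wd (x ^ n)) = last (wd x)"
proof -
  obtain k where n: "n = Suc k" using assms(3) by (cases n) auto
  have "concat (replicate n (wd x)) = wd x @ concat (replicate k (wd x))" by (simp add: n)
  moreover have "concat (replicate n (wd x)) = concat (replicate k (wd x)) @ wd x"
    by (metis concat.simps concat_append append_Nil2 n replicate_Suc replicate_append_same)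
  ultimately show ?thesis using assms by (metis hd_append2 last_appendR wd_eq_Nil_iff wd_power_cyc)
qed

lemma cyc_power: "cyc_reduced x \<Longrightarrow> cyc_reduced (x ^ n)"
  using hd_last_power_cyc[of x n] by (cases "x = 1 \<or> n = 0") (auto simp: cyc_reduced_def)

lemma translation_length_power: "translation_length (x ^ n) = n * translation_length x"
proof -
  obtain S where S: "cyc_reduced (conj_by S x)" using exists_cyc by blast
  have "translation_length (x ^ n) = translation_length (conj_by S x ^ n)" by (simp add: conj_by_power[symmetric])
  also have "\<dots> = n * len (conj_by S x)" using S by (simp add: translation_length_cyc cyc_power len_power_cyc)
  finally show ?thesis using translation_length_cyc[OF S] by simp
qed

text \<open>The ends of a word that is not cyclically reduced belong to the conjugating part and survive in powers.\<close>

lemma hd_last_power: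
  "x \<noteq> 1 \<Longrightarrow> n \<ge> 1 \<Longrightarrow> hd (wd (x ^ n)) = hd (wd x) \<and> last (wd (x ^ n)) = last (wd x)"
proof (induction "len x" arbitrary: x rule: less_induct)
  case less
  show ?case
  proof (cases "cyc_reduced x")
    case True
    then show ?thesis using hd_last_power_cyc less.prems by blast
  next
    case False
    then obtain s w where w: "wd x = s # w @ [inv_letter s]" "w \<noteq> []" "reduced w" by (rule not_cyc_decomp)
    let ?y = "mk w"
    have y: "?y \<noteq> 1" "wd ?y = w" using w by (simp_all flip: wd_eq_Nil_iff)
    have "len ?y < len x" using w y by (simp add: len_def)
    from less.hyps[OF this y(1) less.prems(2)] have IH: "hd (wd (?y ^ n)) = hd w" "last (wd (?y ^ n)) = last w"
      using y by auto
    have ne: "wd (?y ^ n) \<noteq> []" using y less.prems(2) by (simp add: fg_power_eq_1)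
    have "reduced (s # w @ [inv_letter s])" by (metis w(1) reduced_wd)
    then have r: "reduced (s # wd (?y ^ n) @ [inv_letter s])"
      using IH ne w(2) by (auto simp: reduced_Cons reduced_append)
    have "conj_by (mk [s]) (x ^ n) = ?y ^ n" by (simp add: conj_by_power conj_by_letter[OF w(1)])
    then have "conj_by (inverse (mk [s])) (conj_by (mk [s]) (x ^ n)) = conj_by (inverse (mk [s])) (?y ^ n)" by simp
    then have "x ^ n = mk [s] * ?y ^ n * inverse (mk [s])" by (simp only: conj_by_conj_by) (simp add: conj_by_def)
    also have "\<dots> = mk ([s] @ wd (?y ^ n) @ inv_word [s])" by (simp only: mk_append mk_inv_word mk_wd mult.assoc)
    finally have "wd (x ^ n) = s # wd (?y ^ n) @ [inv_letter s]" using r by simp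
    then show ?thesis by (simp add: w)
  qed
qed

section \<open>Commutators\<close>

text \<open>The elements \<open>x\<close> and \<open>conj_by y x\<close> are powers of a common root with equal translation lengths, so they agree or
  are inverse to each other; the latter is excluded by \<open>not_conj_inverse\<close>.\<close>

lemma comm_of_comm_conj_by:
  assumes "comm x (conj_by y x)"
  shows "comm y x"
proof (cases "x = 1")
  case False
  obtain e where e: "x \<in> powers e" "conj_by y x \<in> powers e" using common_root assms by blast
  then have "e \<noteq> 1" using False by (auto simp: powers_def)
  then have te: "translation_length e > 0" by (rule translation_length_pos)
  obtain i j where i: "x = e ^ i \<or> x = inverse e ^ i" and j: "conj_by y x = e ^ j \<or> conj_by y x = inverse e ^ j"
    using e by (auto simp: powers_def)
  have "translation_length x = i * translation_length e" using i by (metis translation_length_inverse translation_length_power)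
  moreover have "translation_length (conj_by y x) = j * translation_length e" using j by (metis translation_length_inverse translation_length_power)
  ultimately have "i = j" using te by simp
  then have "conj_by y x = x \<or> conj_by y x = inverse x"
    using i j by (metis fg_inverse_inverse fg_inverse_power)
  then have "conj_by y x = x" using not_conj_inverse False by blast
  then show ?thesis unfolding comm_def conj_by_def by (metis fg_right_inverse_mult mult.assoc)
qed simp

text \<open>With exponent 3, what cancels between two powers of equal translation length leaves at least
  one period of each (\<open>translation_length_mult_cubes\<close>). Taking both elements to the same power makes the
  expression symmetric up to inversion.\<close>

definition cube_commutator :: "'a fg \<Rightarrow> 'a fg \<Rightarrow> 'a fg" where
  "cube_commutator x y = x ^ 3 * (y ^ 3 * (inverse x ^ 3 * inverse y ^ 3))"

lemma cube_commutator_altdef: "cube_commutator x y = x ^ 3 * conj_by (inverse (y ^ 3)) (inverse x) ^ 3"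
  by (simp add: cube_commutator_def conj_by_power[symmetric]) (simp add: conj_by_def fg_inverse_power[symmetric] mult.assoc)

lemma cube_commutator_inverse: "inverse (cube_commutator x y) = cube_commutator y x"
  by (simp add: cube_commutator_def fg_inverse_power mult.assoc)

lemma comm_cube_commutator_left: "comm x (cube_commutator x y) \<longleftrightarrow> comm x y"
proof
  assume "comm x (cube_commutator x y)"
  then have "comm (inverse (x ^ 3) * cube_commutator x y) x" by (intro comm_mult) (auto intro: comm_sym comm_power)
  then have "comm (conj_by (inverse (y ^ 3)) (inverse x) ^ 3) x" by (simp add: cube_commutator_altdef)
  then have "comm x (conj_by (inverse (y ^ 3)) x)"
    by (simp add: comm_power_iff conj_by_inverse) (rule comm_sym)
  then have "comm (inverse (y ^ 3)) x" by (rule comm_of_comm_conj_by)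
  then show "comm x y" by (simp add: comm_power_iff comm_sym)
next
  assume c: "comm x y"
  then have "comm (inverse (y ^ 3)) (inverse x)" by (simp add: comm_power comm_sym)
  then have "cube_commutator x y = x ^ 3 * inverse x ^ 3" by (simp add: cube_commutator_altdef conj_by_comm)
  then show "comm x (cube_commutator x y)" by (simp add: fg_inverse_power[symmetric])
qed

lemma cube_commutator_eq_1_iff: "cube_commutator x y = 1 \<longleftrightarrow> comm x y"
proof
  assume "cube_commutator x y = 1"
  then have "comm x (cube_commutator x y)" by simp
  then show "comm x y" by (simp only: comm_cube_commutator_left)
next
  assume c: "comm x y"
  then have "comm (inverse (y ^ 3)) (inverse x)" by (simp add: comm_power comm_sym)
  then have "cube_commutator x y = x ^ 3 * inverse x ^ 3" by (simp add: cube_commutator_altdef conj_by_comm)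
  then show "cube_commutator x y = 1" by (simp add: fg_inverse_power[symmetric])
qed

lemma cube_commutator_one [simp]: "cube_commutator 1 x = 1"
  by (simp add: cube_commutator_eq_1_iff)

text \<open>Choose a base point on the axis of \<open>t\<close> as close as possible to the axis of \<open>h\<close>. If the axes are disjoint,
  nothing cancels. If they meet, \<open>t\<close> and \<open>h\<close> become cyclically reduced words of equal length, and a
  cancellation of a whole period at either junction would make them inverse to each other.\<close>

lemma translation_length_mult_cubes:
  assumes "translation_length t = translation_length h" "\<not> comm t h"
  shows "translation_length t \<le> translation_length (t ^ 3 * h ^ 3)"
proof -
  obtain S0 where S0: "cyc_reduced (conj_by S0 t)" using exists_cyc by blast
  obtain S where S: "cyc_reduced (conj_by S t)" and min: "\<And>S'. cyc_reduced (conj_by S' t) \<Longrightarrow> len (conj_by S h) \<le> len (conj_by S' h)"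
    using ex_has_least_nat[of "\<lambda>S. cyc_reduced (conj_by S t)" S0 "\<lambda>S. len (conj_by S h)"] S0 by blast
  let ?r = "conj_by S t" and ?h = "conj_by S h"
  let ?q = "?r ^ 3 * ?h ^ 3"
  have nc: "\<not> comm ?r ?h" using assms(2) by simp
  have r1: "?r \<noteq> 1" and h1: "?h \<noteq> 1" using nc by auto
  have q: "translation_length (t ^ 3 * h ^ 3) = translation_length ?q"
    by (simp add: conj_by_power[symmetric] conj_by_mult[symmetric])
  have tt: "translation_length t = len ?r" using translation_length_cyc[OF S] by simp
  have rp: "wd (?r ^ 3) = wd ?r @ wd ?r @ wd ?r" by (simp only: wd_power_cyc[OF S]) (simp add: numeral_3_eq_3)
  have "len ?r \<le> translation_length ?q"
  proof (cases "cyc_reduced ?h")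
    case False
    then obtain s w where w: "wd ?h = s # w @ [inv_letter s]" "w \<noteq> []" "reduced w" by (rule not_cyc_decomp)
    have no: "hd (wd ?r) \<noteq> s" "last (wd ?r) \<noteq> inv_letter s"
    proof -
      have "\<not> (hd (wd ?r) = s \<or> last (wd ?r) = inv_letter s)"
      proof
        assume "hd (wd ?r) = s \<or> last (wd ?r) = inv_letter s"
        from cyc_rotate_letter[OF S r1 this] have "cyc_reduced (conj_by (S * mk [s]) t)" by (simp add: conj_by_conj_by)
        from min[OF this] have "len ?h \<le> len (conj_by (mk [s]) ?h)" by (simp add: conj_by_conj_by)
        then show False using conj_by_letter[OF w(1)] w by (simp add: len_def)
      qed
      then show "hd (wd ?r) \<noteq> s" "last (wd ?r) \<noteq> inv_letter s" by auto
    qed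
    have hl: "hd (wd (?h ^ 3)) = s" "last (wd (?h ^ 3)) = inv_letter s"
      using hd_last_power[OF h1, of 3] w by simp_all
    have ne: "wd (?h ^ 3) \<noteq> []" using h1 by (simp add: fg_power_eq_1)
    have "s \<noteq> inv_letter (last (wd ?r))" using no(2) inv_letter_inv_letter by metis
    then have "reduced (wd (?r ^ 3) @ wd (?h ^ 3))"
      using hl r1 hd_last_power_cyc[OF S r1, of 3] by (simp add: reduced_append)
    then have wq: "wd ?q = wd (?r ^ 3) @ wd (?h ^ 3)" by (rule wd_mult_reduced)
    have "hd (wd ?q) = hd (wd ?r)" "last (wd ?q) = inv_letter s"
      using wq rp r1 hl ne by simp_all
    then have "cyc_reduced ?q" using no by (simp add: cyc_reduced_def)
    then have "translation_length ?q = len ?q" by (rule translation_length_cyc)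
    then show ?thesis using wq rp by (simp add: len_def)
  next
    case True
    have ll: "len ?r = len ?h" using translation_length_cyc[OF S] translation_length_cyc[OF True] assms(1) by simp
    have hp: "wd (?h ^ 3) = wd ?h @ wd ?h @ wd ?h" by (simp only: wd_power_cyc[OF True]) (simp add: numeral_3_eq_3)
    obtain r1 s y1 where a: "wd ?r = r1 @ s" "wd ?h = inv_word s @ y1" "wd (?r * ?h) = r1 @ y1"
      by (rule cancellation)
    obtain y2 s' r2 where b: "wd ?h = y2 @ s'" "wd ?r = inv_word s' @ r2" "wd (?h * ?r) = y2 @ r2"
      by (rule cancellation)
    have ne: "r1 \<noteq> []" "y1 \<noteq> []" "r2 \<noteq> []" "y2 \<noteq> []"
    proof -
      have l: "length r1 = length y1" "length r2 = length y2"
        using ll a b by (auto simp: len_def) (metis add_left_cancel length_append add.commute inv_word_simps(4))+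
      have "\<not> (r1 = [] \<and> y1 = [])"
      proof
        assume "r1 = [] \<and> y1 = []"
        then have "?r * ?h = 1" using a by (simp flip: wd_eq_Nil_iff)
        then have "inverse ?r = ?h" by (rule fg_inverse_unique)
        then have "comm ?r ?h" by (metis comm_inverse_iff(2) comm_refl)
        then show False using nc by simp
      qed
      moreover have "\<not> (r2 = [] \<and> y2 = [])"
      proof
        assume "r2 = [] \<and> y2 = []"
        then have "?h * ?r = 1" using b by (simp flip: wd_eq_Nil_iff)
        then have "inverse ?h = ?r" by (rule fg_inverse_unique)
        then have "comm ?r ?h" by (metis comm_inverse_iff(1) comm_refl)
        then show False using nc by simp
      qed
      ultimately show "r1 \<noteq> []" "y1 \<noteq> []" "r2 \<noteq> []" "y2 \<noteq> []" using l by auto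
    qed
    \<comment> \<open>Cancel at both junctions of the cyclic word: the middle periods survive.\<close>
    let ?w = "r2 @ wd ?r @ r1 @ y1 @ wd ?h @ y2"
    have hl: "hd (wd ?r) = hd r1" "last (wd ?r) = last r2" "hd (wd ?h) = hd y2" "last (wd ?h) = last y1"
      using a b ne by (metis hd_append2 last_appendR)+
    have cr: "hd r1 \<noteq> inv_letter (last r2)" "hd y2 \<noteq> inv_letter (last y1)"
      using S True hl r1 h1 by (auto simp: cyc_reduced_def)
    have rr: "reduced (r1 @ y1)" "reduced (y2 @ r2)" "reduced (wd ?r)" "reduced (wd ?h)"
      using a(3) b(3) by (metis reduced_wd)+
    have nn: "wd ?r \<noteq> []" "wd ?h \<noteq> []" using r1 h1 by simp_all
    have "reduced ?w" using rr cr hl ne nn by (simp add: reduced_append)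
    have "cyc_reduced (mk ?w)" using \<open>reduced ?w\<close> ne rr(2) by (simp add: cyc_reduced_def reduced_append)
    have r2e: "mk r2 = mk s' * ?r" using b(2) by (metis fg_right_inverse_mult mk_append mk_inv_word mk_wd)
    have r1e: "mk r1 * mk y1 = ?r * ?h" using a(3) by (metis mk_append mk_wd)
    have y2e: "mk y2 = ?h * inverse (mk s')"
    proof -
      have "?h = mk y2 * mk s'" using b(1) by (metis mk_append mk_wd)
      then show ?thesis by (simp add: mult.assoc)
    qed
    have "mk ?w = mk r2 * ?r * (mk r1 * mk y1) * ?h * mk y2" by (simp add: mk_append mult.assoc)
    also have "\<dots> = conj_by (inverse (mk s')) ?q"
      unfolding r2e r1e y2e by (simp add: conj_by_def mult.assoc numeral_3_eq_3)
    finally have "translation_length ?q = translation_length (mk ?w)" by simp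
    also have "\<dots> = length ?w" using translation_length_cyc[OF \<open>cyc_reduced (mk ?w)\<close>] \<open>reduced ?w\<close> by (simp add: len_def)
    finally show ?thesis by (simp add: len_def)
  qed
  then show ?thesis using tt q by simp
qed

lemma translation_length_cube_commutator_left:
  assumes "\<not> comm x y"
  shows "translation_length x \<le> translation_length (cube_commutator x y)"
proof -
  let ?h = "conj_by (inverse (y ^ 3)) (inverse x)"
  have "\<not> comm x ?h"
  proof
    assume "comm x ?h"
    then have "comm x (conj_by (inverse (y ^ 3)) x)" by (simp add: conj_by_inverse)
    then have "comm (inverse (y ^ 3)) x" by (rule comm_of_comm_conj_by)
    then have "comm x y" by (simp add: comm_power_iff comm_sym)
    with assms show False by simp
  qed
  then show ?thesis unfolding cube_commutator_altdef by (intro translation_length_mult_cubes) simp_all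
qed

lemma translation_length_cube_commutator_right: "\<not> comm x y \<Longrightarrow> translation_length y \<le> translation_length (cube_commutator x y)"
  using translation_length_cube_commutator_left[of y x] cube_commutator_inverse[of y x] by (metis comm_sym translation_length_inverse)

section \<open>Joint displacement\<close>

text \<open>Take \<open>T\<close> with minimal largest displacement \<open>L\<close>. If some element of displacement at least \<open>L - 2\<close> is
  cyclically reduced at \<open>T\<close>, it is the required \<open>z\<close>. Otherwise these elements all begin with a letter that cancels
  against their last one. If two of them begin with different letters, their product is cyclically reduced. If they
  all begin with the same letter \<open>s\<close>, moving the base point along \<open>s\<close> lowers the maximum, since the displacement of the
  remaining elements grows by no more than two.\<close>

lemma joint_displacement:
  fixes f :: "nat \<Rightarrow> 'a fg"
  assumes "i0 < m" "f i0 \<noteq> 1"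
  shows "\<exists>T. \<exists>z \<in> f ` {..<m} \<union> (\<lambda>(i, j). f i * f j) ` ({..<m} \<times> {..<m}).
    \<forall>k<m. len (conj_by T (f k)) \<le> 3 * translation_length z"
proof -
  let ?M = "\<lambda>T. Max ((\<lambda>k. len (conj_by T (f k))) ` {..<m})"
  let ?Z = "f ` {..<m} \<union> (\<lambda>(i, j). f i * f j) ` ({..<m} \<times> {..<m})"
  obtain T where T: "\<And>T'. ?M T \<le> ?M T'"
    using ex_has_least_nat[of "\<lambda>_. True" 1 ?M] by blast
  define L where "L = ?M T"
  define a where "a = (\<lambda>k. conj_by T (f k))"
  have ne: "{..<m} \<noteq> {}" using assms by auto
  have le: "len (a k) \<le> L" if "k < m" for k unfolding L_def a_def using that by (intro Max_ge) auto
  have tla: "translation_length (a k) = translation_length (f k)" for k by (simp add: a_def)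
  have "\<exists>z\<in>?Z. L \<le> 3 * translation_length z"
  \<comment> \<open>For small \<open>L\<close> every nontrivial element will do, because translation lengths are integers.\<close>
  proof (cases "L \<le> 3")
    case True
    have "L \<le> 3 * translation_length (f i0)" using True translation_length_pos[OF assms(2)] by linarith
    then show ?thesis using assms(1) by blast
  next
    case False
    then have L: "L \<ge> 4" by simp
    show ?thesis
    proof (cases "\<exists>i<m. L \<le> len (a i) + 2 \<and> cyc_reduced (a i)")
      case True
      then obtain i where i: "i < m" "L \<le> len (a i) + 2" "cyc_reduced (a i)" by blast
      have "L \<le> 3 * translation_length (f i)" using translation_length_cyc[OF i(3)] i(2) L by (simp add: tla)
      then show ?thesis using i(1) by blast
    next
      case False
      then have nc: "\<not> cyc_reduced (a i)" if "i < m" "L \<le> len (a i) + 2" for i using that by blast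
      have "L \<in> (\<lambda>k. len (conj_by T (f k))) ` {..<m}" unfolding L_def by (rule Max_in) (use ne in auto)
      then obtain i1 where i1: "i1 < m" "len (a i1) = L" by (auto simp: a_def)
      define s where "s = hd (wd (a i1))"
      have "\<exists>j<m. L \<le> len (a j) + 2 \<and> hd (wd (a j)) \<noteq> s"
      proof (rule ccontr)
        assume "\<not> ?thesis"
        then have s: "hd (wd (a j)) = s" if "j < m" "L \<le> len (a j) + 2" for j using that by blast
        have "len (conj_by (mk [s]) (a k)) < L" if k: "k < m" for k
        proof (cases "L \<le> len (a k) + 2")
          case True
          obtain s' w where w: "wd (a k) = s' # w @ [inv_letter s']" "w \<noteq> []" "reduced w"
            using nc[OF k True] by (rule not_cyc_decomp)
          have "s' = s" using s[OF k True] w by simp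
          then have "conj_by (mk [s]) (a k) = mk w" using conj_by_letter w(1) by blast
          then show ?thesis using le[OF k] w by (simp add: len_def)
        next
          case False
          have "len (mk [s]) = 1" by (simp add: len_def)
          then show ?thesis using len_conj_by_le[of "mk [s]" "a k"] False by simp
        qed
        then have "?M (T * mk [s]) < L" using ne by (subst Max_less_iff) (auto simp: a_def conj_by_conj_by)
        then show False using T[of "T * mk [s]"] by (simp add: L_def)
      qed
      then obtain j where j: "j < m" "L \<le> len (a j) + 2" "hd (wd (a j)) \<noteq> s" by blast
      obtain w where w: "wd (a i1) = s # w @ [inv_letter s]"
        using nc[OF i1(1)] i1(2) by (metis le_add1 list.sel(1) not_cyc_decomp s_def)
      obtain s' w' where w': "wd (a j) = s' # w' @ [inv_letter s']"
        using nc[OF j(1,2)] by (metis not_cyc_decomp)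
      have ss: "s' \<noteq> s" using j(3) w' by simp
      have "reduced (wd (a i1) @ wd (a j))"
      proof -
        have "hd (wd (a j)) = s'" "last (wd (a i1)) = inv_letter s" using w w' by simp_all
        then show ?thesis using ss by (simp add: reduced_append)
      qed
      then have p: "wd (a i1 * a j) = wd (a i1) @ wd (a j)" by (rule wd_mult_reduced)
      have "hd (wd (a i1 * a j)) = s" "last (wd (a i1 * a j)) = inv_letter s'"
        using w w' p by simp_all
      then have "cyc_reduced (a i1 * a j)" using ss by (simp add: cyc_reduced_def)
      then have "translation_length (a i1 * a j) = len (a i1) + len (a j)" using p by (simp add: translation_length_cyc len_def)
      moreover have "a i1 * a j = conj_by T (f i1 * f j)" by (simp add: a_def conj_by_mult)
      ultimately have "L \<le> 3 * translation_length (f i1 * f j)" using i1(2) by simp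
      moreover have "f i1 * f j \<in> ?Z" using i1(1) j(1) by force
      ultimately show ?thesis by blast
    qed
  qed
  then show ?thesis using le unfolding a_def by (meson le_trans)
qed

section \<open>Words in variables\<close>

fun ev :: "(nat \<Rightarrow> 'a fg) \<Rightarrow> nat letter list \<Rightarrow> 'a fg" where
  "ev f [] = 1"
| "ev f (a # w) = (if snd a then f (fst a) else inverse (f (fst a))) * ev f w"

lemma ev_append [simp]: "ev f (v @ w) = ev f v * ev f w"
  by (induction v) (simp_all add: mult.assoc)

lemma ev_inv_word [simp]: "ev f (inv_word w) = inverse (ev f w)"
  by (induction w) (simp_all add: inv_letter_def)

definition word_power :: "nat \<Rightarrow> 'b list \<Rightarrow> 'b list" where
  "word_power n w = concat (replicate n w)"

lemma ev_word_power [simp]: "ev f (word_power n w) = ev f w ^ n"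
  by (induction n) (simp_all add: word_power_def)

definition cube_commutator_word :: "nat letter list \<Rightarrow> nat letter list \<Rightarrow> nat letter list" where
  "cube_commutator_word v w = word_power 3 v @ word_power 3 w @ inv_word (word_power 3 v) @ inv_word (word_power 3 w)"

lemma ev_cube_commutator_word [simp]: "ev f (cube_commutator_word v w) = cube_commutator (ev f v) (ev f w)"
  by (simp add: cube_commutator_word_def cube_commutator_def fg_inverse_power)

definition var :: "nat \<Rightarrow> nat letter list" where
  "var i = [(i, True)]"

lemma ev_var [simp]: "ev f (var i) = f i"
  by (simp add: var_def)

definition words :: "nat \<Rightarrow> nat letter list set" where
  "words m = {w. fst ` set w \<subseteq> {..<m}}"

lemma words_Nil [simp]: "[] \<in> words m" and words_append [simp]: "v @ w \<in> words m \<longleftrightarrow> v \<in> words m \<and> w \<in> words m"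
  and words_inv_word [simp]: "inv_word w \<in> words m \<longleftrightarrow> w \<in> words m"
  and words_var [simp]: "var i \<in> words m \<longleftrightarrow> i < m"
  by (auto simp: words_def inv_word_def var_def image_image)

lemma words_word_power [simp]: "w \<in> words m \<Longrightarrow> word_power n w \<in> words m"
  by (induction n) (simp_all add: word_power_def)

lemma words_cube_commutator_word [simp]: "v \<in> words m \<Longrightarrow> w \<in> words m \<Longrightarrow> cube_commutator_word v w \<in> words m"
  by (simp add: cube_commutator_word_def)

lemma len_ev:
  assumes "w \<in> words m" "\<And>i. i < m \<Longrightarrow> len (f i) \<le> B"
  shows "len (ev f w) \<le> length w * B"
  using assms(1)
proof (induction w)
  case (Cons a w)
  then have "w \<in> words m" "fst a < m" by (auto simp: words_def)
  then have "len (ev f w) \<le> length w * B" "len (f (fst a)) \<le> B" using Cons assms(2) by auto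
  then show ?case
    using len_mult_le[of "if snd a then f (fst a) else inverse (f (fst a))" "ev f w"]
    by (simp split: if_splits)
qed simp

lemma ev_conj_by: "ev (\<lambda>i. conj_by S (f i)) w = conj_by S (ev f w)"
  by (induction w) (simp_all add: conj_by_mult conj_by_inverse)

lemma ev_cong: "w \<in> words m \<Longrightarrow> (\<And>i. i < m \<Longrightarrow> f i = g i) \<Longrightarrow> ev f w = ev g w"
  by (induction w) (auto simp: words_def)

lemma comm_ev: "w \<in> words m \<Longrightarrow> (\<And>i. i < m \<Longrightarrow> comm (f i) z) \<Longrightarrow> comm (ev f w) z"
  by (induction w) (auto simp: words_def intro!: comm_mult)

definition noncomm :: "nat \<Rightarrow> (nat \<Rightarrow> 'a fg) \<Rightarrow> bool" where
  "noncomm m f \<longleftrightarrow> (\<exists>i<m. \<exists>j<m. \<not> comm (f i) (f j))"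

lemma noncomm_witness:
  assumes "noncomm m f" "x \<noteq> 1"
  obtains i where "i < m" "\<not> comm x (f i)"
  using assms comm_trans unfolding noncomm_def by metis

text \<open>Some vertex of the Cayley tree is displaced by every \<open>f i\<close> by at most \<open>K\<close> times the translation length of \<open>x\<close>.\<close>

definition displacement_bound :: "nat \<Rightarrow> (nat \<Rightarrow> 'a fg) \<Rightarrow> nat \<Rightarrow> 'a fg \<Rightarrow> bool" where
  "displacement_bound m f K x \<longleftrightarrow> (\<exists>T. \<forall>i<m. len (conj_by T (f i)) \<le> K * translation_length x)"

lemma displacement_bound_mono: "displacement_bound m f K x \<Longrightarrow> translation_length x \<le> translation_length y \<Longrightarrow> displacement_bound m f K y"
  unfolding displacement_bound_def by (meson le_trans mult_le_mono2)

text \<open>The vertex can be moved to the axis of a fixed word in the tuple: the distance to the axis is at most the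
  displacement by that word, which is bounded by its length times the largest displacement.\<close>

lemma displacement_bound_control:
  assumes "displacement_bound m f K (ev f w)" "w \<in> words m"
  shows "\<exists>S. cyc_reduced (conj_by S (ev f w)) \<and>
    (\<forall>i<m. len (conj_by S (f i)) \<le> K * (1 + 2 * length w) * len (conj_by S (ev f w)))"
proof -
  let ?x = "ev f w"
  obtain T where T: "\<And>i. i < m \<Longrightarrow> len (conj_by T (f i)) \<le> K * translation_length ?x" using assms(1) by (auto simp: displacement_bound_def)
  have "len (ev (\<lambda>i. conj_by T (f i)) w) \<le> length w * (K * translation_length ?x)" by (rule len_ev[OF assms(2) T])
  then have x': "len (conj_by T ?x) \<le> length w * (K * translation_length ?x)" by (simp add: ev_conj_by)
  obtain S where S: "cyc_reduced (conj_by S (conj_by T ?x))" "len S \<le> len (conj_by T ?x)" using exists_cyc by blast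
  have eq: "translation_length ?x = len (conj_by S (conj_by T ?x))" using translation_length_cyc[OF S(1)] by simp
  have "len (conj_by S (conj_by T (f i))) \<le> K * (1 + 2 * length w) * len (conj_by S (conj_by T ?x))" if "i < m" for i
  proof -
    have "len (conj_by S (conj_by T (f i))) \<le> K * translation_length ?x + 2 * (length w * (K * translation_length ?x))"
      using len_conj_by_le[of S "conj_by T (f i)"] T[OF that] S(2) x' by linarith
    then show ?thesis by (simp add: eq algebra_simps)
  qed
  with S(1) show ?thesis by (auto simp: conj_by_conj_by intro!: exI[of _ "T * S"])
qed

section \<open>Products dominated by a power\<close>

text \<open>The conjugate with the power of \<open>r\<close> distributed to both sides of \<open>g\<close> begins and ends like \<open>r\<close>, so it is
  cyclically reduced.\<close>

lemma translation_length_power_mult: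
  assumes "cyc_reduced r" "len g \<le> k * len r" "2 * k + 3 \<le> n"
  shows "len r \<le> translation_length (r ^ n * g)"
proof (cases "r = 1")
  case False
  define j where "j = n - (2 * k + 3)"
  have n: "n = (k + 1) + (k + 2 + j)" using assms(3) by (simp add: j_def)
  let ?X = "r ^ (k + 2 + j) * g * r ^ (k + 1)"
  have pk: "periodic r ((k + 1) * len r) (r ^ (k + 1))" by (rule periodic_power[OF assms(1)])
  have l: "len g + len r \<le> (k + 1) * len r" using assms(2) by simp
  have "periodic r ((k + 2 + j) * len r - len g - len r) ?X" by (rule power_mult_periodic(1)[OF assms(1) False pk l])
  moreover have "len r \<le> (k + 2 + j) * len r - len g - len r" using assms(2) by (simp add: algebra_simps)
  ultimately have q: "periodic r (len r) ?X" using periodic_mono by blast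
  have "len r > 0" using False by simp
  then have "?X \<noteq> 1" using q unfolding periodic_def by (metis len_eq_0_iff not_le)
  have "wd ?X ! 0 = wd r ! 0" using q \<open>len r > 0\<close> by (simp add: periodic_def)
  then have h: "hd (wd ?X) = hd (wd r)" using \<open>?X \<noteq> 1\<close> False by (metis hd_conv_nth wd_eq_Nil_iff)
  have "last (wd ?X) = last (wd (r ^ (k + 1)))" by (rule power_mult_periodic(2)[OF assms(1) False pk l])
  also have "\<dots> = last (wd r)" using hd_last_power_cyc[OF assms(1) False, of "k + 1"] by simp
  finally have "cyc_reduced ?X" using h assms(1) False by (simp add: cyc_reduced_def)
  then have "len r \<le> translation_length ?X" using q by (simp add: periodic_def translation_length_cyc)
  moreover have "?X = conj_by (r ^ (k + 1)) (r ^ n * g)"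
    unfolding n power_add[of r "k + 1"] by (simp add: conj_by_def mult.assoc del: power_Suc)
  ultimately show ?thesis by (metis translation_length_conj_by)
qed simp

lemma not_comm_power_mult:
  assumes "cyc_reduced r" "comm d (r ^ n * g)" "len g + 2 * len d + len r \<le> n * len r"
  shows "comm d r"
proof -
  have p: "periodic r (n * len r - len g) (r ^ n * g)" by (rule periodic_mult[OF periodic_power[OF assms(1)]])
  have "periodic r (n * len r - len g - len d) (r ^ n * g * d)" by (rule periodic_mult[OF p])
  then have "periodic r (len d + len r) (d * (r ^ n * g))"
    using assms(2,3) periodic_mono[of r "n * len r - len g - len d"] by (simp add: comm_def)
  moreover have "periodic r (len d + len r) (r ^ n * g)" using assms(3) by (intro periodic_mono[OF p]) simp
  ultimately show ?thesis by (intro comm_of_periodic[where L = "len d + len r"]) auto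
qed

abbreviation first_nontrivial :: "(nat \<Rightarrow> 'a fg) \<Rightarrow> nat letter list list \<Rightarrow> nat letter list option" where
  "first_nontrivial f Q \<equiv> find (\<lambda>q. ev f q \<noteq> 1) Q"

text \<open>Put \<open>c = q ^ n @ c'\<close>, where \<open>c'\<close> serves the remaining list. If \<open>q\<close> is trivial on \<open>f\<close>, then so is \<open>q ^ n\<close>. Otherwise the
  displacement bound makes the value of \<open>c'\<close> short compared with \<open>q\<close>, and a large \<open>n\<close> lets \<open>q\<close> decide. The word \<open>d\<close> is
  a spectator whose failure to commute with \<open>q\<close> passes on to \<open>c\<close>.\<close>

lemma dominant_word:
  assumes "set Q \<subseteq> words m" "d \<in> words m"
  shows "\<exists>c\<in>words m. \<forall>f :: nat \<Rightarrow> 'a fg.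
    (first_nontrivial f Q = None \<longrightarrow> ev f c = 1) \<and>
    (\<forall>q. first_nontrivial f Q = Some q \<longrightarrow> displacement_bound m f K (ev f q) \<longrightarrow>
      displacement_bound m f K (ev f c) \<and> (\<not> comm (ev f d) (ev f q) \<longrightarrow> \<not> comm (ev f d) (ev f c)))"
  using assms(1)
proof (induction Q)
  case Nil
  show ?case by (rule bexI[of _ "[]"]) simp_all
next
  case (Cons q Q)
  then obtain c where c: "c \<in> words m"
    and IH: "\<And>f :: nat \<Rightarrow> 'a fg. first_nontrivial f Q = None \<Longrightarrow> ev f c = 1"
      "\<And>f :: nat \<Rightarrow> 'a fg. \<And>q. first_nontrivial f Q = Some q \<Longrightarrow> displacement_bound m f K (ev f q) \<Longrightarrow>
        displacement_bound m f K (ev f c) \<and> (\<not> comm (ev f d) (ev f q) \<longrightarrow> \<not> comm (ev f d) (ev f c))"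
    by auto
  have q: "q \<in> words m" using Cons.prems by simp
  define K1 where "K1 = K * (1 + 2 * length q)"
  \<comment> \<open>Large enough for both \<open>translation_length_power_mult\<close> and \<open>not_comm_power_mult\<close>.\<close>
  define n where "n = 2 * (length c * K1) + 2 * (length d * K1) + 3"
  have main: "displacement_bound m f K (ev f (word_power n q @ c)) \<and>
      (\<not> comm (ev f d) (ev f q) \<longrightarrow> \<not> comm (ev f d) (ev f (word_power n q @ c)))"
    if b: "displacement_bound m f K (ev f q)" for f :: "nat \<Rightarrow> 'a fg"
  proof -
    obtain S where S: "cyc_reduced (conj_by S (ev f q))"
      and le: "\<And>i. i < m \<Longrightarrow> len (conj_by S (f i)) \<le> K1 * len (conj_by S (ev f q))"
      using displacement_bound_control[OF b q] by (auto simp: K1_def)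
    let ?r = "conj_by S (ev f q)" and ?g = "conj_by S (ev f c)" and ?d = "conj_by S (ev f d)"
    have g: "len ?g \<le> length c * K1 * len ?r"
      using len_ev[OF c, of "\<lambda>i. conj_by S (f i)"] le by (simp add: ev_conj_by mult.assoc)
    have d: "len ?d \<le> length d * K1 * len ?r"
      using len_ev[OF assms(2), of "\<lambda>i. conj_by S (f i)"] le by (simp add: ev_conj_by mult.assoc)
    have e: "conj_by S (ev f (word_power n q @ c)) = ?r ^ n * ?g" by (simp add: conj_by_mult conj_by_power)
    have "len ?r \<le> translation_length (?r ^ n * ?g)" by (rule translation_length_power_mult[OF S g]) (simp add: n_def)
    then have "translation_length (ev f q) \<le> translation_length (ev f (word_power n q @ c))"
      using translation_length_cyc[OF S] e by (metis translation_length_conj_by)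
    moreover have "comm ?d ?r" if "comm ?d (?r ^ n * ?g)"
    proof (rule not_comm_power_mult[OF S that])
      have "len ?g + 2 * len ?d + len ?r \<le> (length c * K1 + 2 * (length d * K1) + 1) * len ?r"
        using g d by (simp add: algebra_simps)
      also have "\<dots> \<le> n * len ?r" by (rule mult_le_mono1) (simp add: n_def)
      finally show "len ?g + 2 * len ?d + len ?r \<le> n * len ?r" .
    qed
    ultimately show ?thesis using displacement_bound_mono[OF b] e by (metis comm_conj_by_iff)
  qed
  show ?case
  proof (rule bexI[of _ "word_power n q @ c"], intro allI conjI impI, goal_cases)
    case (1 f)
    then show ?case using IH(1)[of f] by (simp split: if_splits)
  next
    case (2 f p)
    then show ?case using IH(2)[of f p] main[of f] by (cases "ev f q = 1") auto
  next
    case (3 f p)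
    then show ?case using IH(2)[of f p] main[of f] by (cases "ev f q = 1") auto
  qed (use q c in simp)
qed

section \<open>Words of large translation length\<close>

lemma find_skip: "(\<And>x. x \<in> set xs \<Longrightarrow> \<not> P x) \<Longrightarrow> find P (xs @ ys) = find P ys"
  by (induction xs) auto

lemma find_hit: "x \<in> set xs \<Longrightarrow> P x \<Longrightarrow> \<exists>q\<in>set xs. P q \<and> find P (xs @ ys) = Some q"
  by (induction xs) auto

lemma find_split: "find P xs = Some x \<Longrightarrow> \<exists>us vs. xs = us @ x # vs \<and> P x \<and> (\<forall>u\<in>set us. \<not> P u)"
proof (induction xs)
  case (Cons y xs)
  show ?case
  proof (cases "P y")
    case True
    with Cons.prems show ?thesis by (intro exI[of _ "[]"] exI[of _ xs]) simp
  next
    case False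
    with Cons obtain us vs where "xs = us @ x # vs" "P x" "\<forall>u\<in>set us. \<not> P u" by auto
    with False show ?thesis by (intro exI[of _ "y # us"] exI[of _ vs]) simp
  qed
qed simp

text \<open>To accommodate a further word \<open>z\<close>, put in front of the old list, for each entry \<open>e\<close>, the commutators of the cubes of \<open>e\<close> and
  \<open>z\<close>, and those where \<open>e\<close> is first replaced by its commutator with a variable. If \<open>z\<close> is trivial on \<open>f\<close>, all new entries are
  trivial. Otherwise the first nontrivial entry \<open>e\<close> of the old list contributes a nontrivial new one: if \<open>e\<close> commutes with
  \<open>z\<close>, then a variable that does not commute with \<open>e\<close> turns \<open>e\<close> into an element that does not commute with \<open>z\<close>.
  Commutators never have smaller translation length than their arguments, and new entries from trivial \<open>e\<close> are trivial.\<close>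

lemma candidate_list:
  assumes "set Z \<subseteq> words m"
  shows "\<exists>Q. set Q \<subseteq> words m \<and> (\<forall>f :: nat \<Rightarrow> 'a fg. noncomm m f \<longrightarrow>
    (\<exists>q. first_nontrivial f Q = Some q \<and> (\<forall>z\<in>set Z. translation_length (ev f z) \<le> translation_length (ev f q))))"
  using assms
proof (induction Z)
  case Nil
  let ?Q = "concat (map (\<lambda>i. map (\<lambda>j. cube_commutator_word (var i) (var j)) [0..<m]) [0..<m])"
  show ?case
  proof (intro exI[of _ ?Q] conjI allI impI)
    show "set ?Q \<subseteq> words m" by auto
    fix f :: "nat \<Rightarrow> 'a fg" assume "noncomm m f"
    then obtain i j where "i < m" "j < m" "\<not> comm (f i) (f j)" by (auto simp: noncomm_def)
    then have "cube_commutator_word (var i) (var j) \<in> set ?Q" "ev f (cube_commutator_word (var i) (var j)) \<noteq> 1"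
      by (force simp: cube_commutator_eq_1_iff)+
    then have "\<exists>q\<in>set ?Q. ev f q \<noteq> 1 \<and> first_nontrivial f (?Q @ []) = Some q" by (rule find_hit)
    then show "\<exists>q. first_nontrivial f ?Q = Some q \<and> (\<forall>z\<in>set []. translation_length (ev f z) \<le> translation_length (ev f q))" by auto
  qed
next
  case (Cons z Z)
  then obtain Q where Q: "set Q \<subseteq> words m"
    and IH: "\<And>f :: nat \<Rightarrow> 'a fg. noncomm m f \<Longrightarrow>
      \<exists>q. first_nontrivial f Q = Some q \<and> (\<forall>z\<in>set Z. translation_length (ev f z) \<le> translation_length (ev f q))" by auto
  have z: "z \<in> words m" using Cons.prems by simp
  define B where "B = (\<lambda>e. cube_commutator_word e z # map (\<lambda>i. cube_commutator_word (cube_commutator_word e (var i)) z) [0..<m])"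
  let ?Q = "concat (map B Q) @ Q"
  show ?case
  proof (intro exI[of _ ?Q] conjI allI impI)
    show "set ?Q \<subseteq> words m" using Q z by (auto simp: B_def)
    fix f :: "nat \<Rightarrow> 'a fg" assume nc: "noncomm m f"
    then obtain e where e: "first_nontrivial f Q = Some e"
      and le: "\<And>z. z \<in> set Z \<Longrightarrow> translation_length (ev f z) \<le> translation_length (ev f e)" using IH by blast
    have trivial: "ev f q = 1" if "q \<in> set (B e')" "ev f e' = 1 \<or> ev f z = 1" for e' q
      using that by (auto simp: B_def cube_commutator_eq_1_iff)
    show "\<exists>q. first_nontrivial f ?Q = Some q \<and> (\<forall>z'\<in>set (z # Z). translation_length (ev f z') \<le> translation_length (ev f q))"
    proof (cases "ev f z = 1")
      case True
      have "first_nontrivial f ?Q = first_nontrivial f Q"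
        by (rule find_skip) (use trivial True in auto)
      moreover have "translation_length (ev f z) = 0" using True by (simp add: translation_length_cyc)
      ultimately show ?thesis using e le by auto
    next
      case False
      obtain us vs where Qs: "Q = us @ e # vs" and e1: "ev f e \<noteq> 1" and us: "\<forall>u\<in>set us. ev f u = 1"
        using find_split[OF e] by auto
      have outgrows: "translation_length (ev f e) \<le> translation_length (ev f q) \<and> translation_length (ev f z) \<le> translation_length (ev f q)"
        if "q \<in> set (B e)" "ev f q \<noteq> 1" for q
      proof -
        have "q = cube_commutator_word e z \<or> (\<exists>i<m. q = cube_commutator_word (cube_commutator_word e (var i)) z)"
          using that(1) by (auto simp: B_def)
        then show ?thesis
        proof
          assume "q = cube_commutator_word e z"
          then show ?thesis using that(2) by (auto simp: cube_commutator_eq_1_iff translation_length_cube_commutator_left translation_length_cube_commutator_right)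
        next
          assume "\<exists>i<m. q = cube_commutator_word (cube_commutator_word e (var i)) z"
          then obtain i where qi: "q = cube_commutator_word (cube_commutator_word e (var i)) z" by blast
          then have n: "\<not> comm (cube_commutator (ev f e) (f i)) (ev f z)" using that(2) by (auto simp: cube_commutator_eq_1_iff)
          then have "cube_commutator (ev f e) (f i) \<noteq> 1" by auto
          then have "\<not> comm (ev f e) (f i)" by (simp add: cube_commutator_eq_1_iff)
          then have "translation_length (ev f e) \<le> translation_length (cube_commutator (ev f e) (f i))" by (rule translation_length_cube_commutator_left)
          also have "\<dots> \<le> translation_length (ev f q)" using translation_length_cube_commutator_left[OF n] by (simp add: qi)
          finally show ?thesis using translation_length_cube_commutator_right[OF n] by (simp add: qi)
        qed
      qed
      have "\<exists>q\<in>set (B e). ev f q \<noteq> 1"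
      proof (cases "comm (ev f e) (ev f z)")
        case True
        obtain i where i: "i < m" "\<not> comm (ev f e) (f i)" using noncomm_witness[OF nc e1] by blast
        have "\<not> comm (cube_commutator (ev f e) (f i)) (ev f z)"
        proof
          assume "comm (cube_commutator (ev f e) (f i)) (ev f z)"
          then have "comm (ev f e) (cube_commutator (ev f e) (f i))"
            using comm_trans[OF comm_sym[OF True] comm_sym False] by blast
          with i(2) show False by (simp add: comm_cube_commutator_left)
        qed
        then have "ev f (cube_commutator_word (cube_commutator_word e (var i)) z) \<noteq> 1" by (simp add: cube_commutator_eq_1_iff)
        moreover have "cube_commutator_word (cube_commutator_word e (var i)) z \<in> set (B e)" using i(1) by (auto simp: B_def)
        ultimately show ?thesis by blast
      next
        case False
        then have "ev f (cube_commutator_word e z) \<noteq> 1" by (simp add: cube_commutator_eq_1_iff)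
        then show ?thesis by (auto simp: B_def)
      qed
      then obtain q0 where "q0 \<in> set (B e)" "ev f q0 \<noteq> 1" by blast
      then have "\<exists>q\<in>set (B e). ev f q \<noteq> 1 \<and> first_nontrivial f (B e @ (concat (map B vs) @ Q)) = Some q"
        by (rule find_hit)
      then obtain q where q: "q \<in> set (B e)" "ev f q \<noteq> 1"
        "first_nontrivial f (B e @ (concat (map B vs) @ Q)) = Some q" by blast
      have "first_nontrivial f (concat (map B us) @ (B e @ (concat (map B vs) @ Q))) =
          first_nontrivial f (B e @ (concat (map B vs) @ Q))"
        by (rule find_skip) (use us trivial in auto)
      moreover have "?Q = concat (map B us) @ (B e @ (concat (map B vs) @ Q))" by (simp add: Qs)
      ultimately have "first_nontrivial f ?Q = Some q" using q(3) by simp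
      moreover have "\<forall>z'\<in>set (z # Z). translation_length (ev f z') \<le> translation_length (ev f q)"
        using outgrows[OF q(1,2)] le by (auto intro: le_trans)
      ultimately show ?thesis by blast
    qed
  qed
qed

text \<open>The word \<open>d\<close> is dominant for the generators and their products. The word \<open>c\<close> is dominant for the commutators of the cubes
  of \<open>d\<close> and the generators; none of these commutes with \<open>d\<close> unless it is trivial.\<close>

lemma controlling_pair:
  "\<exists>c\<in>words m. \<exists>d\<in>words m. \<forall>f :: nat \<Rightarrow> 'a fg.
    (if noncomm m f then \<not> comm (ev f d) (ev f c) \<and> displacement_bound m f 3 (ev f c) else ev f c = 1)"
proof -
  define Z where "Z = map var [0..<m] @ concat (map (\<lambda>i. map (\<lambda>j. var i @ var j) [0..<m]) [0..<m])"
  have "set Z \<subseteq> words m" by (auto simp: Z_def)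
  from candidate_list[OF this] obtain Q where Q: "set Q \<subseteq> words m"
    and Q1: "\<And>f :: nat \<Rightarrow> 'a fg. noncomm m f \<Longrightarrow>
      \<exists>q. first_nontrivial f Q = Some q \<and> (\<forall>z\<in>set Z. translation_length (ev f z) \<le> translation_length (ev f q))" by blast
  obtain d where d: "d \<in> words m"
    and d1: "\<And>f :: nat \<Rightarrow> 'a fg. \<And>q. first_nontrivial f Q = Some q \<Longrightarrow> displacement_bound m f 3 (ev f q) \<Longrightarrow>
      displacement_bound m f 3 (ev f d)"
    using dominant_word[OF Q words_Nil, of 3, where 'a = 'a] by blast
  have bd: "displacement_bound m f 3 (ev f d)" if nc: "noncomm m f" for f :: "nat \<Rightarrow> 'a fg"
  proof -
    obtain q where q: "first_nontrivial f Q = Some q" "\<And>z. z \<in> set Z \<Longrightarrow> translation_length (ev f z) \<le> translation_length (ev f q)"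
      using Q1[OF nc] by blast
    obtain i where i: "i < m" "f i \<noteq> 1" using nc unfolding noncomm_def by (metis comm_one(1))
    obtain T z where z: "z \<in> f ` {..<m} \<union> (\<lambda>(i, j). f i * f j) ` ({..<m} \<times> {..<m})"
      "\<forall>k<m. len (conj_by T (f k)) \<le> 3 * translation_length z" using joint_displacement[of i m f, OF i] by blast
    obtain w where "w \<in> set Z" "z = ev f w"
    proof (cases "z \<in> f ` {..<m}")
      case True
      then obtain k where "k < m" "z = f k" by auto
      then show ?thesis using that[of "var k"] by (auto simp: Z_def)
    next
      case False
      then obtain k l where "k < m" "l < m" "z = f k * f l" using z(1) by auto
      then show ?thesis using that[of "var k @ var l"] by (force simp: Z_def)
    qed
    then have "displacement_bound m f 3 z" "translation_length z \<le> translation_length (ev f q)" using z(2) q(2) by (auto simp: displacement_bound_def)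
    then have "displacement_bound m f 3 (ev f q)" using displacement_bound_mono by blast
    then show ?thesis using d1 q(1) by blast
  qed
  define Q' where "Q' = map (\<lambda>i. cube_commutator_word d (var i)) [0..<m]"
  have Q': "set Q' \<subseteq> words m" using d by (auto simp: Q'_def)
  obtain c where c: "c \<in> words m"
    and c0: "\<And>f :: nat \<Rightarrow> 'a fg. first_nontrivial f Q' = None \<Longrightarrow> ev f c = 1"
    and c1: "\<And>f :: nat \<Rightarrow> 'a fg. \<And>q. first_nontrivial f Q' = Some q \<Longrightarrow> displacement_bound m f 3 (ev f q) \<Longrightarrow>
      displacement_bound m f 3 (ev f c) \<and> (\<not> comm (ev f d) (ev f q) \<longrightarrow> \<not> comm (ev f d) (ev f c))"
    using dominant_word[OF Q' d, of 3, where 'a = 'a] by blast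
  have "\<not> comm (ev f d) (ev f c) \<and> displacement_bound m f 3 (ev f c)" if nc: "noncomm m f" for f :: "nat \<Rightarrow> 'a fg"
  proof -
    have "ev f d \<noteq> 1"
    proof
      assume "ev f d = 1"
      then have "translation_length (ev f d) = 0" by (simp add: translation_length_cyc)
      then have "f i = 1" if "i < m" for i using bd[OF nc] that by (auto simp: displacement_bound_def)
      then show False using nc by (auto simp: noncomm_def)
    qed
    then obtain i where i: "i < m" "\<not> comm (ev f d) (f i)" using noncomm_witness[OF nc] by blast
    then have "cube_commutator_word d (var i) \<in> set Q'" "ev f (cube_commutator_word d (var i)) \<noteq> 1" by (auto simp: Q'_def cube_commutator_eq_1_iff)
    then have "\<exists>q\<in>set Q'. ev f q \<noteq> 1 \<and> first_nontrivial f (Q' @ []) = Some q" by (rule find_hit)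
    then obtain q where q: "q \<in> set Q'" "ev f q \<noteq> 1" "first_nontrivial f Q' = Some q" by auto
    then obtain j where j: "q = cube_commutator_word d (var j)" by (auto simp: Q'_def)
    then have nj: "\<not> comm (ev f d) (f j)" using q(2) by (simp add: cube_commutator_eq_1_iff)
    have "displacement_bound m f 3 (ev f q)" using displacement_bound_mono[OF bd[OF nc]] translation_length_cube_commutator_left[OF nj] j by simp
    moreover have "\<not> comm (ev f d) (ev f q)" using nj j by (simp add: comm_cube_commutator_left)
    ultimately show ?thesis using c1[OF q(3)] by blast
  qed
  moreover have "ev f c = 1" if "\<not> noncomm m f" for f :: "nat \<Rightarrow> 'a fg"
  proof (rule c0)
    have "comm (ev f d) (f i)" if "i < m" for i
      by (rule comm_ev[OF d]) (use \<open>\<not> noncomm m f\<close> that in \<open>auto simp: noncomm_def\<close>)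
    then show "first_nontrivial f Q' = None" by (auto simp: find_None_iff Q'_def cube_commutator_eq_1_iff)
  qed
  ultimately show ?thesis using c d by (metis (no_types, lifting))
qed

section \<open>Products with long periodic syllables\<close>

text \<open>The tail \<open>R\<close> is a parameter so that a product can be cut at any syllable and multiplied on the right.\<close>

fun interleave :: "'a fg \<Rightarrow> (nat \<times> 'a fg) list \<Rightarrow> 'a fg \<Rightarrow> 'a fg" where
  "interleave v [] R = R"
| "interleave v ((p, g) # xs) R = v ^ p * g * interleave v xs R"

lemma interleave_append: "interleave v (xs @ ys) R = interleave v xs (interleave v ys R)"
  by (induction xs) auto

lemma interleave_mult_right: "interleave v xs (R * S) = interleave v xs R * S"
  by (induction xs) (auto simp: mult.assoc)

lemma inverse_mult_interleave:
  "inverse T * interleave v xs R = interleave (conj_by T v) (map (\<lambda>(p, g). (p, conj_by T g)) xs) (inverse T * R)"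
proof (induction xs)
  case (Cons x xs)
  obtain p g where x: "x = (p, g)" by force
  have "inverse T * (v ^ p * g * interleave v xs R) = conj_by T (v ^ p) * conj_by T g * (inverse T * interleave v xs R)"
    by (simp add: conj_by_def mult.assoc)
  then show ?case using Cons by (simp add: x conj_by_power)
qed simp

lemma conj_by_interleave: "conj_by T (interleave v xs R) = interleave (conj_by T v) (map (\<lambda>(p, g). (p, conj_by T g)) xs) (conj_by T R)"
  by (simp add: conj_by_def[of T "interleave v xs R"] conj_by_def[of T R] inverse_mult_interleave interleave_mult_right)

lemma len_interleave_le:
  assumes "\<And>p g. (p, g) \<in> set xs \<Longrightarrow> p \<le> N \<and> len g \<le> K * len v"
  shows "len (interleave v xs R) \<le> length xs * (N + K) * len v + len R"
  using assms
proof (induction xs)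
  case (Cons x xs)
  obtain p g where x: "x = (p, g)" by force
  then have pg: "p \<le> N" "len g \<le> K * len v" using Cons.prems by auto
  have "len (v ^ p) \<le> N * len v" using len_power_le[of v p] mult_le_mono1[OF pg(1), of "len v"] by linarith
  moreover have "len (interleave v xs R) \<le> length xs * (N + K) * len v + len R"
    by (rule Cons.IH) (rule Cons.prems, simp)
  moreover have "len (interleave v (x # xs) R) \<le> len (v ^ p) + len g + len (interleave v xs R)"
    using len_mult_le[of "v ^ p * g" "interleave v xs R"] len_mult_le[of "v ^ p" g] by (simp add: x)
  ultimately show ?case using pg(2) by (simp add: algebra_simps)
qed simp

lemma power_root_mult_periodic:
  assumes "cyc_reduced r" "r \<noteq> 1" "v = r ^ i" "periodic r M X" "len g + len r \<le> M"
  shows "periodic r (p * len v - len g - len r) (v ^ p * g * X)"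
    and "last (wd (v ^ p * g * X)) = last (wd X)"
proof -
  have v: "v ^ p = r ^ (i * p)" "p * len v = (i * p) * len r"
    using assms(1,3) by (simp_all add: power_mult len_power_cyc)
  show "periodic r (p * len v - len g - len r) (v ^ p * g * X)"
    unfolding v by (rule power_mult_periodic(1)[OF assms(1,2,4,5)])
  show "last (wd (v ^ p * g * X)) = last (wd X)"
    unfolding v by (rule power_mult_periodic(2)[OF assms(1,2,4,5)])
qed

text \<open>Since runs do not backtrack, every tail of a product with short separators begins with a long periodic
  piece, and its last letter is that of \<open>R\<close>.\<close>

lemma interleave_periodic:
  assumes "cyc_reduced r" "r \<noteq> 1" "v = r ^ i"
    and "\<And>p g. (p, g) \<in> set xs \<Longrightarrow> E \<le> p \<and> len g \<le> G"
    and "M + G + len r \<le> E * len v" "G + len r \<le> M" "periodic r M R"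
  shows "periodic r M (interleave v xs R) \<and> last (wd (interleave v xs R)) = last (wd R)"
  using assms(4)
proof (induction xs)
  case Nil
  then show ?case using assms(7) by simp
next
  case (Cons x xs)
  obtain p g where x: "x = (p, g)" by force
  then have pg: "E \<le> p" "len g \<le> G" using Cons.prems by auto
  have IH: "periodic r M (interleave v xs R)" "last (wd (interleave v xs R)) = last (wd R)" using Cons by auto
  have "len g + len r \<le> M" using pg assms(6) by simp
  note * = power_root_mult_periodic[OF assms(1-3) IH(1) this, of p]
  have "E * len v \<le> p * len v" using pg(1) by (rule mult_le_mono1)
  then have "M \<le> p * len v - len g - len r" using pg(2) assms(5) by linarith
  then show ?case using * IH(2) periodic_mono by (auto simp: x)
qed

text \<open>The representation of an element outside the centraliser of \<open>r\<close> in its double coset is unique.\<close>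

lemma comm_unique:
  assumes "\<not> comm b r" "comm c1 r" "comm c2 r" "comm c3 r" "comm c4 r" "c1 * b * c2 = c3 * b * c4"
  shows "c1 = c3 \<and> c2 = c4"
proof -
  have r: "r \<noteq> 1" using assms(1) by auto
  let ?x = "inverse c3 * c1" and ?y = "c4 * inverse c2"
  have x: "comm ?x r" and y: "comm ?y r" using assms(2-5) by (auto intro: comm_mult)
  have "?x * b = b * ?y"
  proof -
    have "?x * b = inverse c3 * (c1 * b * c2) * inverse c2" by (simp add: mult.assoc)
    also have "\<dots> = b * ?y" unfolding assms(6) by (simp add: mult.assoc)
    finally show ?thesis .
  qed
  then have c: "conj_by b ?x = ?y" by (simp add: conj_by_def mult.assoc)
  then have "comm r (conj_by b ?x)" using y comm_sym by metis
  then have "comm ?x (conj_by b ?x)" using comm_trans[OF comm_sym[OF x] _ r] by blast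
  then have "comm b ?x" by (rule comm_of_comm_conj_by)
  then have "?x = 1" using comm_trans[OF comm_sym x] assms(1) by blast
  then have "?y = 1" using c by (metis conj_by_one)
  have "c1 = c3" using \<open>?x = 1\<close> by (metis fg_right_inverse_mult mult.right_neutral)
  moreover have "c2 = c4" using \<open>?y = 1\<close> by (metis fg_inverse_inverse fg_inverse_unique mult.left_neutral
        fg_left_inverse mult.assoc mult.right_neutral)
  ultimately show ?thesis by blast
qed

text \<open>Each side leaves the axis of \<open>r\<close> where its separator stands. If \<open>H\<close> were a long power of \<open>r\<close>, the separator of one
  side would sit inside the run of the other side and so commute with \<open>r\<close>.\<close>

lemma exit_len:
  assumes "cyc_reduced r" "r \<noteq> 1" "\<not> comm a r" "\<not> comm b r" "len a \<le> G" "len b \<le> G" "len r \<le> G"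
    and "periodic r M X" "periodic r M Y" "2 * G \<le> M" "H \<in> powers r" "a * X = H * b * Y"
  shows "len H \<le> 4 * G"
proof -
  have *: "h * len r < 2 * G + 2 * len r"
    if "\<not> comm a r" "len a \<le> G" "len b \<le> G" "periodic r M X" "periodic r M Y" "a * X = r ^ h * b * Y"
    for a b X Y h
  proof (rule ccontr)
    assume n: "\<not> ?thesis"
    have "len b + len r \<le> M" using that(3) assms(7,10) by linarith
    then have "periodic r (h * len r - len b - len r) (r ^ h * b * Y)"
      using power_mult_periodic(1)[OF assms(1,2) that(5)] by blast
    then have "periodic r (G + len r) (a * X)" using that(3) n unfolding that(6) by (elim periodic_mono) linarith
    moreover have "periodic r (G + len r) X" using that(4) assms(7,10) by (elim periodic_mono) linarith
    ultimately have "comm a r" using comm_of_periodic[of r "G + len r" X a] that(2) by simp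
    then show False using that(1) by simp
  qed
  obtain h where "H = r ^ h \<or> H = inverse r ^ h" using assms(11) by (auto simp: powers_def)
  then show ?thesis
  proof
    assume H: "H = r ^ h"
    then have "h * len r < 2 * G + 2 * len r" using * assms by blast
    then show ?thesis using H assms(1,7) by (simp add: len_power_cyc)
  next
    assume H: "H = inverse r ^ h"
    then have "H = inverse (r ^ h)" by (simp add: fg_inverse_power)
    then have "b * Y = r ^ h * a * X" using assms(12) by (simp add: mult.assoc)
    then have "h * len r < 2 * G + 2 * len r" using * assms by blast
    then show ?thesis using H assms(1,7) by (simp add: len_power_cyc fg_inverse_power[symmetric])
  qed
qed

lemma exit_comm:
  assumes "cyc_reduced r" "r \<noteq> 1" "\<not> comm a r" "\<not> comm b r" "len a \<le> G" "len b \<le> G" "len r \<le> G"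
    and "periodic r M X" "periodic r M Y" "7 * G \<le> M" "H \<in> powers r" "a * X = H * b * Y"
  obtains f where "comm f r" "len f \<le> 6 * G" "f * X = Y" "a = H * b * f"
proof -
  have H: "len H \<le> 4 * G" by (rule exit_len[OF assms(1-9) _ assms(11,12)]) (use assms(10) in simp)
  let ?f = "inverse b * inverse H * a"
  have eq: "?f * X = Y" using assms(12) by (simp add: mult.assoc)
  have l: "len ?f \<le> 6 * G"
    using len_mult_le[of "inverse b * inverse H" a] len_mult_le[of "inverse b" "inverse H"] H assms(5,6) by simp
  have "comm ?f r"
    by (rule comm_of_periodic[of r M X]) (use assms(7-10) eq l in auto)
  then show ?thesis using that eq l by (simp add: mult.assoc)
qed

lemma powers_quotient: "inverse (r ^ a) * r ^ b \<in> powers r"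
proof (cases "a \<le> b")
  case True
  then have "r ^ b = r ^ a * r ^ (b - a)" by (simp flip: power_add)
  then show ?thesis by (auto simp: powers_def)
next
  case False
  then have "r ^ a = r ^ b * r ^ (a - b)" by (simp flip: power_add)
  then have "inverse (r ^ a) * r ^ b = inverse (r ^ (a - b))" by (simp add: mult.assoc)
  then show ?thesis by (auto simp: powers_def fg_inverse_power)
qed

lemma comm_powers: "x \<in> powers r \<Longrightarrow> comm x r"
  using powers_comm[OF comm_refl] .

lemma comm_left_commute: "comm x y \<Longrightarrow> x * (y * z) = y * (x * z)"
  unfolding comm_def by (metis mult.assoc)

text \<open>Each exit expresses \<open>a\<close> as an element of the same double coset of \<open>b\<close> with respect to the centraliser of \<open>r\<close>. By uniqueness,
  the left factors agree; the exponents \<open>2 * E\<close> and \<open>E\<close> being different, this forces \<open>v = w\<close>.\<close>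

lemma three_exits:
  assumes r: "cyc_reduced r" "r \<noteq> 1" and v: "v = r ^ i" and w: "w = r ^ j" and E: "E \<ge> 1"
    and ab: "\<not> comm a r" "\<not> comm b r" "len a \<le> G" "len b \<le> G" "len r \<le> G"
    and X: "periodic r M X" "periodic r M (v ^ E * a * X)" "periodic r M (v ^ (2 * E) * a * (v ^ E * a * X))"
    and Y: "periodic r M Y" "periodic r M (w ^ E * b * Y)" "periodic r M (w ^ (2 * E) * b * (w ^ E * b * Y))"
    and M: "400 * G \<le> M" and H: "H \<in> powers r"
    and eq: "a * (v ^ (2 * E) * a * (v ^ E * a * X)) = H * b * (w ^ (2 * E) * b * (w ^ E * b * Y))"
  obtains \<phi> where "v = w" "comm \<phi> r" "len \<phi> \<le> 6 * G" "\<phi> * X = Y" "a = conj_by \<phi> b"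
proof -
  let ?X1 = "v ^ (2 * E) * a * (v ^ E * a * X)" and ?Y1 = "w ^ (2 * E) * b * (w ^ E * b * Y)"
  let ?X2 = "v ^ E * a * X" and ?Y2 = "w ^ E * b * Y"
  have vw: "inverse (v ^ n) * w ^ n \<in> powers r" for n
    unfolding v w by (simp only: power_mult[symmetric] powers_quotient)
  have cv: "comm (v ^ n) f" if "comm f r" for n f
    unfolding v using that by (intro comm_power comm_sym[OF that])
  \<comment> \<open>The factors accumulate: the separators to be compared have length \<open>G\<close>, \<open>7 * G\<close> and \<open>43 * G\<close>, and 7 times 43 is less than 400.\<close>
  obtain f1 where f1: "comm f1 r" "len f1 \<le> 6 * G" "f1 * ?X1 = ?Y1" "a = H * b * f1"
    by (rule exit_comm[OF r ab X(3) Y(3) _ H eq]) (use M in auto)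
  let ?H2 = "inverse (v ^ (2 * E)) * w ^ (2 * E)"
  have "v ^ (2 * E) * (f1 * a * ?X2) = f1 * v ^ (2 * E) * a * ?X2"
    using comm_left_commute[OF cv[OF f1(1), of "2 * E"], of "a * ?X2"] by (simp only: mult.assoc)
  also have "\<dots> = w ^ (2 * E) * b * ?Y2" using f1(3) by (simp add: mult.assoc)
  finally have "v ^ (2 * E) * (f1 * a * ?X2) = w ^ (2 * E) * b * ?Y2" .
  then have e2: "(f1 * a) * ?X2 = ?H2 * b * ?Y2" by (simp add: mult.assoc) (metis fg_left_inverse_mult)
  have nc: "\<not> comm (f * a) r" if "comm f r" for f
  proof
    assume "comm (f * a) r"
    then have "comm (inverse f * (f * a)) r" using comm_mult[OF comm_inverse[OF that]] by blast
    then show False using ab(1) by simp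
  qed
  have l2: "len (f1 * a) \<le> 7 * G" using len_mult_le[of f1 a] f1(2) ab(3) by simp
  obtain f2 where f2: "comm f2 r" "len f2 \<le> 6 * (7 * G)" "f2 * ?X2 = ?Y2" "f1 * a = ?H2 * b * f2"
    by (rule exit_comm[OF r nc[OF f1(1)] ab(2) l2 _ _ X(2) Y(2) _ vw e2]) (use M ab in auto)
  let ?H3 = "inverse (v ^ E) * w ^ E"
  have "v ^ E * (f2 * a * X) = f2 * v ^ E * a * X"
    using comm_left_commute[OF cv[OF f2(1), of E], of "a * X"] by (simp only: mult.assoc)
  also have "\<dots> = w ^ E * b * Y" using f2(3) by (simp add: mult.assoc)
  finally have "v ^ E * (f2 * a * X) = w ^ E * b * Y" .
  then have e3: "(f2 * a) * X = ?H3 * b * Y" by (simp add: mult.assoc) (metis fg_left_inverse_mult)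
  have l3: "len (f2 * a) \<le> 43 * G" using len_mult_le[of f2 a] f2(2) ab(3) by simp
  obtain f3 where f3: "comm f3 r" "f3 * X = Y" "f2 * a = ?H3 * b * f3"
    by (rule exit_comm[OF r nc[OF f2(1)] ab(2) l3 _ _ X(1) Y(1) _ vw e3]) (use M ab in auto)
  have cH: "comm H r" "comm ?H2 r" "comm ?H3 r" using H vw comm_powers by blast+
  have a2: "a = (inverse f1 * ?H2) * b * f2"
  proof -
    have "a = inverse f1 * (f1 * a)" by simp
    then show ?thesis unfolding f2(4) by (simp add: mult.assoc)
  qed
  have a3: "a = (inverse f2 * ?H3) * b * f3"
  proof -
    have "a = inverse f2 * (f2 * a)" by simp
    then show ?thesis unfolding f3(3) by (simp add: mult.assoc)
  qed
  have u1: "H = inverse f1 * ?H2 \<and> f1 = f2"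
    by (rule comm_unique[OF ab(2)]) (use f1 f2 cH a2 in \<open>auto intro!: comm_mult\<close>)
  have u2: "inverse f1 * ?H2 = inverse f2 * ?H3 \<and> f2 = f3"
    by (rule comm_unique[OF ab(2)]) (use f1 f2 f3 cH a2 a3 in \<open>auto intro!: comm_mult\<close>)
  have "?H2 = ?H3" using u1 u2 by (metis fg_left_cancel)
  have rij: "r ^ (j * E) = r ^ (i * E)"
  proof -
    have "inverse (r ^ (2 * (i * E))) * r ^ (2 * (j * E)) = inverse (r ^ (i * E)) * r ^ (j * E)"
      using \<open>?H2 = ?H3\<close> unfolding v w by (simp only: power_mult[symmetric] ac_simps)
    then have "r ^ (i * E) * (r ^ (i * E) * (inverse (r ^ (2 * (i * E))) * r ^ (2 * (j * E))))
      = r ^ (i * E) * (r ^ (i * E) * (inverse (r ^ (i * E)) * r ^ (j * E)))" by simp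
    moreover have "r ^ (2 * (i * E)) = r ^ (i * E) * r ^ (i * E)" "r ^ (2 * (j * E)) = r ^ (j * E) * r ^ (j * E)"
      by (simp_all add: mult_2 power_add)
    ultimately have "r ^ (j * E) * r ^ (j * E) = r ^ (i * E) * r ^ (j * E)"
      by (simp add: mult.assoc)
    then show ?thesis by simp
  qed
  then have "len (r ^ (j * E)) = len (r ^ (i * E))" by simp
  then have "i = j" using r E by (simp add: len_power_cyc)
  then have vw': "v = w" using v w by simp
  then have "?H2 = 1" by simp
  then have "H = inverse f1" using u1 by simp
  then have "a = conj_by f1 b" using f1(4) by (simp add: conj_by_def)
  moreover have "f1 * X = Y" using f3(2) u1 u2 by metis
  ultimately show ?thesis using that vw' f1(1,2) by blast
qed

text \<open>The separator \<open>d\<close> after each \<open>a\<close> detects any discrepancy that \<open>a\<close> itself, if it commutes with the period,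
  would let pass.\<close>

definition syllables :: "nat \<Rightarrow> 'a fg \<Rightarrow> 'a fg list \<Rightarrow> (nat \<times> 'a fg) list" where
  "syllables E d as = concat (map (\<lambda>a. [(E, a), (E, d)]) as)"

lemma syllables_simps [simp]: "syllables E d [] = []"
  "syllables E d (a # as) = (E, a) # (E, d) # syllables E d as"
  by (simp_all add: syllables_def)

text \<open>The quotient \<open>f\<close> of the first separators maps one periodic tail to the other, so it commutes with the period \<open>r\<close>. The same
  holds for the conjugate of \<open>f\<close> by the next separator \<open>d\<close>. As \<open>d\<close> is outside the centraliser of \<open>r\<close>, \<open>f\<close> is trivial.\<close>

lemma separators_equal:
  assumes "cyc_reduced r" "r \<noteq> 1" "v = r ^ i" "\<not> comm d r"
    and G: "len d \<le> G" "len r \<le> G" and M: "5 * G \<le> M" "M + 2 * G \<le> E * len v"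
    and "length as = length bs"
    and "\<And>a. a \<in> set as \<union> set bs \<Longrightarrow> len a \<le> G"
    and R: "periodic r M R" "periodic r M R'"
    and "interleave v (syllables E d as) R = interleave v (syllables E d bs) R'"
  shows "as = bs"
  using assms(9,10,13)
proof (induction as bs rule: list_induct2)
  case (Cons a as b bs)
  let ?X = "interleave v (syllables E d as) R" and ?Y = "interleave v (syllables E d bs) R'"
  have ab: "len a \<le> G" "len b \<le> G" using Cons.prems(1) by auto
  have in_syl: "p = E \<and> len g \<le> G" if "(p, g) \<in> set (syllables E d cs)" "\<forall>c\<in>set cs. len c \<le> G" for p g cs
    using that G(1) by (auto simp: syllables_def)
  have pX: "periodic r M (interleave v (syllables E d cs) R0)"
    if "\<forall>c\<in>set cs. len c \<le> G" "periodic r M R0" for cs R0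
    using interleave_periodic[OF assms(1-3), of "syllables E d cs" E G M R0] in_syl[of _ _ cs] that M G by fastforce
  have pre1: "periodic r M ?X" "periodic r M ?Y" using pX R Cons.prems(1) by auto
  have pre2: "periodic r M (v ^ E * d * ?X)" "periodic r M (v ^ E * d * ?Y)"
  proof -
    have "M \<le> E * len v - len d - len r" using M(2) G by linarith
    moreover have "len d + len r \<le> M" using M(1) G by linarith
    ultimately show "periodic r M (v ^ E * d * ?X)" "periodic r M (v ^ E * d * ?Y)"
      using power_root_mult_periodic(1)[OF assms(1-3) pre1(1)] power_root_mult_periodic(1)[OF assms(1-3) pre1(2)] periodic_mono
      by blast+
  qed
  let ?f = "inverse b * a"
  have e: "a * (v ^ E * d * ?X) = b * (v ^ E * d * ?Y)" using Cons.prems(2) by (simp add: mult.assoc)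
  then have e1: "?f * (v ^ E * d * ?X) = v ^ E * d * ?Y" by (simp add: mult.assoc)
  have lf: "len ?f \<le> 2 * G" using len_mult_le[of "inverse b" a] ab by simp
  have cf: "comm ?f r" by (rule comm_of_periodic[of r M "v ^ E * d * ?X"]) (use pre2 e1 lf M G in auto)
  have "comm (v ^ E) ?f" unfolding assms(3) by (intro comm_power comm_sym[OF cf])
  from comm_left_commute[OF this, of "d * ?X"]
  have "v ^ E * (?f * d * ?X) = ?f * (v ^ E * d * ?X)" by (simp only: mult.assoc)
  then have "v ^ E * (?f * d * ?X) = v ^ E * (d * ?Y)" unfolding e1 by (simp only: mult.assoc)
  then have "?f * d * ?X = d * ?Y" by simp
  then have e2: "conj_by d ?f * ?X = ?Y" by (simp add: conj_by_def mult.assoc)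
  have "len (conj_by d ?f) \<le> 4 * G" using len_conj_by_le[of d ?f] lf G by simp
  then have cc: "comm (conj_by d ?f) r" by (intro comm_of_periodic[of r M ?X]) (use pre1 e2 M G in auto)
  have "?f = 1"
  proof -
    have "?f * d * 1 = d * conj_by d ?f" by (simp add: conj_by_def mult.assoc)
    then have "?f * d * 1 = 1 * d * conj_by d ?f" by (simp add: mult.assoc)
    then show ?thesis using comm_unique[OF assms(4) cf _ _ cc, of 1 1] by simp
  qed
  then have "a = b" by (metis fg_right_inverse_mult mult.right_neutral)
  moreover have "as = bs"
  proof (rule Cons.IH)
    show "?X = ?Y" using e2 \<open>?f = 1\<close> by simp
  qed (use Cons.prems in auto)
  ultimately show ?case by simp
qed simp

section \<open>Conjugate cyclically reduced words\<close>

text \<open>Move the base point along \<open>S\<close> letter by letter. As soon as a step leaves the axis of \<open>V\<close>, the conjugate by all of \<open>S\<close> is reduced as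
  written, hence not cyclically reduced.\<close>

lemma conj_rotate:
  assumes "cyc_reduced V" "cyc_reduced (conj_by S V)"
  shows "\<exists>n. wd (conj_by S V) = rotate n (wd V)"
  using assms
proof (induction "len S" arbitrary: S V rule: less_induct)
  case less
  show ?case
  proof (cases "S = 1 \<or> V = 1")
    case True
    then have "wd (conj_by S V) = rotate 0 (wd V)" by auto
    then show ?thesis by blast
  next
    case False
    then obtain s S' where S: "wd S = s # S'" by (cases "wd S") auto
    have "reduced (s # S')" by (metis S reduced_wd)
    then have rS': "reduced S'" by (simp add: reduced_Cons)
    have Se: "S = mk [s] * mk S'" using S by (metis append_Cons append_Nil mk_append mk_wd)
    show ?thesis
    proof (cases "hd (wd V) = s \<or> last (wd V) = inv_letter s")
      case True
      let ?V = "conj_by (mk [s]) V"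
      have c: "cyc_reduced ?V" using cyc_rotate_letter less.prems(1) False True by blast
      have "\<exists>n. wd ?V = rotate n (wd V)"
        using True
      proof
        assume "hd (wd V) = s"
        then obtain b where b: "wd V = [s] @ b" using False by (cases "wd V") auto
        from cyc_rotate(2)[OF less.prems(1) this] have "wd ?V = rotate 1 (wd V)" using b by simp
        then show ?thesis by blast
      next
        assume "last (wd V) = inv_letter s"
        then obtain b where b: "wd V = b @ inv_word [s]" using False
          by (metis append_butlast_last_id append_Nil inv_word_simps(1,2) wd_eq_Nil_iff)
        then have "V = mk b * inverse (mk [s])" by (metis mk_append mk_inv_word mk_wd)
        then have "conj_by (mk b) V = ?V" by (simp add: conj_by_def mult.assoc)
        then have "wd ?V = inv_word [s] @ b" using cyc_rotate(2)[OF less.prems(1) b] by simp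
        then have "wd ?V = rotate (length b) (wd V)" using b by (simp add: rotate_append)
        then show ?thesis by blast
      qed
      then obtain n where n: "wd ?V = rotate n (wd V)" by blast
      have e: "conj_by S V = conj_by (mk S') ?V" by (simp add: Se conj_by_conj_by)
      have "len (mk S') < len S" using S rS' by (simp add: len_def)
      then obtain n' where "wd (conj_by S V) = rotate n' (wd ?V)"
        using less.hyps[of "mk S'" ?V] c less.prems(2) e by auto
      then show ?thesis using n by (metis rotate_rotate)
    next
      case out: False
      have "s \<noteq> inv_letter (last (wd V))" using out inv_letter_inv_letter by metis
      moreover have hS: "hd (wd S) = s" "wd S \<noteq> []" using S by simp_all
      ultimately have r: "reduced (inv_word (wd S) @ wd V @ wd S)"
        using out False hS by (simp add: reduced_append last_inv_word)
      have "conj_by S V = mk (inv_word (wd S) @ wd V @ wd S)"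
        by (simp add: conj_by_def mk_append mk_inv_word mult.assoc)
      then have w: "wd (conj_by S V) = inv_word (wd S) @ wd V @ wd S" using r by simp
      have Sn: "wd S \<noteq> []" using S by simp
      have "hd (wd (conj_by S V)) = inv_letter (last (wd S))" "last (wd (conj_by S V)) = last (wd S)"
        unfolding w using Sn by (simp_all add: hd_inv_word)
      moreover have "conj_by S V \<noteq> 1" using False by simp
      ultimately show ?thesis using less.prems(2) by (simp add: cyc_reduced_def)
    qed
  qed
qed

section \<open>The test word\<close>

definition tail_syllables :: "nat \<Rightarrow> 'a fg \<Rightarrow> 'a fg list \<Rightarrow> 'a fg \<Rightarrow> (nat \<times> 'a fg) list" where
  "tail_syllables E d as s = (2 * E, d) # (E, d) # syllables E d as @ [(E, s)]"

lemma in_tail_syllables: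
  assumes "(p, g) \<in> set (tail_syllables E d as s)"
  shows "E \<le> p" "p \<le> 2 * E" "g \<in> insert d (insert s (set as))"
  using assms by (auto simp: tail_syllables_def syllables_def)

lemma map_conj_by_syllables:
  "map (\<lambda>(p, g). (p, conj_by T g)) (syllables E d as) = syllables E (conj_by T d) (map (conj_by T) as)"
  by (induction as) auto

lemma map_conj_by_tail_syllables:
  "map (\<lambda>(p, g). (p, conj_by T g)) (tail_syllables E d as s) =
    tail_syllables E (conj_by T d) (map (conj_by T) as) (conj_by T s)"
  by (simp add: tail_syllables_def map_conj_by_syllables)

lemma length_tail_syllables: "length (tail_syllables E d as s) = 2 * length as + 3"
proof -
  have "length (syllables E d as) = 2 * length as" by (induction as) auto
  then show ?thesis by (simp add: tail_syllables_def)
qed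

text \<open>The exponents \<open>p\<close>, \<open>q\<close> and \<open>E + k\<close> are left open because the rotation of one word splits its first run. The element \<open>\<phi>\<close>
  from \<open>three_exits\<close> conjugates the second family of separators so that only \<open>separators_equal\<close> is left.\<close>

lemma aligned_match:
  fixes a b :: "'a fg"
  assumes r: "cyc_reduced r" "r \<noteq> 1" and v: "v = r ^ i" and w: "w = r ^ j"
    and nc: "\<not> comm a r" "\<not> comm b r"
    and G: "len r \<le> G" "len a \<le> G" "len b \<le> G" "len s \<le> G" "len t \<le> G"
      "\<And>x. x \<in> set as \<union> set bs \<Longrightarrow> len x \<le> G"
    and E: "1000 * G \<le> E * len v" "1000 * G \<le> E * len w" "E \<ge> 1"
    and l: "length as = length bs"
    and eq: "v ^ p * a * interleave v (tail_syllables E a as s) (v ^ (E + k)) =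
      w ^ q * b * interleave w (tail_syllables E b bs t) (w ^ E)"
  shows "\<exists>\<phi>. as = map (conj_by \<phi>) bs"
proof -
  let ?M = "400 * G"
  have G1: "G \<ge> 1" using r G(1) by (metis One_nat_def Suc_leI len_pos_iff order.trans)
  have vp: "v ^ n = r ^ (i * n)" "w ^ n = r ^ (j * n)" for n by (simp_all add: v w power_mult)
  have vl: "len v = i * len r" "len w = j * len r" using r by (simp_all add: v w len_power_cyc)
  have Rv: "periodic r ?M (v ^ (E + n))" for n
  proof -
    have "?M \<le> E * len v" using E(1) by linarith
    also have "\<dots> \<le> i * (E + n) * len r" by (simp add: vl algebra_simps)
    finally show ?thesis using periodic_mono[OF periodic_power[OF r(1)]] by (simp add: vp)
  qed
  have Rw: "periodic r ?M (w ^ E)"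
  proof -
    have "?M \<le> E * len w" using E(2) by linarith
    also have "\<dots> = j * E * len r" by (simp add: vl algebra_simps)
    finally show ?thesis using periodic_mono[OF periodic_power[OF r(1)]] by (simp add: vp)
  qed
  let ?RA = "v ^ (E + k)"
  have pA: "periodic r ?M (interleave v xs ?RA)" if "\<And>p g. (p, g) \<in> set xs \<Longrightarrow> E \<le> p \<and> len g \<le> G" for xs
    using interleave_periodic[OF r v that _ _ Rv] E(1) G(1) G1 by auto
  have pB: "periodic r ?M (interleave w xs (w ^ E))" if "\<And>p g. (p, g) \<in> set xs \<Longrightarrow> E \<le> p \<and> len g \<le> G" for xs
    using interleave_periodic[OF r w that _ _ Rw] E(2) G(1) G1 by auto
  let ?xs = "syllables E a as @ [(E, s)]" and ?ys = "syllables E b bs @ [(E, t)]"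
  have inA: "E \<le> p \<and> len g \<le> G" if "(p, g) \<in> set ((2 * E, a) # (E, a) # ?xs)" for p g
    using that G by (auto simp: syllables_def)
  have inB: "E \<le> p \<and> len g \<le> G" if "(p, g) \<in> set ((2 * E, b) # (E, b) # ?ys)" for p g
    using that G by (auto simp: syllables_def)
  let ?X = "interleave v ?xs ?RA" and ?Y = "interleave w ?ys (w ^ E)"
  have X: "periodic r ?M ?X" "periodic r ?M (v ^ E * a * ?X)" "periodic r ?M (v ^ (2 * E) * a * (v ^ E * a * ?X))"
    using pA[of ?xs] pA[of "(E, a) # ?xs"] pA[of "(2 * E, a) # (E, a) # ?xs"] inA by auto
  have Y: "periodic r ?M ?Y" "periodic r ?M (w ^ E * b * ?Y)" "periodic r ?M (w ^ (2 * E) * b * (w ^ E * b * ?Y))"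
    using pB[of ?ys] pB[of "(E, b) # ?ys"] pB[of "(2 * E, b) # (E, b) # ?ys"] inB by auto
  have "v ^ p * (a * (v ^ (2 * E) * a * (v ^ E * a * ?X))) = w ^ q * b * (w ^ (2 * E) * b * (w ^ E * b * ?Y))"
    using eq by (simp add: tail_syllables_def mult.assoc)
  then have "inverse (v ^ p) * (v ^ p * (a * (v ^ (2 * E) * a * (v ^ E * a * ?X)))) =
      inverse (v ^ p) * (w ^ q * b * (w ^ (2 * E) * b * (w ^ E * b * ?Y)))" by simp
  then have e: "a * (v ^ (2 * E) * a * (v ^ E * a * ?X)) =
      (inverse (v ^ p) * w ^ q) * b * (w ^ (2 * E) * b * (w ^ E * b * ?Y))" by (simp add: mult.assoc)
  have H: "inverse (v ^ p) * w ^ q \<in> powers r" unfolding vp by (rule powers_quotient)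
  obtain \<phi> where \<phi>: "v = w" "comm \<phi> r" "len \<phi> \<le> 6 * G" "\<phi> * ?X = ?Y" "a = conj_by \<phi> b"
    by (rule three_exits[OF r v w E(3) nc G(2,3,1) X Y le_refl H e])
  have c\<phi>: "comm \<phi> (v ^ n)" for n unfolding vp using comm_power[OF comm_sym[OF \<phi>(2)]] by (rule comm_sym)
  have cv: "conj_by \<phi> v = v" using conj_by_comm[OF c\<phi>[of 1]] by simp
  have "?X = inverse \<phi> * ?Y" using \<phi>(4) by (metis fg_left_inverse_mult)
  also have "?Y = interleave v (syllables E b bs) (v ^ E * t * v ^ E)" by (simp add: interleave_append \<phi>(1))
  also have "inverse \<phi> * \<dots> = interleave v (syllables E a (map (conj_by \<phi>) bs)) (inverse \<phi> * (v ^ E * t * v ^ E))"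
    by (simp only: inverse_mult_interleave cv map_conj_by_syllables \<phi>(5))
  also have "inverse \<phi> * (v ^ E * t * v ^ E) = v ^ E * (inverse \<phi> * t) * v ^ E"
    using comm_left_commute[OF comm_inverse[OF c\<phi>], of E "t * v ^ E"] by (simp only: mult.assoc)
  finally have final: "interleave v (syllables E a as) (v ^ E * s * ?RA) =
      interleave v (syllables E a (map (conj_by \<phi>) bs)) (v ^ E * (inverse \<phi> * t) * v ^ E)" by (simp add: interleave_append)
  have t7: "len (inverse \<phi> * t) \<le> 7 * G" using len_mult_le[of "inverse \<phi>" t] \<phi>(3) G(5) by simp
  have "as = map (conj_by \<phi>) bs"
  proof (rule separators_equal[OF r v nc(1), of "13 * G" ?M E, OF _ _ _ _ _ _ _ _ final])
    fix x assume "x \<in> set as \<union> set (map (conj_by \<phi>) bs)"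
    then consider "x \<in> set as" | y where "y \<in> set bs" "x = conj_by \<phi> y" by auto
    then show "len x \<le> 13 * G"
    proof cases
      case 1
      then show ?thesis using G(6)[of x] by simp
    next
      case 2
      then show ?thesis using G(6)[of y] len_conj_by_le[of \<phi> y] \<phi>(3) by simp
    qed
  next
    show "periodic r ?M (v ^ E * s * ?RA)"
    proof (rule periodic_mono[OF power_root_mult_periodic(1)[OF r v Rv]])
      show "len s + len r \<le> ?M" using G G1 by linarith
      show "?M \<le> E * len v - len s - len r" using G E(1) by linarith
    qed
    show "periodic r ?M (v ^ E * (inverse \<phi> * t) * v ^ E)"
    proof (rule periodic_mono[OF power_root_mult_periodic(1)[OF r v]])
      show "periodic r ?M (v ^ E)" using Rv[of 0] by simp
      show "len (inverse \<phi> * t) + len r \<le> ?M" using t7 G G1 by linarith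
      show "?M \<le> E * len v - len (inverse \<phi> * t) - len r" using t7 G E(1) by linarith
    qed
  qed (use G E l in auto)
  then show ?thesis by blast
qed

text \<open>This is the value of the test word on a tuple \<open>as\<close> on which \<open>c\<close>, \<open>d\<close>, \<open>s\<close> have the values \<open>v\<close>, \<open>d\<close>, \<open>s\<close>.\<close>

definition test_value :: "nat \<Rightarrow> nat \<Rightarrow> 'a fg \<Rightarrow> 'a fg \<Rightarrow> 'a fg list \<Rightarrow> 'a fg \<Rightarrow> 'a fg" where
  "test_value P E v d as s = v ^ P * d * interleave v (tail_syllables E d as s) (v ^ E)"

lemma conj_by_test_value: "conj_by T (test_value P E v d as s) = test_value P E (conj_by T v) (conj_by T d) (map (conj_by T) as) (conj_by T s)"
  by (simp add: test_value_def conj_by_mult conj_by_interleave conj_by_power map_conj_by_tail_syllables)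

text \<open>In units of the length of the period, \<open>scale n E K\<close> bounds everything in the test value except its first run, and also what
  that run can lose by cancellation. A first run of \<open>20 * scale n E K\<close> periods thus makes up most of the word
  (\<open>test_value_props\<close>).\<close>

definition scale :: "nat \<Rightarrow> nat \<Rightarrow> nat \<Rightarrow> nat" where
  "scale n E K = K + (2 * n + 3) * (2 * E + K) + E + K + 1"

lemma tail_periodic:
  assumes "cyc_reduced v" "v \<noteq> 1" "len d \<le> K * len v" "len s \<le> K * len v"
    "\<And>x. x \<in> set as \<Longrightarrow> len x \<le> K * len v" "2 * K + 2 \<le> E"
  shows "periodic v (p * len v - (K + 1) * len v) (v ^ p * d * interleave v (tail_syllables E d as s) (v ^ (E + k)))"
    and "last (wd (v ^ p * d * interleave v (tail_syllables E d as s) (v ^ (E + k)))) = last (wd v)"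
proof -
  let ?M = "(K + 1) * len v"
  have E: "(2 * K + 2) * len v \<le> E * len v" using assms(6) by (rule mult_le_mono1)
  have "periodic v ((E + k) * len v) (v ^ (E + k))" by (rule periodic_power[OF assms(1)])
  then have R: "periodic v ?M (v ^ (E + k))" using E by (elim periodic_mono) (simp add: algebra_simps)
  have t: "periodic v ?M (interleave v (tail_syllables E d as s) (v ^ (E + k))) \<and>
      last (wd (interleave v (tail_syllables E d as s) (v ^ (E + k)))) = last (wd (v ^ (E + k)))"
  proof (rule interleave_periodic[OF assms(1,2), of v 1 _ E "K * len v"])
    show "E \<le> p \<and> len g \<le> K * len v" if "(p, g) \<in> set (tail_syllables E d as s)" for p g
      using in_tail_syllables[OF that] assms(3-5) by auto
    show "?M + K * len v + len v \<le> E * len v" using E by (simp add: algebra_simps)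
    show "periodic v ?M (v ^ (E + k))" by (rule R)
  qed simp_all
  have l: "len d + len v \<le> ?M" using assms(3) by simp
  note * = power_mult_periodic[OF assms(1,2) conjunct1[OF t] l, of p]
  show "periodic v (p * len v - (K + 1) * len v) (v ^ p * d * interleave v (tail_syllables E d as s) (v ^ (E + k)))"
    using assms(3) by (intro periodic_mono[OF *(1)]) simp
  show "last (wd (v ^ p * d * interleave v (tail_syllables E d as s) (v ^ (E + k)))) = last (wd v)"
    using *(2) t hd_last_power_cyc[OF assms(1,2), of "E + k"] assms(6) by simp
qed

lemma test_value_props:
  assumes "cyc_reduced v" "v \<noteq> 1" "len d \<le> K * len v" "len s \<le> K * len v"
    "\<And>x. x \<in> set as \<Longrightarrow> len x \<le> K * len v" "2 * K + 2 \<le> E"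
    and Q: "Q = scale (length as) E K" and V: "V = test_value (20 * Q) E v d as s"
  shows "cyc_reduced V" "periodic v (19 * Q * len v) V" "len V \<le> 21 * Q * len v"
proof -
  note * = tail_periodic[OF assms(1-4) _ assms(6), where as = as and p = "20 * Q" and k = 0, OF assms(5)]
  have Q1: "K + 1 \<le> Q" by (simp add: Q scale_def)
  then have "(K + 1) * len v \<le> Q * len v" by (rule mult_le_mono1)
  then have "19 * Q * len v \<le> 20 * Q * len v - (K + 1) * len v" by simp
  then show p: "periodic v (19 * Q * len v) V" using *(1) periodic_mono by (auto simp: V test_value_def)
  have "len v > 0" using assms(2) by simp
  have pos: "0 < 19 * Q * len v" using Q1 \<open>len v > 0\<close> by simp
  then have "V \<noteq> 1" using p unfolding periodic_def by (metis len_eq_0_iff not_le)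
  have "wd V ! 0 = wd v ! 0" using p pos by (simp add: periodic_def)
  then have "hd (wd V) = hd (wd v)" using \<open>V \<noteq> 1\<close> assms(2) by (metis hd_conv_nth wd_eq_Nil_iff)
  moreover have "last (wd V) = last (wd v)" using *(2) by (simp add: V test_value_def)
  ultimately show "cyc_reduced V" using assms(1,2) by (simp add: cyc_reduced_def)
  have "len (interleave v (tail_syllables E d as s) (v ^ E)) \<le>
      length (tail_syllables E d as s) * (2 * E + K) * len v + len (v ^ E)"
  proof (rule len_interleave_le)
    fix p g assume "(p, g) \<in> set (tail_syllables E d as s)"
    from in_tail_syllables[OF this] show "p \<le> 2 * E \<and> len g \<le> K * len v" using assms(3-5) by auto
  qed
  also have "\<dots> = ((2 * length as + 3) * (2 * E + K) + E) * len v"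
    by (simp add: length_tail_syllables len_power_cyc[OF assms(1)] algebra_simps)
  finally have a: "len (interleave v (tail_syllables E d as s) (v ^ E)) \<le> ((2 * length as + 3) * (2 * E + K) + E) * len v" .
  have "len V \<le> len (v ^ (20 * Q)) + len d + len (interleave v (tail_syllables E d as s) (v ^ E))"
    unfolding V test_value_def using len_mult_le[of "v ^ (20 * Q) * d"] len_mult_le[of "v ^ (20 * Q)" d]
    by (meson add_le_mono1 le_trans)
  also have "\<dots> \<le> 20 * Q * len v + K * len v + ((2 * length as + 3) * (2 * E + K) + E) * len v"
    using a assms(3) by (simp add: len_power_cyc[OF assms(1)])
  also have "\<dots> \<le> 20 * Q * len v + Q * len v" by (simp add: Q scale_def algebra_simps)
  finally show "len V \<le> 21 * Q * len v" by simp
qed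

text \<open>Since \<open>x\<close> is at most half of \<open>V\<close>, it lies inside the first run of \<open>V\<close>, that is, it is a power of \<open>v\<close> followed by a prefix
  \<open>v1\<close> of \<open>v\<close>. Rotating \<open>V\<close> by \<open>x\<close> leaves nearly half of that run at the front, where it overlaps the first run of \<open>W\<close>.\<close>

lemma rotated_match:
  fixes v w :: "'a fg"
  assumes v: "cyc_reduced v" "v \<noteq> 1" and w: "cyc_reduced w" "w \<noteq> 1"
    and A: "len a \<le> K * len v" "len s \<le> K * len v" "\<And>x. x \<in> set as \<Longrightarrow> len x \<le> K * len v"
    and B: "len b \<le> K * len w" "len t \<le> K * len w" "\<And>x. x \<in> set bs \<Longrightarrow> len x \<le> K * len w"
    and nc: "\<not> comm a v" "\<not> comm b w"
    and l: "length as = length bs"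
    and E: "E = 4000 * (K + 2)" and Q: "Q = scale (length as) E K"
    and V: "V = test_value (20 * Q) E v a as s" and W: "W = test_value (20 * Q) E w b bs t"
    and xy: "wd V = x @ y" "wd W = y @ x" "length x \<le> length y"
  shows "\<exists>T. as = map (conj_by T) bs"
proof -
  have E2: "2 * K + 2 \<le> E" by (simp add: E)
  have Q': "Q = scale (length bs) E K" by (simp add: Q l)
  have QK: "K + 4001 \<le> Q" by (simp add: Q scale_def E)
  note Vp = test_value_props[OF v A E2 Q V] and Wp = test_value_props[OF w B E2 Q' W]
  have lenVW: "len V = length x + length y" "len W = length x + length y" using xy by (simp_all add: len_def)
  have "19 * Q * len v \<le> len V" "19 * Q * len w \<le> len W" using Vp(2) Wp(2) by (simp_all add: periodic_def)
  then have "19 * Q * len v \<le> 21 * Q * len w" "19 * Q * len w \<le> 21 * Q * len v"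
    using Vp(3) Wp(3) lenVW by linarith+
  then have "Q * (19 * len v) \<le> Q * (21 * len w)" "Q * (19 * len w) \<le> Q * (21 * len v)"
    by (simp_all only: ac_simps)
  moreover have "0 < Q" using QK by simp
  ultimately have "19 * len v \<le> 21 * len w" "19 * len w \<le> 21 * len v"
    by (simp_all only: nat_mult_le_cancel1)
  then have vw: "len v \<le> 2 * len w" "len w \<le> 2 * len v" by linarith+
  have lv: "len v > 0" "len w > 0" using v w by simp_all
  define k where "k = length x div len v"
  define v1 where "v1 = take (length x mod len v) (wd v)"
  define v2 where "v2 = drop (length x mod len v) (wd v)"
  have v12: "wd v = v1 @ v2" by (simp add: v1_def v2_def)
  have qlt: "length x mod len v < len v" using lv by simp
  then have lv1: "length v1 = length x mod len v" by (simp add: v1_def len_def)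
  have x2: "2 * length x \<le> 21 * Q * len v" using Vp(3) lenVW xy(3) by linarith
  have kx: "k * len v + length v1 = length x" by (simp add: k_def lv1)
  have "(2 * k) * len v \<le> (21 * Q) * len v" using x2 kx by linarith
  then have "2 * k \<le> 21 * Q" using lv(1) by (metis mult_le_cancel2)
  then have k11: "k \<le> 11 * Q" by linarith
  have xw: "x = concat (replicate k (wd v)) @ v1"
  proof (rule nth_equalityI)
    show "length x = length (concat (replicate k (wd v)) @ v1)"
      using kx by (simp add: length_concat_replicate len_def)
  next
    fix n assume n: "n < length x"
    then have "n < 19 * Q * len v" using x2 by simp
    then have "wd V ! n = wd v ! (n mod len v)" using Vp(2) by (simp add: periodic_def)
    then have xn: "x ! n = wd v ! (n mod len v)" using n xy(1) by (simp add: nth_append)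
    show "x ! n = (concat (replicate k (wd v)) @ v1) ! n"
    proof (cases "n < k * len v")
      case True
      then show ?thesis using xn
        by (simp add: nth_append nth_concat_replicate length_concat_replicate len_def)
    next
      case False
      let ?j = "n - k * len v"
      have j: "?j < length v1" using n kx False by linarith
      then have "?j < len v" using qlt lv1 by linarith
      moreover have "n = ?j + k * len v" using False by simp
      ultimately have "n mod len v = ?j" by (metis mod_less mod_mult_self1)
      moreover have "v1 ! ?j = wd v ! ?j" using j lv1 by (simp add: v1_def)
      ultimately show ?thesis using False xn
        by (simp add: nth_append length_concat_replicate len_def)
    qed
  qed
  have mkx: "mk x = v ^ k * mk v1"
  proof -
    have "mk (concat (replicate n (wd v))) = v ^ n" for n
      by (induction n) (simp_all add: mk_append)
    then show ?thesis by (simp add: xw mk_append)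
  qed
  let ?T = "mk v1"
  let ?v = "conj_by ?T v"
  have cv: "cyc_reduced ?v" "wd ?v = v2 @ v1" using cyc_rotate[OF v(1) v12] by simp_all
  have lv': "len ?v = len v" using cv(2) v12 by (simp add: len_def)
  have lT: "len ?T \<le> len v" using len_mk_le[of v1] lv1 qlt by linarith
  have lcj: "len (conj_by ?T z) \<le> (K + 2) * len ?v" if "len z \<le> K * len v" for z
    using len_conj_by_le[of ?T z] lT that by (simp add: lv')
  let ?p = "20 * Q - k"
  let ?tl = "tail_syllables E (conj_by ?T a) (map (conj_by ?T) as) (conj_by ?T s)"
  \<comment> \<open>The \<open>k\<close> full periods of \<open>x\<close> move from the front to the last run; only \<open>v1\<close> is used to conjugate, which keeps the
    separators short.\<close>
  have Weq: "W = ?v ^ ?p * conj_by ?T a * interleave ?v ?tl (?v ^ (E + k))"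
  proof -
    have "V = mk x * mk y" "W = mk y * mk x" using xy by (metis mk_append mk_wd)+
    then have "W = conj_by (mk x) V" by (simp add: conj_by_def mult.assoc)
    then have "W = conj_by ?T (conj_by (v ^ k) V)" by (simp add: mkx conj_by_conj_by)
    also have "conj_by (v ^ k) V = v ^ ?p * a * interleave v (tail_syllables E a as s) (v ^ (E + k))"
    proof -
      have "20 * Q = k + ?p" using k11 by simp
      then have "v ^ (20 * Q) = v ^ k * v ^ ?p" by (metis power_add)
      then show ?thesis by (simp add: V test_value_def conj_by_def power_add interleave_mult_right mult.assoc)
    qed
    finally show ?thesis by (simp add: conj_by_mult conj_by_interleave conj_by_power map_conj_by_tail_syllables)
  qed
  have v'1: "?v \<noteq> 1" using v(2) by simp
  have tp: "periodic ?v (?p * len ?v - (K + 2 + 1) * len ?v) W"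
    unfolding Weq by (rule tail_periodic[OF cv(1) v'1]) (use lcj A E in auto)
  have "3 * len v \<le> ?p * len ?v - (K + 2 + 1) * len ?v"
  proof -
    have "3 + (K + 3) \<le> ?p" using k11 QK by linarith
    then have "(3 + (K + 3)) * len v \<le> ?p * len v" by (rule mult_le_mono1)
    then show ?thesis by (simp add: lv' algebra_simps)
  qed
  then have p1: "periodic ?v (3 * len v) W" using periodic_mono[OF tp] by blast
  have "3 * len v \<le> 19 * Q * len w"
  proof -
    have "3 * len v \<le> 6 * len w" using vw by simp
    also have "\<dots> \<le> 19 * Q * len w" by (rule mult_le_mono1) (use QK in simp)
    finally show ?thesis .
  qed
  then have p2: "periodic w (3 * len v) W" using periodic_mono[OF Wp(2)] by blast
  have "wd ?v @ wd w = wd w @ wd ?v"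
    by (rule two_periods_commute[OF p1 p2]) (use vw lv' in simp)
  \<comment> \<open>Both periods are now powers of one element, which is cyclically reduced because they are.\<close>
  from common_root_of_words[OF this] obtain r i j where r: "?v = r ^ i" "w = r ^ j" by blast
  have r1: "r \<noteq> 1" using r(2) w(2) by auto
  have i1: "i \<ge> 1" using r(1) v'1 by (cases i) auto
  have j1: "j \<ge> 1" using r(2) w(2) by (cases j) auto
  have cr: "cyc_reduced r" using hd_last_power[OF r1 i1] cv(1) v'1 r1 unfolding r(1) by (simp add: cyc_reduced_def fg_power_eq_1)
  let ?G = "(K + 2) * (len v + len w)"
  have lr: "len r \<le> ?G"
  proof -
    have "len ?v = i * len r" using r(1) len_power_cyc[OF cr] by metis
    then have "len r \<le> len v" using i1 lv' by simp
    also have "\<dots> \<le> ?G" by simp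
    finally show ?thesis .
  qed
  have GA: "(K + 2) * len v \<le> ?G" "K * len w \<le> ?G" by (simp_all add: algebra_simps)
  have ncr: "\<not> comm (conj_by ?T a) r" "\<not> comm b r"
  proof -
    show "\<not> comm (conj_by ?T a) r"
    proof
      assume "comm (conj_by ?T a) r"
      then have "comm (conj_by ?T a) ?v" unfolding r(1) using comm_power_iff'[OF i1] by blast
      then show False using nc(1) by simp
    qed
    show "\<not> comm b r" using nc(2) comm_power_iff'[OF j1] r(2) by blast
  qed
  have "\<exists>\<phi>. map (conj_by ?T) as = map (conj_by \<phi>) bs"
  proof (rule aligned_match[OF cr r1 r ncr lr])
    show "len (conj_by ?T a) \<le> ?G" "len (conj_by ?T s) \<le> ?G" "len b \<le> ?G" "len t \<le> ?G"
      using lcj[OF A(1)] lcj[OF A(2)] B(1,2) GA unfolding lv' by linarith+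
    show "len z \<le> ?G" if zin: "z \<in> set (map (conj_by ?T) as) \<union> set bs" for z
    proof -
      consider z' where "z' \<in> set as" "z = conj_by ?T z'" | "z \<in> set bs" using zin by auto
      then show ?thesis
      proof cases
        case 1
        then show ?thesis using lcj[OF A(3)] GA unfolding lv' by fastforce
      next
        case 2
        then show ?thesis using B(3)[of z] GA by linarith
      qed
    qed
    have "1000 * ?G \<le> 1000 * ((K + 2) * (3 * len v))" using vw by (intro mult_le_mono2) simp
    also have "\<dots> \<le> E * len v" by (simp add: E algebra_simps)
    finally show "1000 * ?G \<le> E * len ?v" by (simp add: lv')
    have "1000 * ?G \<le> 1000 * ((K + 2) * (3 * len w))" using vw by (intro mult_le_mono2) simp
    also have "\<dots> \<le> E * len w" by (simp add: E algebra_simps)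
    finally show "1000 * ?G \<le> E * len w" .
    show "?v ^ ?p * conj_by ?T a * interleave ?v ?tl (?v ^ (E + k)) = w ^ (20 * Q) * b * interleave w (tail_syllables E b bs t) (w ^ E)"
      using Weq W by (simp add: test_value_def)
  qed (use l E in auto)
  then obtain \<phi> where "map (conj_by ?T) as = map (conj_by \<phi>) bs" by blast
  then have "map (conj_by (inverse ?T)) (map (conj_by ?T) as) = map (conj_by (inverse ?T)) (map (conj_by \<phi>) bs)" by simp
  then have "as = map (conj_by (\<phi> * inverse ?T)) bs" by (simp add: conj_by_conj_by comp_def)
  then show ?thesis by blast
qed

section \<open>Test words for tuples of elements\<close>

lemma ev_syllables:
  "ev f (concat (map (\<lambda>i. word_power E c @ var i @ word_power E c @ d) is)) * R =
    interleave (ev f c) (syllables E (ev f d) (map f is)) R"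
  by (induction "is") (simp_all add: mult.assoc)

lemma ev_syllables_trivial:
  "ev f c = 1 \<Longrightarrow> ev f (concat (map (\<lambda>i. word_power E c @ var i @ word_power E c @ d) is)) =
    ev f (concat (map (\<lambda>i. var i @ d) is))"
  by (induction "is") (simp_all add: mult.assoc)

lemma words_concat [simp]: "concat ws \<in> words m \<longleftrightarrow> set ws \<subseteq> words m"
  by (induction ws) auto

text \<open>The conjugator \<open>S\<close> is not asked to commute with \<open>ev g u\<close>: this follows from \<open>ev f u = ev g u\<close>.\<close>

theorem test_word:
  "\<exists>u\<in>words m. \<forall>f g :: nat \<Rightarrow> 'a fg. noncomm m g \<longrightarrow> ev f u = ev g u \<longrightarrow>
    noncomm m f \<and> (\<exists>S. \<forall>k<m. f k = conj_by S (g k))"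
proof -
  obtain c d where c: "c \<in> words m" and d: "d \<in> words m"
    and nc: "\<And>f :: nat \<Rightarrow> 'a fg. noncomm m f \<Longrightarrow> \<not> comm (ev f d) (ev f c) \<and> displacement_bound m f 3 (ev f c)"
    and triv: "\<And>f :: nat \<Rightarrow> 'a fg. \<not> noncomm m f \<Longrightarrow> ev f c = 1"
    using controlling_pair[of m, where 'a = 'a] by (metis (no_types, lifting))
  \<comment> \<open>When \<open>c\<close> is trivial, \<open>s\<close> cancels all other separators.\<close>
  define s where "s = inv_word (d @ d @ d @ concat (map (\<lambda>i. var i @ d) [0..<m]))"
  have s: "s \<in> words m" using d by (auto simp: s_def)
  define K where "K = 3 * (1 + 2 * length c) * (1 + length d + length s)"
  define E where "E = 4000 * (K + 2)"
  define Q where "Q = scale m E K"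
  define u where "u = word_power (20 * Q) c @ d @ word_power (2 * E) c @ d @ word_power E c @ d @
    concat (map (\<lambda>i. word_power E c @ var i @ word_power E c @ d) [0..<m]) @
    word_power E c @ s @ word_power E c"
  have u: "u \<in> words m" using c d s by (auto simp: u_def)
  have ev_u: "ev f u = test_value (20 * Q) E (ev f c) (ev f d) (map f [0..<m]) (ev f s)" for f :: "nat \<Rightarrow> 'a fg"
    by (simp add: u_def test_value_def tail_syllables_def interleave_append ev_syllables mult.assoc)
  have ev_u_trivial: "ev f u = 1" if "ev f c = 1" for f :: "nat \<Rightarrow> 'a fg"
    using that by (simp add: u_def s_def ev_syllables_trivial mult.assoc)
  have control: "\<exists>S. cyc_reduced (conj_by S (ev f c)) \<and> (\<forall>i<m. len (conj_by S (f i)) \<le> K * len (conj_by S (ev f c))) \<and>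
      len (conj_by S (ev f d)) \<le> K * len (conj_by S (ev f c)) \<and> len (conj_by S (ev f s)) \<le> K * len (conj_by S (ev f c))"
    if nf: "noncomm m f" for f :: "nat \<Rightarrow> 'a fg"
  proof -
    let ?K0 = "3 * (1 + 2 * length c)"
    obtain S where S: "cyc_reduced (conj_by S (ev f c))" "\<forall>i<m. len (conj_by S (f i)) \<le> ?K0 * len (conj_by S (ev f c))"
      using displacement_bound_control[OF conjunct2[OF nc[OF nf]] c] by blast
    let ?v = "conj_by S (ev f c)"
    have w: "len (conj_by S (ev f z)) \<le> K * len ?v" if "z \<in> words m" "length z \<le> 1 + length d + length s" for z
    proof -
      have "len (ev (\<lambda>i. conj_by S (f i)) z) \<le> length z * (?K0 * len ?v)"
        by (rule len_ev[OF that(1)]) (use S in blast)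
      also have "\<dots> \<le> (1 + length d + length s) * (?K0 * len ?v)" using that(2) by (rule mult_le_mono1)
      finally show ?thesis by (simp add: ev_conj_by K_def algebra_simps)
    qed
    have "len (conj_by S (f i)) \<le> K * len ?v" if "i < m" for i
      using w[of "var i"] that by (simp add: var_def) (simp add: words_def)
    then show ?thesis using S(1) w[OF d] w[OF s] by auto
  qed
  have main: "noncomm m f \<and> (\<exists>S. \<forall>k<m. f k = conj_by S (g k))" if ng: "noncomm m g" and eq: "ev f u = ev g u"
    for f g :: "nat \<Rightarrow> 'a fg"
  proof -
    obtain Sg where Sg: "cyc_reduced (conj_by Sg (ev g c))" "\<And>i. i < m \<Longrightarrow> len (conj_by Sg (g i)) \<le> K * len (conj_by Sg (ev g c))"
      "len (conj_by Sg (ev g d)) \<le> K * len (conj_by Sg (ev g c))" "len (conj_by Sg (ev g s)) \<le> K * len (conj_by Sg (ev g c))"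
      using control[OF ng] by blast
    have E2: "2 * K + 2 \<le> E" by (simp add: E_def)
    let ?w = "conj_by Sg (ev g c)" and ?b = "conj_by Sg (ev g d)" and ?t = "conj_by Sg (ev g s)"
      and ?bs = "map (\<lambda>i. conj_by Sg (g i)) [0..<m]"
    have w1: "?w \<noteq> 1" using nc[OF ng] by auto
    have W: "conj_by Sg (ev g u) = test_value (20 * Q) E ?w ?b ?bs ?t" by (simp add: ev_u conj_by_test_value comp_def)
    have Bs: "len x \<le> K * len ?w" if "x \<in> set ?bs" for x using that Sg(2) by auto
    have Q': "Q = scale (length ?bs) E K" by (simp add: Q_def)
    note Wp = test_value_props[OF Sg(1) w1 Sg(3,4) Bs E2 Q' W]
    have "Q \<ge> 1" by (simp add: Q_def scale_def)
    then have "19 * Q * len ?w > 0" using w1 by simp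
    then have W1: "ev g u \<noteq> 1" using Wp(2) by (auto simp: periodic_def)
    have nf: "noncomm m f" using ev_u_trivial[OF triv] W1 eq by metis
    obtain Sf where Sf: "cyc_reduced (conj_by Sf (ev f c))" "\<And>i. i < m \<Longrightarrow> len (conj_by Sf (f i)) \<le> K * len (conj_by Sf (ev f c))"
      "len (conj_by Sf (ev f d)) \<le> K * len (conj_by Sf (ev f c))" "len (conj_by Sf (ev f s)) \<le> K * len (conj_by Sf (ev f c))"
      using control[OF nf] by blast
    let ?v = "conj_by Sf (ev f c)" and ?a = "conj_by Sf (ev f d)" and ?s = "conj_by Sf (ev f s)"
      and ?as = "map (\<lambda>i. conj_by Sf (f i)) [0..<m]"
    have v1: "?v \<noteq> 1" using nc[OF nf] by auto
    have V: "conj_by Sf (ev f u) = test_value (20 * Q) E ?v ?a ?as ?s" by (simp add: ev_u conj_by_test_value comp_def)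
    have As: "len x \<le> K * len ?v" if "x \<in> set ?as" for x using that Sf(2) by auto
    have Q'': "Q = scale (length ?as) E K" by (simp add: Q_def)
    note Vp = test_value_props[OF Sf(1) v1 Sf(3,4) As E2 Q'' V]
    have e: "conj_by (inverse Sf * Sg) (conj_by Sf (ev f u)) = conj_by Sg (ev g u)"
      by (simp only: conj_by_conj_by) (simp add: eq)
    then obtain n where n: "wd (conj_by Sg (ev g u)) = rotate n (wd (conj_by Sf (ev f u)))"
      using conj_rotate[OF Vp(1), of "inverse Sf * Sg"] Wp(1) by auto
    let ?l = "wd (conj_by Sf (ev f u))"
    let ?x = "take (n mod length ?l) ?l" and ?y = "drop (n mod length ?l) ?l"
    have xy: "?l = ?x @ ?y" "wd (conj_by Sg (ev g u)) = ?y @ ?x"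
      using n by (simp_all add: rotate_drop_take)
    have na: "\<not> comm ?a ?v" "\<not> comm ?b ?w" using nc[OF nf] nc[OF ng] by simp_all
    have "\<exists>T. ?as = map (conj_by T) ?bs"
    \<comment> \<open>Exchanging the tuples exchanges the two parts of the rotation.\<close>
    proof (cases "length ?x \<le> length ?y")
      case True
      show ?thesis
        by (rule rotated_match[OF Sf(1) v1 Sg(1) w1 Sf(3,4) As Sg(3,4) Bs na _ E_def Q'' V W xy True]) simp_all
    next
      case False
      then have "length ?y \<le> length ?x" by simp
      from rotated_match[OF Sg(1) w1 Sf(1) v1 Sg(3,4) Bs Sf(3,4) As na(2,1) _ E_def Q' W V xy(2,1) this]
      obtain T where T: "?bs = map (conj_by T) ?as" by auto
      have "?as = map (conj_by (inverse T)) (map (conj_by T) ?as)" by (simp add: conj_by_conj_by comp_def mult.assoc)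
      also have "\<dots> = map (conj_by (inverse T)) ?bs" unfolding T ..
      finally show ?thesis by blast
    qed
    then obtain T where T: "?as = map (conj_by T) ?bs" by blast
    have "f k = conj_by (Sg * T * inverse Sf) (g k)" if "k < m" for k
    proof -
      have "conj_by Sf (f k) = conj_by T (conj_by Sg (g k))" using T that by (simp add: comp_def)
      then have "conj_by (inverse Sf) (conj_by Sf (f k)) = conj_by (inverse Sf) (conj_by T (conj_by Sg (g k)))" by simp
      then show ?thesis by (simp add: conj_by_conj_by mult.assoc)
    qed
    then show ?thesis using nf by blast
  qed
  then show ?thesis using u by blast
qed

section \<open>Cyclic subgroups\<close>

text \<open>The power of \<open>e\<close> with the least positive exponent generates, by division with remainder.\<close>

lemma (in group) subgroup_of_cyclic:
  assumes H: "subgroup H G" and e: "e \<in> carrier G" and sub: "H \<subseteq> generate G {e}"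
  shows "cyclic_group (G\<lparr>carrier := H\<rparr>)"
proof -
  interpret H: subgroup H G by (rule H)
  interpret GH: group "G\<lparr>carrier := H\<rparr>" by (rule subgroup_imp_group[OF H])
  have gen: "generate G {e} = range (\<lambda>k::int. e [^] k)" using generate_pow[OF e] by auto
  have "\<exists>h\<in>H. H \<subseteq> range (\<lambda>k::int. h [^] k)"
  proof (cases "\<exists>n::nat. 0 < n \<and> e [^] (int n) \<in> H")
    case False
    have "x = \<one>" if x: "x \<in> H" for x
    proof -
      obtain k :: int where k: "x = e [^] k" using x sub gen by auto
      have neg: "e [^] (- k) \<in> H" using x k e by (simp add: int_pow_neg)
      have "k = 0"
      proof (rule ccontr)
        assume "k \<noteq> 0"
        then consider "0 < nat k" "int (nat k) = k" | "0 < nat (- k)" "int (nat (- k)) = - k"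
          by (cases "0 < k") auto
        then show False using False x k neg by cases metis+
      qed
      then show ?thesis using k by simp
    qed
    then show ?thesis by (intro bexI[of _ \<one>]) (auto intro!: image_eqI[of _ _ 0])
  next
    case True
    define n where "n = (LEAST n::nat. 0 < n \<and> e [^] (int n) \<in> H)"
    have n: "0 < n" "e [^] (int n) \<in> H" using LeastI_ex[OF True] by (auto simp: n_def)
    have least: "n \<le> n'" if "0 < n'" "e [^] (int n') \<in> H" for n' :: nat
      unfolding n_def using that by (intro Least_le) simp
    have pow_H: "(e [^] (int n)) [^] q \<in> H" for q :: int
      using GH.int_pow_closed[of "e [^] (int n)" q] n(2) int_pow_consistent[OF H n(2)] by simp
    have "x \<in> range (\<lambda>k::int. (e [^] (int n)) [^] k)" if x: "x \<in> H" for x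
    proof -
      obtain k :: int where k: "x = e [^] k" using x sub gen by auto
      let ?q = "k div int n" and ?r = "k mod int n"
      have kq: "k = int n * ?q + ?r" by simp
      have "x = (e [^] (int n)) [^] ?q \<otimes> e [^] ?r"
        using e by (subst k, subst kq) (simp only: int_pow_mult int_pow_pow)
      then have "e [^] ?r = inv ((e [^] (int n)) [^] ?q) \<otimes> x"
        using e by (simp add: inv_solve_left)
      then have rH: "e [^] ?r \<in> H" using pow_H[of ?q] x by simp
      have r0: "0 \<le> ?r" "?r < int n" using n(1) by simp_all
      have "?r = 0"
      proof (rule ccontr)
        assume "?r \<noteq> 0"
        then have "0 < nat ?r" "int (nat ?r) = ?r" using r0 by simp_all
        then have "n \<le> nat ?r" using least[of "nat ?r"] rH by simp
        then show False using r0 by linarith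
      qed
      then have "k = int n * ?q" using kq by simp
      then have "x = (e [^] (int n)) [^] ?q" using e k by (metis int_pow_pow)
      then show ?thesis by blast
    qed
    then show ?thesis using n(2) by blast
  qed
  then obtain h where h: "h \<in> H" "H \<subseteq> range (\<lambda>k::int. h [^] k)" by blast
  have "range (\<lambda>k::int. h [^]\<^bsub>G\<lparr>carrier := H\<rparr>\<^esub> k) \<subseteq> H"
    using GH.int_pow_closed h(1) by auto
  then have "carrier (G\<lparr>carrier := H\<rparr>) = range (\<lambda>k::int. h [^]\<^bsub>G\<lparr>carrier := H\<rparr>\<^esub> k)"
    using h int_pow_consistent[OF H h(1)] by auto
  then show ?thesis using GH.cyclic_group h(1) by auto
qed

section \<open>Commuting families\<close>

lemma powers_one [simp]: "1 \<in> powers e" and powers_self [simp]: "e \<in> powers e"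
proof -
  have "1 = e ^ 0" "e = e ^ 1" by simp_all
  then show "1 \<in> powers e" "e \<in> powers e" unfolding powers_def by blast+
qed

lemma powers_mult:
  assumes "x \<in> powers e" "y \<in> powers e"
  shows "x * y \<in> powers e"
proof -
  obtain a b where a: "x = e ^ a \<or> x = inverse e ^ a" and b: "y = e ^ b \<or> y = inverse e ^ b"
    using assms by (auto simp: powers_def)
  have q: "inverse e ^ a * e ^ b \<in> powers e" using powers_quotient[of e a b] by (simp add: fg_inverse_power)
  have q': "e ^ a * inverse e ^ b \<in> powers e"
    using powers_quotient[of "inverse e" a b] by (simp add: fg_inverse_power) (auto simp: powers_def)
  consider "x * y = e ^ (a + b)" | "x * y = inverse e ^ (a + b)" | "x * y = inverse e ^ a * e ^ b"
    | "x * y = e ^ a * inverse e ^ b" using a b by (auto simp: power_add)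
  then show ?thesis using q q' by cases (auto simp: powers_def)
qed

lemma powers_power: "x \<in> powers e \<Longrightarrow> x ^ n \<in> powers e"
  by (induction n) (auto intro: powers_mult)

lemma powers_trans: "x \<in> powers y \<Longrightarrow> y \<in> powers z \<Longrightarrow> x \<in> powers z"
  using powers_power powers_inverse unfolding powers_def[of y] by blast

lemma commuting_family:
  assumes "\<not> noncomm m f"
  shows "\<exists>e. \<forall>k<m. f k \<in> powers e"
proof -
  have "\<exists>e. \<forall>k<n. f k \<in> powers e" if "n \<le> m" for n
    using that
  proof (induction n)
    case (Suc n)
    then obtain e where e: "\<forall>k<n. f k \<in> powers e" by auto
    show ?case
    proof (cases "\<exists>k<n. f k \<noteq> 1")
      case True
      then obtain k where k: "k < n" "f k \<noteq> 1" by blast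
      have "comm (f k) (f n)" using assms k(1) Suc.prems by (auto simp: noncomm_def)
      then have "comm e (f n)" using powers_root_comm e k by blast
      then obtain e' where e': "e \<in> powers e'" "f n \<in> powers e'" using common_root by blast
      have "f j \<in> powers e'" if "j < Suc n" for j
        using that e e' powers_trans[of "f j" e e'] by (auto simp: less_Suc_eq)
      then show ?thesis by blast
    next
      case False
      have "f j \<in> powers (f n)" if "j < Suc n" for j
        using that False by (auto simp: less_Suc_eq)
      then show ?thesis by blast
    qed
  qed simp
  then show ?thesis by blast
qed

lemma ev_powers: "w \<in> words m \<Longrightarrow> \<forall>k<m. f k \<in> powers e \<Longrightarrow> ev f w \<in> powers e"
  by (induction w) (auto simp: words_def intro!: powers_mult powers_inverse)

section \<open>Retraction\<close>

lemma ev_cons_reduce: "ev f (cons_reduce a w) = ev f (a # w)"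
  by (cases w) (auto simp: inv_letter_def)

lemma ev_foldr_cons_reduce: "ev f (foldr cons_reduce v w) = ev f v * ev f w"
  by (induction v) (simp_all add: ev_cons_reduce mult.assoc)

lemma ev_wd_mk [simp]: "ev f (wd (mk w)) = ev f w"
  by (simp add: wd_mk ev_foldr_cons_reduce)

lemma ev_wd_mult: "ev f (wd (x * y)) = ev f (wd x) * ev f (wd y)"
  by (simp add: wd_times ev_foldr_cons_reduce)

lemma ev_wd_inverse: "ev f (wd (inverse x)) = inverse (ev f (wd x))"
  by (simp add: wd_inverse)

lemma ev_wd_power: "ev f (wd (x ^ n)) = ev f (wd x) ^ n"
  by (induction n) (simp_all add: ev_wd_mult)

text \<open>Sending the generators outside \<open>{..<m}\<close> to 1 fixes the words in the remaining ones. This brings conjugators and roots, found in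
  the free group on all natural numbers, back to rank \<open>m\<close>.\<close>

definition retract :: "nat \<Rightarrow> nat fg \<Rightarrow> nat fg" where
  "retract m x = ev (\<lambda>i. if i < m then mk (generator i) else 1) (wd x)"

lemma retract_mult: "retract m (x * y) = retract m x * retract m y"
  and retract_inverse: "retract m (inverse x) = inverse (retract m x)"
  and retract_conj_by: "retract m (conj_by T x) = conj_by (retract m T) (retract m x)"
  by (simp_all add: retract_def ev_wd_mult ev_wd_inverse conj_by_def)

lemma retract_powers: "x \<in> powers e \<Longrightarrow> retract m x \<in> powers (retract m e)"
  unfolding powers_def by (auto simp: retract_def ev_wd_power ev_wd_inverse)

lemma mk_Cons: "mk (a # w) = mk [a] * mk w"
  using mk_append[of "[a]" w] by simp

lemma mk_letter: "mk [a] = (if snd a then mk (generator (fst a)) else inverse (mk (generator (fst a))))"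
proof (cases "snd a")
  case True
  then show ?thesis by (cases a) (simp add: generator_def)
next
  case False
  then have "[a] = inv_word (generator (fst a))" by (cases a) (simp add: generator_def inv_letter_def)
  then show ?thesis using False mk_inv_word by metis
qed

lemma retract_words: "w \<in> words m \<Longrightarrow> retract m (mk w) = mk w"
proof -
  assume "w \<in> words m"
  then have "ev (\<lambda>i. if i < m then mk (generator i) else 1) w = mk w"
  proof (induction w)
    case (Cons a w)
    then have "w \<in> words m" "fst a < m" by (auto simp: words_def)
    then show ?case using Cons.IH by (subst mk_Cons) (simp add: mk_letter)
  qed simp
  then show ?thesis by (simp add: retract_def)
qed

lemma wd_mult_words: "wd x \<in> words m \<Longrightarrow> wd y \<in> words m \<Longrightarrow> wd (x * y) \<in> words m"
  using set_foldr_cons_reduce[of "wd x" "wd y"] by (fastforce simp: words_def wd_times)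

lemma wd_inverse_words: "wd x \<in> words m \<Longrightarrow> wd (inverse x) \<in> words m"
  by (simp add: wd_inverse)

lemma wd_retract: "wd (retract m x) \<in> words m"
proof -
  have "wd (ev (\<lambda>i. if i < m then mk (generator i) else 1) w) \<in> words m" for w
  proof (induction w)
    case (Cons a w)
    have "wd (mk (generator i)) \<in> words m" if "i < m" for i
      using that by (simp add: generator_def words_def)
    then show ?case using Cons by (auto intro!: wd_mult_words wd_inverse_words)
  qed simp
  then show ?thesis by (simp add: retract_def)
qed

section \<open>The free group on a finite set\<close>

lemma carrier_free_group: "w \<in> carrier (free_group {..<m}) \<longleftrightarrow> w \<in> words m \<and> reduced w"
  by (auto simp: free_group_def words_def)

lemma mk_mult:
  fixes m :: nat
  assumes "v \<in> carrier (free_group {..<m})" "w \<in> carrier (free_group {..<m})"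
  shows "mk (v \<otimes>\<^bsub>free_group {..<m}\<^esub> w) = mk v * mk w"
proof -
  have "v \<otimes>\<^bsub>free_group {..<m}\<^esub> w = wd (mk v * mk w)"
    using assms by (simp add: carrier_free_group wd_times) (simp add: free_group_def)
  then show ?thesis by simp
qed

lemma mk_one:
  fixes m :: nat
  shows "mk \<one>\<^bsub>free_group {..<m}\<^esub> = 1"
  by (simp add: free_group_def)

lemma mk_inv:
  fixes m :: nat
  assumes "w \<in> carrier (free_group {..<m})"
  shows "mk (inv\<^bsub>free_group {..<m}\<^esub> w) = inverse (mk w)"
proof -
  interpret group "free_group {..<m}" by (rule group_free_group)
  have "mk w * mk (inv\<^bsub>free_group {..<m}\<^esub> w) = 1"
    using assms mk_mult[of w m "inv\<^bsub>free_group {..<m}\<^esub> w"] mk_one[of m] by simp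
  then show ?thesis by (metis fg_inverse_unique)
qed

lemma mk_inject:
  fixes m :: nat
  assumes "v \<in> carrier (free_group {..<m})" "w \<in> carrier (free_group {..<m})" "mk v = mk w"
  shows "v = w"
proof -
  have "v = wd (mk v)" using assms(1) by (simp add: carrier_free_group)
  also have "\<dots> = wd (mk w)" by (simp only: assms(3))
  also have "\<dots> = w" using assms(2) by (simp add: carrier_free_group)
  finally show ?thesis .
qed

lemma mk_hom:
  assumes h: "h \<in> hom (free_group {..<m}) (free_group {..<m})" and w: "w \<in> carrier (free_group {..<m})"
  shows "mk (h w) = ev (\<lambda>i. mk (h (generator i))) w"
proof -
  let ?F = "free_group {..<m}"
  interpret group ?F by (rule group_free_group)
  have hg: "(\<lambda>x. h (generator x)) \<in> {..<m} \<rightarrow> carrier ?F"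
    using h by (auto simp: hom_def generator_in_carrier Pi_iff)
  have "mk (word_value ?F (\<lambda>x. h (generator x)) w) = ev (\<lambda>i. mk (h (generator i))) w" if "w \<in> words m" for w
    using that
  proof (induction w)
    case Nil
    then show ?case by (simp add: word_value_def mk_one)
  next
    case (Cons a w)
    then have w: "w \<in> words m" "fst a < m" by (auto simp: words_def)
    let ?l = "letter_value ?F (\<lambda>x. h (generator x)) a" and ?v = "word_value ?F (\<lambda>x. h (generator x)) w"
    have c: "?l \<in> carrier ?F" "?v \<in> carrier ?F"
      using letter_value_closed[OF hg, of a] word_value_closed[OF hg, of w] w by (auto simp: words_def)
    have hc: "h (generator (fst a)) \<in> carrier ?F" using hg w(2) by auto
    have "word_value ?F (\<lambda>x. h (generator x)) (a # w) = ?l \<otimes>\<^bsub>?F\<^esub> ?v" by (simp add: word_value_def)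
    then show ?case using mk_mult[OF c] Cons.IH[OF w(1)] mk_inv[OF hc] by (simp add: letter_value_def)
  qed
  then show ?thesis using hom_free_group_eq_word_value[OF h w] w by (simp add: carrier_free_group)
qed

lemma generate_of_powers:
  fixes m :: nat
  assumes e: "e \<in> carrier (free_group {..<m})" and w: "w \<in> carrier (free_group {..<m})"
    and "mk w \<in> powers (mk e)"
  shows "w \<in> generate (free_group {..<m}) {e}"
proof -
  let ?F = "free_group {..<m}"
  interpret group ?F by (rule group_free_group)
  have p: "mk (e [^]\<^bsub>?F\<^esub> n) = mk e ^ n" for n :: nat
    by (induction n) (simp_all add: mk_one mk_mult e power_commutes)
  obtain n where "mk w = mk e ^ n \<or> mk w = inverse (mk e) ^ n" using assms(3) by (auto simp: powers_def)
  then have "mk w = mk (e [^]\<^bsub>?F\<^esub> (int n)) \<or> mk w = mk (e [^]\<^bsub>?F\<^esub> (- int n))"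
    using e by (simp add: int_pow_neg int_pow_int mk_inv p fg_inverse_power)
  then have "w = e [^]\<^bsub>?F\<^esub> (int n) \<or> w = e [^]\<^bsub>?F\<^esub> (- int n)"
    using mk_inject[OF w] e by (metis int_pow_closed)
  then show ?thesis using generate_pow[OF e] by auto
qed

lemma cyclic_of_powers:
  fixes m :: nat
  assumes H: "subgroup H (free_group {..<m})" and e: "\<And>w. w \<in> H \<Longrightarrow> mk w \<in> powers e"
  shows "cyclic_group ((free_group {..<m})\<lparr>carrier := H\<rparr>)"
proof -
  let ?F = "free_group {..<m}"
  interpret group ?F by (rule group_free_group)
  let ?e = "wd (retract m e)"
  have ec: "?e \<in> carrier ?F" by (simp add: carrier_free_group wd_retract)
  have "H \<subseteq> generate ?F {?e}"
  proof
    fix w assume w: "w \<in> H"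
    then have wc: "w \<in> carrier ?F" using subgroup.subset[OF H] by blast
    have "retract m (mk w) \<in> powers (retract m e)" using e[OF w] by (rule retract_powers)
    then have "mk w \<in> powers (mk ?e)" using wc by (simp add: retract_words carrier_free_group)
    then show "w \<in> generate ?F {?e}" by (rule generate_of_powers[OF ec wc])
  qed
  then show ?thesis by (rule subgroup_of_cyclic[OF H ec])
qed

text \<open>Pairwise commuting elements, finite in number, are powers of a single element.\<close>

lemma cyclic_image_iff:
  assumes h: "h \<in> hom (free_group {..<m}) (free_group {..<m})"
  shows "cyclic_group ((free_group {..<m})\<lparr>carrier := h ` carrier (free_group {..<m})\<rparr>) \<longleftrightarrow>
    \<not> noncomm m (\<lambda>i. mk (h (generator i)))"
proof -
  let ?F = "free_group {..<m}"
  let ?f = "\<lambda>i. mk (h (generator i))"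
  interpret group ?F by (rule group_free_group)
  interpret h: group_hom ?F ?F h using h by unfold_locales
  have H: "subgroup (h ` carrier ?F) ?F" by (rule h.img_is_subgroup)
  show ?thesis
  proof
    assume c: "cyclic_group (?F\<lparr>carrier := h ` carrier ?F\<rparr>)"
    have "comm_group (?F\<lparr>carrier := h ` carrier ?F\<rparr>)"
      by (rule group.cyclic_imp_abelian_group[OF subgroup_imp_group[OF H] c])
    then interpret A: comm_group "?F\<lparr>carrier := h ` carrier ?F\<rparr>" .
    have "comm (?f i) (?f j)" if "i < m" "j < m" for i j
    proof -
      have g: "generator i \<in> carrier ?F" "generator j \<in> carrier ?F" using that by (simp_all add: generator_in_carrier)
      then have "h (generator i) \<otimes>\<^bsub>?F\<^esub> h (generator j) = h (generator j) \<otimes>\<^bsub>?F\<^esub> h (generator i)"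
        using A.m_comm[of "h (generator i)" "h (generator j)"] by simp
      then show ?thesis using g by (metis comm_def h.hom_closed mk_mult)
    qed
    then show "\<not> noncomm m ?f" by (auto simp: noncomm_def)
  next
    assume "\<not> noncomm m ?f"
    then obtain e where e: "\<forall>k<m. ?f k \<in> powers e" using commuting_family by blast
    show "cyclic_group (?F\<lparr>carrier := h ` carrier ?F\<rparr>)"
    proof (rule cyclic_of_powers[OF H])
      fix w assume "w \<in> h ` carrier ?F"
      then obtain x where x: "x \<in> carrier ?F" "w = h x" by blast
      then show "mk w \<in> powers e" using mk_hom[OF h x(1)] ev_powers[OF _ e] by (simp add: carrier_free_group)
    qed
  qed
qed

theorem corollary1:
  fixes m :: nat and F :: "nat letter list monoid"
  assumes "m \<ge> 2" and "F = free_group {..<m}"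
  shows "\<exists>u\<in>carrier F. \<forall>\<phi>\<in>hom F F. \<forall>\<psi>\<in>hom F F.
    \<not> cyclic_group (F\<lparr>carrier := \<psi> ` carrier F\<rparr>) \<longrightarrow> \<phi> u = \<psi> u \<longrightarrow>
      \<not> cyclic_group (F\<lparr>carrier := \<phi> ` carrier F\<rparr>) \<and>
      (\<exists>S\<in>carrier F. cyclic_group (subgroup_generated F {S, \<psi> u}) \<and>
        (\<forall>x\<in>carrier F. \<phi> x = inner_automorphism F S (\<psi> x)))"
proof -
  interpret F: group F unfolding assms(2) by (rule group_free_group)
  obtain t where t: "t \<in> words m"
    and test: "\<And>f g :: nat \<Rightarrow> nat fg. noncomm m g \<Longrightarrow> ev f t = ev g t \<Longrightarrow>
      noncomm m f \<and> (\<exists>S. \<forall>k<m. f k = conj_by S (g k))"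
    using test_word[of m, where 'a = nat] by blast
  define u where "u = wd (mk t)"
  have "set u \<subseteq> set t" using set_foldr_cons_reduce[of t "[]"] by (simp add: u_def wd_mk)
  then have u: "u \<in> carrier F"
    using t by (auto simp: u_def assms(2) carrier_free_group words_def)
  show ?thesis
  proof (intro bexI[OF _ u] ballI impI)
    fix \<phi> \<psi>
    assume \<phi>: "\<phi> \<in> hom F F" and \<psi>: "\<psi> \<in> hom F F" and eq: "\<phi> u = \<psi> u"
      and nc: "\<not> cyclic_group (F\<lparr>carrier := \<psi> ` carrier F\<rparr>)"
    let ?f = "\<lambda>i. mk (\<phi> (generator i))" and ?g = "\<lambda>i. mk (\<psi> (generator i))"
    have ng: "noncomm m ?g" using nc cyclic_image_iff[of \<psi> m] \<psi> by (simp add: assms(2))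
    have f: "mk (\<phi> x) = ev ?f x" and g: "mk (\<psi> x) = ev ?g x" if "x \<in> carrier F" for x
      using mk_hom that \<phi> \<psi> unfolding assms(2) by blast+
    have "ev ?f t = ev ?g t" using f[OF u] g[OF u] eq by (simp add: u_def)
    from test[OF ng this] obtain T where nf: "noncomm m ?f" and T: "\<And>k. k < m \<Longrightarrow> ?f k = conj_by T (?g k)" by blast
    let ?T = "retract m T"
    define S where "S = wd (inverse ?T)"
    have S: "S \<in> carrier F"
      by (simp add: S_def assms(2) carrier_free_group wd_inverse_words wd_retract)
    have mS: "mk S = inverse ?T" by (simp add: S_def)
    have \<phi>c: "\<phi> x \<in> carrier F" and \<psi>c: "\<psi> x \<in> carrier F" if "x \<in> carrier F" for x
      using \<phi> \<psi> that by (auto simp: hom_def)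
    have ret: "retract m (mk x) = mk x" if "x \<in> carrier F" for x
      using that by (simp add: assms(2) carrier_free_group retract_words)
    have gen: "generator k \<in> carrier F" if "k < m" for k
      using that by (simp add: assms(2) generator_in_carrier)
    have T': "?f k = conj_by ?T (?g k)" if "k < m" for k
      using arg_cong[OF T[OF that], of "retract m"] ret[OF \<phi>c[OF gen[OF that]]] ret[OF \<psi>c[OF gen[OF that]]]
      by (simp add: retract_conj_by)
    have conj: "mk (\<phi> x) = conj_by ?T (mk (\<psi> x))" if "x \<in> carrier F" for x
    proof -
      have "x \<in> words m" using that by (simp add: assms(2) carrier_free_group)
      then have "ev ?f x = ev (\<lambda>i. conj_by ?T (?g i)) x" by (rule ev_cong) (rule T')
      then show ?thesis using f g that by (simp add: ev_conj_by)
    qed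
    have inner: "\<phi> x = inner_automorphism F S (\<psi> x)" if x: "x \<in> carrier F" for x
    proof -
      have c: "S \<otimes>\<^bsub>F\<^esub> \<psi> x \<in> carrier F" "inv\<^bsub>F\<^esub> S \<in> carrier F" using S \<psi>c[OF x] by auto
      have "mk (inner_automorphism F S (\<psi> x)) = mk S * mk (\<psi> x) * inverse (mk S)"
        using mk_mult[of "S \<otimes>\<^bsub>F\<^esub> \<psi> x" m "inv\<^bsub>F\<^esub> S"] mk_mult[of S m "\<psi> x"] mk_inv[of S m] c S \<psi>c[OF x]
        by (simp add: inner_automorphism_def assms(2))
      also have "\<dots> = mk (\<phi> x)" using conj[OF x] by (simp add: mS conj_by_def)
      finally show ?thesis
        using mk_inject[of "\<phi> x" m "inner_automorphism F S (\<psi> x)"] \<phi>c[OF x] F.m_closed[OF c]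
        by (simp add: inner_automorphism_def assms(2))
    qed
    have "comm ?T (mk (\<psi> u))"
      using conj[OF u] eq unfolding comm_def conj_by_def by (metis fg_right_inverse_mult mult.assoc)
    then have "comm (mk S) (mk (\<psi> u))" by (simp add: mS)
    then obtain e where e: "mk S \<in> powers e" "mk (\<psi> u) \<in> powers e" using common_root by blast
    have cyc: "cyclic_group (subgroup_generated F {S, \<psi> u})"
    proof -
      have gs: "{S, \<psi> u} \<subseteq> carrier F" using S \<psi>c[OF u] by blast
      let ?H = "generate F {S, \<psi> u}"
      have H: "subgroup ?H F" by (rule F.generate_is_subgroup[OF gs])
      have "mk w \<in> powers e" if "w \<in> ?H" for w
        using that
      proof (induction rule: generate.induct)
        case one
        then show ?case by (simp add: assms(2) mk_one)
      next
        case (incl h)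
        then show ?case using e by auto
      next
        case (inv h)
        then have "mk (inv\<^bsub>F\<^esub> h) = inverse (mk h)" using gs mk_inv[of h m] by (auto simp: assms(2))
        then show ?case using inv e powers_inverse by auto
      next
        case (eng h1 h2)
        then have "h1 \<in> carrier F" "h2 \<in> carrier F" using F.generate_in_carrier[OF gs] by blast+
        then have "mk (h1 \<otimes>\<^bsub>F\<^esub> h2) = mk h1 * mk h2" using mk_mult by (simp add: assms(2))
        then show ?case using eng powers_mult by simp
      qed
      then have "cyclic_group (F\<lparr>carrier := ?H\<rparr>)"
        using cyclic_of_powers H unfolding assms(2) by blast
      moreover have "subgroup_generated F {S, \<psi> u} = F\<lparr>carrier := ?H\<rparr>"
        using gs by (simp add: subgroup_generated_def Int_absorb1)
      ultimately show ?thesis by simp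
    qed
    have "\<not> cyclic_group (F\<lparr>carrier := \<phi> ` carrier F\<rparr>)"
      using cyclic_image_iff[of \<phi> m] \<phi> nf by (simp add: assms(2))
    then show "\<not> cyclic_group (F\<lparr>carrier := \<phi> ` carrier F\<rparr>) \<and>
      (\<exists>S\<in>carrier F. cyclic_group (subgroup_generated F {S, \<psi> u}) \<and>
        (\<forall>x\<in>carrier F. \<phi> x = inner_automorphism F S (\<psi> x)))"
      using S cyc inner by blast
  qed
qed

end
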